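(* Let $\Omega=B_1\subset\mathbb{R}^n$, with $n\ge2$. Let $\Gamma\subset B_1$ be a smooth closed hypersurface such that $\Gamma\cap B_{1/2}=\{x_n=0\}\cap B_{1/2}$. Consider the continuous function $\eta:(-1/2,1/2)\to\mathbb{R}$ given by $$\eta(t)=\begin{cases}\dfrac{1}{|\log t|}& \text{for } t\in(0,1/2),\\[1ex] 0&\text{for } t\in(-1/2,0],\end{cases}$$ and let $g:\Gamma\to\mathbb{R}$ be any function on $\Gamma$, smooth outside $\Gamma\cap B_{1/2}$, and such that $$g(x)=\eta(x_1)\quad\text{for } x\in\Gamma\cap B_{1/2}.$$ Then the unique weak solution $u$ to $$\Delta u=g\,dH^{n-1}|_\Gamma\ \text{ in }\Omega,\qquad u=0\ \text{ on }\partial\Omega,$$ is not locally Lipschitz in $B_1$.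
   Context: $B_r\subset\mathbb{R}^n$ is the open ball of radius $r$ centered at $0$. A closed hypersurface is a compact hypersurface without boundary. $dH^{n-1}|_\Gamma$ is the Hausdorff measure restricted to $\Gamma$. Weak solution: $u\in C(\overline\Omega)$ with $u=0$ on $\partial\Omega$ and $\int_\Omega u\Delta\varphi\,dx=\int_\Gamma g\varphi\,dH^{n-1}$ for all $\varphi\in C_c^\infty(\Omega)$. *)

theory Defs
  imports "HOL-Analysis.Analysis"
begin

subsection \<open>Hausdorff measure\<close>

text \<open>Normalised so that the \<open>s\<close>-dimensional Hausdorff measure agrees with Lebesgue measure on
  \<open>s\<close>-dimensional planes. The empty set is singled out only because of \<open>0 ^ 0 = 1\<close>.\<close>

definition hausdorff_gauge :: "nat \<Rightarrow> 'a::metric_space set \<Rightarrow> ennreal" where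
  "hausdorff_gauge s C =
     (if C = {} then 0 else ennreal (unit_ball_vol (real s) * (diameter C / 2) ^ s))"

text \<open>\<open>diameter\<close> is meaningful for bounded sets only, hence the explicit boundedness.\<close>

definition hausdorff_content :: "nat \<Rightarrow> real \<Rightarrow> 'a::metric_space set \<Rightarrow> ennreal" where
  "hausdorff_content s \<delta> A =
     (INF C \<in> {C :: nat \<Rightarrow> 'a set. A \<subseteq> (\<Union>i. C i) \<and> (\<forall>i. bounded (C i) \<and> diameter (C i) \<le> \<delta>)}.
        \<Sum>i. hausdorff_gauge s (C i))"

definition hausdorff_outer :: "nat \<Rightarrow> 'a::metric_space set \<Rightarrow> ennreal" where
  "hausdorff_outer s A = (SUP \<delta> \<in> {0<..}. hausdorff_content s \<delta> A)"

text \<open>\<open>hausdorff_outer s\<close> is a metric outer measure, hence countably additive on the Borel sets,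
  so that \<open>measure_of\<close> does not fall back to the zero measure.\<close>

definition hausdorff_measure :: "nat \<Rightarrow> 'a::metric_space measure" where
  "hausdorff_measure s = measure_of UNIV (sets borel) (hausdorff_outer s)"


subsection \<open>Smooth functions and test functions\<close>

definition partial_deriv :: "'a::euclidean_space \<Rightarrow> ('a \<Rightarrow> 'b::real_normed_vector) \<Rightarrow> 'a \<Rightarrow> 'b" where
  "partial_deriv b f x = frechet_derivative f (at x) b"

text \<open>Both notions are meant for open \<open>S\<close>.\<close>

primrec Ck_on :: "nat \<Rightarrow> 'a::euclidean_space set \<Rightarrow> ('a \<Rightarrow> 'b::real_normed_vector) \<Rightarrow> bool" where
  "Ck_on 0 S f \<longleftrightarrow> continuous_on S f"
| "Ck_on (Suc k) S f \<longleftrightarrow> f differentiable_on S \<and> (\<forall>b\<in>Basis. Ck_on k S (partial_deriv b f))"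

definition smooth_on :: "'a::euclidean_space set \<Rightarrow> ('a \<Rightarrow> 'b::real_normed_vector) \<Rightarrow> bool" where
  "smooth_on S f \<longleftrightarrow> (\<forall>k. Ck_on k S f)"

text \<open>Smoothness on an arbitrary set: locally the restriction of a smooth function on an open set.\<close>

definition smooth_on_subset :: "'a::euclidean_space set \<Rightarrow> ('a \<Rightarrow> 'b::real_normed_vector) \<Rightarrow> bool" where
  "smooth_on_subset A f \<longleftrightarrow>
     (\<forall>x\<in>A. \<exists>U F. open U \<and> x \<in> U \<and> smooth_on U F \<and> (\<forall>y\<in>A \<inter> U. F y = f y))"

definition laplacian :: "('a::euclidean_space \<Rightarrow> real) \<Rightarrow> 'a \<Rightarrow> real" where
  "laplacian f x = (\<Sum>b\<in>Basis. partial_deriv b (partial_deriv b f) x)"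

text \<open>\<open>C\<^sub>c\<^sup>\<infinity>(\<Omega>)\<close>, its elements being extended by zero to the whole space.\<close>

definition test_functions :: "'a::euclidean_space set \<Rightarrow> ('a \<Rightarrow> real) set" where
  "test_functions \<Omega> =
     {\<phi>. smooth_on UNIV \<phi> \<and> compact (closure {x. \<phi> x \<noteq> 0}) \<and> closure {x. \<phi> x \<noteq> 0} \<subseteq> \<Omega>}"


subsection \<open>Closed hypersurfaces\<close>

text \<open>Embedded smooth submanifolds of codimension one without boundary, described by slice charts
  \<open>\<Phi>\<close> with inverse \<open>\<Psi>\<close>; connectedness is not required.\<close>

definition smooth_hypersurface :: "'a::euclidean_space set \<Rightarrow> bool" where
  "smooth_hypersurface \<Gamma> \<longleftrightarrow>
     (\<forall>p\<in>\<Gamma>. \<exists>U V \<Phi> \<Psi>. \<exists>b\<in>(Basis :: 'a set).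
        open U \<and> p \<in> U \<and> open V \<and> homeomorphism U V \<Phi> \<Psi> \<and>
        smooth_on U \<Phi> \<and> smooth_on V \<Psi> \<and> \<Phi> ` (\<Gamma> \<inter> U) = {y \<in> V. y \<bullet> b = 0})"

definition smooth_closed_hypersurface :: "'a::euclidean_space set \<Rightarrow> bool" where
  "smooth_closed_hypersurface \<Gamma> \<longleftrightarrow> compact \<Gamma> \<and> smooth_hypersurface \<Gamma>"


subsection \<open>The boundary value problem\<close>

text \<open>Weak solutions of \<open>\<Delta>u = g dH\<^sup>n\<^sup>-\<^sup>1|\<^sub>\<Gamma>\<close> in \<open>\<Omega>\<close>, \<open>u = 0\<close> on the boundary. Only the values of \<open>u\<close> on the
  closure of \<open>\<Omega>\<close> and of \<open>g\<close> on \<open>\<Gamma>\<close> matter.\<close>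

definition weak_solution ::
  "'a::euclidean_space set \<Rightarrow> 'a set \<Rightarrow> ('a \<Rightarrow> real) \<Rightarrow> ('a \<Rightarrow> real) \<Rightarrow> bool" where
  "weak_solution \<Omega> \<Gamma> g u \<longleftrightarrow>
     continuous_on (closure \<Omega>) u \<and> (\<forall>x\<in>frontier \<Omega>. u x = 0) \<and>
     (\<forall>\<phi>\<in>test_functions \<Omega>.
        (LINT x:\<Omega>|lborel. u x * laplacian \<phi> x) =
        (LINT x:\<Gamma>|hausdorff_measure (DIM('a) - 1). g x * \<phi> x))"

definition locally_lipschitz_on :: "'a::metric_space set \<Rightarrow> ('a \<Rightarrow> 'b::metric_space) \<Rightarrow> bool" where
  "locally_lipschitz_on S u \<longleftrightarrow> (\<forall>x\<in>S. \<exists>e>0. \<exists>L. L-lipschitz_on (ball x e \<inter> S) u)"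

text \<open>To be used on the interval from \<open>-1/2\<close> to \<open>1/2\<close> only.\<close>

definition eta :: "real \<Rightarrow> real" where
  "eta t = (if 0 < t then 1 / \<bar>ln t\<bar> else 0)"

end

theory Submission
  imports Defs
begin

text \<open>Existence: since \<open>H\<^sup>n\<^sup>-\<^sup>1(\<Gamma> \<inter> B\<^sub>r(x)) \<le> C r\<^sup>n\<^sup>-\<^sup>1\<close>, the potential of \<open>g dH\<^sup>n\<^sup>-\<^sup>1|\<^sub>\<Gamma>\<close> with respect to the explicit Green
  function of the unit ball is continuous up to the boundary, and it vanishes there. Uniqueness: testing
  the difference of two solutions with radial functions whose Laplacian is a positive kernel minus an
  approximate identity yields a mean value inequality, hence a maximum principle.

  Failure of the Lipschitz property: test the equation with regularised and truncated dipoles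
  \<open>\<psi>\<^sub>\<epsilon>(x) = x\<^sub>1 (|x|\<^sup>2 + \<epsilon>)\<^sup>-\<^sup>n\<^sup>/\<^sup>2 \<chi>(|x|\<^sup>2)\<close>. The integral of \<open>\<Delta>\<psi>\<^sub>\<epsilon>\<close> is zero and that of \<open>|x| |\<Delta>\<psi>\<^sub>\<epsilon>|\<close> is bounded
  uniformly in \<open>\<epsilon>\<close>, so that \<open>\<integral> u \<Delta>\<psi>\<^sub>\<epsilon>\<close> stays bounded if \<open>u\<close> is Lipschitz near \<open>0\<close>. On the other hand,
  \<open>\<integral>\<^sub>\<Gamma> g \<psi>\<^sub>\<epsilon>\<close> tends to infinity like \<open>\<integral> dt / (t |log t|)\<close>.\<close>

section \<open>Hausdorff measure\<close>

text \<open>The source \<open>eta\<close> is continuous but not Dini continuous: at scale 2^-k it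
  has size 1/k, a piece of hyperplane has measure of order 2^(-k(n-1)) and the dipole is of order
  2^(k(n-1)), so that every scale contributes about 1/k. As \<open>eta\<close> vanishes for t <= 0,
  the negative half of the dipole is not seen and nothing cancels. The dipole is essentially a
  derivative of the fundamental solution, so the tested quantity imitates a first derivative of u at
  0; it applies to any weak solution, not only to the Green potential. Hausdorff measure is
  accessible only through its covering definition. The proof is therefore arranged around crude
  two-sided bounds: growth r^(n-1) from Lipschitz charts for existence, and a lower bound of order
  t^(n-1) on flat boxes for the harmonic sum, both with unspecified constants. Kernels are functions
  of the squared radius, regularised by adding \<epsilon>. This keeps test functions smooth and
  makes every integration by parts one of compactly supported functions; the singular kernel is
  reached as a limit with an approximate identity.\<close>

lemma hausdorff_gauge_empty [simp]: "hausdorff_gauge s {} = 0"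
  by (simp add: hausdorff_gauge_def)

lemma hausdorff_content_le:
  assumes "A \<subseteq> (\<Union>i. C i)" "\<And>i. bounded (C i)" "\<And>i. diameter (C i) \<le> \<delta>"
  shows "hausdorff_content s \<delta> A \<le> (\<Sum>i::nat. hausdorff_gauge s (C i))"
  unfolding hausdorff_content_def using assms by (intro INF_lower) auto

lemma hausdorff_content_mono: "A \<subseteq> B \<Longrightarrow> hausdorff_content s \<delta> A \<le> hausdorff_content s \<delta> B"
  unfolding hausdorff_content_def by (intro INF_superset_mono) auto

lemma hausdorff_content_antimono: "\<delta> \<le> \<delta>' \<Longrightarrow> hausdorff_content s \<delta>' A \<le> hausdorff_content s \<delta> A"
  unfolding hausdorff_content_def by (intro INF_superset_mono) (auto intro: order_trans)

lemma hausdorff_content_le_outer: "\<delta> > 0 \<Longrightarrow> hausdorff_content s \<delta> A \<le> hausdorff_outer s A"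
  unfolding hausdorff_outer_def by (intro SUP_upper) auto

lemma hausdorff_outer_mono: "A \<subseteq> B \<Longrightarrow> hausdorff_outer s A \<le> hausdorff_outer s B"
  unfolding hausdorff_outer_def by (intro SUP_mono) (auto intro: hausdorff_content_mono)

lemma hausdorff_outer_empty [simp]: "hausdorff_outer s {} = 0"
proof -
  have "hausdorff_content s \<delta> {} = 0" if "\<delta> > 0" for \<delta>
    using hausdorff_content_le[of "{}" "\<lambda>_. {}" \<delta> s] that by simp
  then show ?thesis
    unfolding hausdorff_outer_def by (intro SUP_eq_const) auto
qed

text \<open>The pieces get nearly optimal covers whose excess over the content is e 2^(-i-1), and
  \<open>prod_decode\<close> merges these covers into one sequence. The case of an infinite sum is
  absorbed by \<open>ennreal_le_epsilon\<close>.\<close>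

lemma hausdorff_content_UN:
  "hausdorff_content s \<delta> (\<Union>i. A i) \<le> (\<Sum>i::nat. hausdorff_content s \<delta> (A i))"
proof (rule ennreal_le_epsilon)
  fix e :: real
  assume fin: "(\<Sum>i. hausdorff_content s \<delta> (A i)) < top" and e: "0 < e"
  have "\<exists>C. A i \<subseteq> (\<Union>j. C j) \<and> (\<forall>j::nat. bounded (C j) \<and> diameter (C j) \<le> \<delta>) \<and>
      (\<Sum>j. hausdorff_gauge s (C j)) \<le> hausdorff_content s \<delta> (A i) + ennreal (e * (1/2) ^ Suc i)" for i
  proof -
    have "hausdorff_content s \<delta> (A i) < top"
      using fin by (rule ennreal_suminf_lessD)
    moreover have "ennreal (e * (1/2) ^ Suc i) > 0" using e by simp
    ultimately have "hausdorff_content s \<delta> (A i) < hausdorff_content s \<delta> (A i) + ennreal (e * (1/2) ^ Suc i)"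
      using ennreal_add_left_cancel_less[of "hausdorff_content s \<delta> (A i)" 0] by (simp add: less_top)
    then obtain C where "C \<in> {C :: nat \<Rightarrow> 'a set. A i \<subseteq> (\<Union>i. C i) \<and> (\<forall>i. bounded (C i) \<and> diameter (C i) \<le> \<delta>)}"
      "(\<Sum>j. hausdorff_gauge s (C j)) < hausdorff_content s \<delta> (A i) + ennreal (e * (1/2) ^ Suc i)"
      by (subst (asm) (1) hausdorff_content_def) (auto simp: INF_less_iff)
    then show ?thesis by (auto intro!: exI[of _ C] less_imp_le)
  qed
  then obtain C where C: "\<And>i. A i \<subseteq> (\<Union>j. C i j)" "\<And>i j::nat. bounded (C i j)"
      "\<And>i j. diameter (C i j) \<le> \<delta>"
      "\<And>i. (\<Sum>j. hausdorff_gauge s (C i j)) \<le> hausdorff_content s \<delta> (A i) + ennreal (e * (1/2) ^ Suc i)"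
    by metis
  have "hausdorff_content s \<delta> (\<Union>i. A i) \<le>
      (\<Sum>k. hausdorff_gauge s ((\<lambda>(i, j). C i j) (prod_decode k)))"
  proof (rule hausdorff_content_le)
    show "(\<Union>i. A i) \<subseteq> (\<Union>k. (\<lambda>(i, j). C i j) (prod_decode k))"
    proof
      fix x assume "x \<in> (\<Union>i. A i)"
      then obtain i j where "x \<in> C i j" using C(1) by blast
      then have "x \<in> (\<lambda>(i, j). C i j) (prod_decode (prod_encode (i, j)))" by simp
      then show "x \<in> (\<Union>k. (\<lambda>(i, j). C i j) (prod_decode k))" by (rule UN_I[OF UNIV_I])
    qed
  qed (auto simp: C(2,3) split: prod.split)
  also have "\<dots> = (\<Sum>i. \<Sum>j. hausdorff_gauge s (C i j))"
    by (intro suminf_ennreal_2dimen[where f="\<lambda>p. hausdorff_gauge s ((\<lambda>(i, j). C i j) p)"]) simp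
  also have "\<dots> \<le> (\<Sum>i. hausdorff_content s \<delta> (A i) + ennreal (e * (1/2) ^ Suc i))"
    by (intro suminf_le C(4)) auto
  also have "\<dots> = (\<Sum>i. hausdorff_content s \<delta> (A i)) + (\<Sum>i. ennreal (e * (1/2) ^ Suc i))"
    by (intro suminf_add[symmetric]) auto
  also have "(\<Sum>i. ennreal (e * (1/2) ^ Suc i)) = ennreal e"
    using e sums_mult[OF power_half_series, of e] by (intro suminf_ennreal_eq) auto
  finally show "hausdorff_content s \<delta> (\<Union>i. A i) \<le> (\<Sum>i. hausdorff_content s \<delta> (A i)) + ennreal e" .
qed

lemma hausdorff_outer_UN:
  "hausdorff_outer s (\<Union>i. A i) \<le> (\<Sum>i::nat. hausdorff_outer s (A i))"
proof (subst hausdorff_outer_def, rule SUP_least)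
  fix \<delta> :: real assume "\<delta> \<in> {0<..}"
  then show "hausdorff_content s \<delta> (\<Union>i. A i) \<le> (\<Sum>i. hausdorff_outer s (A i))"
    by (intro order_trans[OF hausdorff_content_UN] suminf_le hausdorff_content_le_outer) auto
qed

lemma hausdorff_outer_Un: "hausdorff_outer s (A \<union> B) \<le> hausdorff_outer s A + hausdorff_outer s B"
proof -
  have "hausdorff_outer s (\<Union>i. binaryset A B i) \<le> (\<Sum>i. hausdorff_outer s (binaryset A B i))"
    by (rule hausdorff_outer_UN)
  then show ?thesis
    by (simp add: UN_binaryset_eq binaryset_sums suminf_binaryset_eq)
qed

text \<open>A set of diameter at most \<delta> < d cannot meet both A and B. Every cover of the
  union therefore splits without loss into a cover \<open>C1\<close> of A and a cover
  \<open>C2\<close> of B, the discarded members being replaced by the empty set at cost 0.\<close>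

lemma hausdorff_content_separated:
  assumes sep: "\<And>x y. x \<in> A \<Longrightarrow> y \<in> B \<Longrightarrow> d \<le> dist x y" and "\<delta> < d"
  shows "hausdorff_content s \<delta> A + hausdorff_content s \<delta> B \<le> hausdorff_content s \<delta> (A \<union> B)"
proof (subst (3) hausdorff_content_def, rule INF_greatest)
  fix C :: "nat \<Rightarrow> 'a set"
  assume "C \<in> {C. A \<union> B \<subseteq> (\<Union>i. C i) \<and> (\<forall>i. bounded (C i) \<and> diameter (C i) \<le> \<delta>)}"
  then have C: "A \<union> B \<subseteq> (\<Union>i. C i)" "\<And>i. bounded (C i)" "\<And>i. diameter (C i) \<le> \<delta>" by auto
  have d0: "0 \<le> \<delta>"
    using C(3)[of 0] diameter_ge_0[OF C(2)[of 0]] by linarith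
  define C1 where "C1 i = (if C i \<inter> A = {} then {} else C i)" for i
  define C2 where "C2 i = (if C i \<inter> A = {} then C i else {})" for i
  have "hausdorff_content s \<delta> A \<le> (\<Sum>i. hausdorff_gauge s (C1 i))"
  proof (intro hausdorff_content_le subsetI)
    fix x assume "x \<in> A"
    then obtain i where "x \<in> C i" using C(1) by blast
    with \<open>x \<in> A\<close> have "x \<in> C1 i" by (auto simp: C1_def)
    then show "x \<in> (\<Union>i. C1 i)" by blast
  qed (use C d0 in \<open>auto simp: C1_def\<close>)
  moreover have "hausdorff_content s \<delta> B \<le> (\<Sum>i. hausdorff_gauge s (C2 i))"
  proof (intro hausdorff_content_le subsetI)
    fix y assume y: "y \<in> B"
    then obtain i where i: "y \<in> C i" using C(1) by blast
    have "C i \<inter> A = {}"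
    proof (rule ccontr)
      assume "C i \<inter> A \<noteq> {}"
      then obtain x where "x \<in> C i" "x \<in> A" by blast
      then show False
        using sep[of x y] diameter_bounded_bound[OF C(2)[of i], of x y] i y C(3)[of i] \<open>\<delta> < d\<close>
        by (auto simp: dist_commute)
    qed
    then show "y \<in> (\<Union>i. C2 i)" using i by (auto simp: C2_def)
  qed (use C d0 in \<open>auto simp: C2_def\<close>)
  ultimately have "hausdorff_content s \<delta> A + hausdorff_content s \<delta> B \<le>
     (\<Sum>i. hausdorff_gauge s (C1 i)) + (\<Sum>i. hausdorff_gauge s (C2 i))"
    by (rule add_mono)
  also have "\<dots> = (\<Sum>i. hausdorff_gauge s (C1 i) + hausdorff_gauge s (C2 i))"
    by (intro suminf_add) auto
  also have "\<dots> = (\<Sum>i. hausdorff_gauge s (C i))"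
    by (intro suminf_cong) (auto simp: C1_def C2_def)
  finally show "hausdorff_content s \<delta> A + hausdorff_content s \<delta> B \<le> (\<Sum>i. hausdorff_gauge s (C i))" .
qed

lemma hausdorff_outer_separated:
  assumes sep: "\<And>x y. x \<in> A \<Longrightarrow> y \<in> B \<Longrightarrow> d \<le> dist x y" and "d > 0"
  shows "hausdorff_outer s A + hausdorff_outer s B \<le> hausdorff_outer s (A \<union> B)"
proof -
  have "hausdorff_content s \<delta> A + hausdorff_content s \<epsilon> B \<le> hausdorff_outer s (A \<union> B)"
    if "\<delta> > 0" "\<epsilon> > 0" for \<delta> \<epsilon>
  proof -
    \<comment> \<open>The two suprema run over independent mesh sizes. A common mesh below both only
      increases the contents, and below d the separated case applies.\<close>
    define \<gamma> where "\<gamma> = min (min \<delta> \<epsilon>) (d / 2)"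
    have \<gamma>: "\<gamma> \<le> \<delta>" "\<gamma> \<le> \<epsilon>" "\<gamma> < d" "\<gamma> > 0" using that \<open>d > 0\<close> by (auto simp: \<gamma>_def)
    have "hausdorff_content s \<delta> A + hausdorff_content s \<epsilon> B \<le> hausdorff_content s \<gamma> A + hausdorff_content s \<gamma> B"
      using \<gamma> by (intro add_mono hausdorff_content_antimono)
    also have "\<dots> \<le> hausdorff_content s \<gamma> (A \<union> B)"
      using sep \<gamma> by (intro hausdorff_content_separated)
    also have "\<dots> \<le> hausdorff_outer s (A \<union> B)"
      using \<gamma> by (intro hausdorff_content_le_outer)
    finally show ?thesis .
  qed
  then have "hausdorff_content s \<delta> A + hausdorff_outer s B \<le> hausdorff_outer s (A \<union> B)" if "\<delta> > 0" for \<delta>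
    unfolding hausdorff_outer_def[of s B] using that
    by (subst ennreal_SUP_add_right) (auto intro!: SUP_least)
  then show ?thesis
    unfolding hausdorff_outer_def[of s A]
    by (subst ennreal_SUP_add_left[symmetric]) (auto intro!: SUP_least)
qed

text \<open>Each set keeps a positive distance from the union of its predecessors; the gap may
  shrink with m, since the separated case is applied once per induction step.\<close>

lemma hausdorff_outer_finite_disjoint:
  assumes sep: "\<And>m. \<exists>d>0. \<forall>x \<in> (\<Union>j<m. D j). \<forall>y \<in> D m. d \<le> dist x y"
  shows "(\<Sum>j<m::nat. hausdorff_outer s (D j)) \<le> hausdorff_outer s (\<Union>j<m. D j)"
proof (induction m)
  case (Suc m)
  obtain d where d: "d > 0" "\<And>x y. x \<in> (\<Union>j<m. D j) \<Longrightarrow> y \<in> D m \<Longrightarrow> d \<le> dist x y"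
    using sep[of m] by blast
  have "(\<Sum>j<Suc m. hausdorff_outer s (D j)) \<le> hausdorff_outer s (\<Union>j<m. D j) + hausdorff_outer s (D m)"
    using Suc by (simp add: add_right_mono)
  also have "\<dots> \<le> hausdorff_outer s ((\<Union>j<m. D j) \<union> D m)"
    using d by (intro hausdorff_outer_separated) auto
  also have "(\<Union>j<m. D j) \<union> D m = (\<Union>j<Suc m. D j)"
    by (auto simp: lessThan_Suc)
  finally show ?case .
qed simp

text \<open>Shells around \<open>F\<close> at distances \<open>1/(j+1)\<close> whose indices have the same parity are separated, so
  that their outer measures sum up to at most that of \<open>A\<close>; the part of \<open>A - F\<close> close to \<open>F\<close> therefore
  has small outer measure.\<close>

lemma hausdorff_outer_closed_split:
  assumes "closed F"
  shows "hausdorff_outer s (A \<inter> F) + hausdorff_outer s (A - F) \<le> hausdorff_outer s A"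
proof (cases "F = {} \<or> hausdorff_outer s A = top")
  case True then show ?thesis by auto
next
  case False
  then have F: "F \<noteq> {}" and fin: "hausdorff_outer s A < top" by (auto simp: top.not_eq_extremum)
  define D where "D j = {x \<in> A. 1 / (real j + 2) \<le> infdist x F \<and> infdist x F < 1 / (real j + 1)}" for j
  have half: "(\<Sum>j<m. hausdorff_outer s (D (2 * j + p))) \<le> hausdorff_outer s A" for m p
  proof -
    have "(\<Sum>j<m. hausdorff_outer s (D (2 * j + p))) \<le> hausdorff_outer s (\<Union>j<m. D (2 * j + p))"
    proof (rule hausdorff_outer_finite_disjoint)
      fix m
      show "\<exists>d>0. \<forall>x \<in> (\<Union>j<m. D (2 * j + p)). \<forall>y \<in> D (2 * m + p). d \<le> dist x y"
      proof (cases "m = 0")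
        case False
        then show ?thesis
      \<comment> \<open>The earlier shells of the same parity have distance at least 1/(2m+p) from
        F, the shell of index 2m+p has distance less than 1/(2m+p+1). The difference is the gap,
        positive once m > 0; for m = 0 the union is empty.\<close>
      proof (intro exI[of _ "1 / (2 * real m + real p) - 1 / (2 * real m + real p + 1)"] conjI ballI)
        fix x y assume "x \<in> (\<Union>j<m. D (2 * j + p))" and y: "y \<in> D (2 * m + p)"
        then obtain j where j: "j < m" "x \<in> D (2 * j + p)" by blast
        have "1 / (2 * real m + real p) \<le> 1 / (real (2 * j + p) + 2)"
          using j(1) by (intro divide_left_mono) auto
        also have "\<dots> \<le> infdist x F" using j(2) by (simp add: D_def)
        also have "\<dots> \<le> infdist y F + dist x y" by (rule infdist_triangle)
        also have "infdist y F \<le> 1 / (2 * real m + real p + 1)" using y by (simp add: D_def)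
        finally show "1 / (2 * real m + real p) - 1 / (2 * real m + real p + 1) \<le> dist x y" by simp
      next
        show "0 < 1 / (2 * real m + real p) - 1 / (2 * real m + real p + 1)" if "m \<noteq> 0"
          using that by (simp add: divide_strict_left_mono)
      qed
      qed (auto intro: exI[of _ 1])
    qed
    also have "\<dots> \<le> hausdorff_outer s A" by (intro hausdorff_outer_mono) (auto simp: D_def)
    finally show ?thesis .
  qed
  have "(\<Sum>j<m. hausdorff_outer s (D j)) \<le> 2 * hausdorff_outer s A" for m
  proof -
    have "(\<Sum>j<m. hausdorff_outer s (D j)) \<le> (\<Sum>j<2 * m. hausdorff_outer s (D j))"
      by (intro sum_mono2) auto
    also have "\<dots> = (\<Sum>j<m. hausdorff_outer s (D (2 * j + 0))) + (\<Sum>j<m. hausdorff_outer s (D (2 * j + 1)))"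
      by (induction m) (auto simp: algebra_simps)
    also have "\<dots> \<le> hausdorff_outer s A + hausdorff_outer s A"
      by (intro add_mono half)
    finally show ?thesis by (simp add: mult_2)
  qed
  then have "(\<Sum>j. hausdorff_outer s (D j)) \<le> 2 * hausdorff_outer s A"
    by (simp add: suminf_eq_SUP SUP_le_iff)
  also have "\<dots> < top" using fin by (simp add: ennreal_mult_less_top)
  finally have fin': "(\<Sum>j. hausdorff_outer s (D j)) < top" .
  show ?thesis
  proof (rule ennreal_le_epsilon)
    fix e :: real assume e: "e > 0"
    have "\<exists>k. (\<Sum>j. hausdorff_outer s (D j)) < (\<Sum>j<k. hausdorff_outer s (D j)) + ennreal e"
    proof (rule ccontr)
      assume "\<not> ?thesis"
      then have "(SUP k. \<Sum>j<k. hausdorff_outer s (D j)) + ennreal e \<le> (\<Sum>j. hausdorff_outer s (D j))"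
        by (subst ennreal_SUP_add_left[symmetric]) (auto intro!: SUP_least simp: not_less)
      then show False
        using fin' e ennreal_add_left_cancel_less[of "\<Sum>j. hausdorff_outer s (D j)" 0 "ennreal e"]
        by (simp add: suminf_eq_SUP[symmetric] less_top not_less[symmetric])
    qed
    then obtain k where k: "(\<Sum>j. hausdorff_outer s (D j)) < (\<Sum>j<k. hausdorff_outer s (D j)) + ennreal e"
      by blast
    have tail: "(\<Sum>j. hausdorff_outer s (D (j + k))) \<le> ennreal e"
    proof -
      have "(\<Sum>j<k. hausdorff_outer s (D j)) + (\<Sum>j. hausdorff_outer s (D (j + k)))
          = (\<Sum>j. hausdorff_outer s (D j))"
        by (subst suminf_offset[of _ k]) (auto simp: add.commute)
      with k show ?thesis
        by (metis ennreal_add_left_cancel_less less_imp_le)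
    qed
    define A' where "A' = {x \<in> A. 1 / (real k + 1) \<le> infdist x F}"
    have "A - F \<subseteq> A' \<union> (\<Union>j. D (j + k))"
    proof
      fix x assume x: "x \<in> A - F"
      then have pos: "infdist x F > 0"
        using \<open>closed F\<close> F in_closed_iff_infdist_zero[of F x] infdist_nonneg[of x F] by auto
      show "x \<in> A' \<union> (\<Union>j. D (j + k))"
      proof (cases "1 / (real k + 1) \<le> infdist x F")
        case False
        \<comment> \<open>Membership in \<open>D m\<close> means m + 1 < 1 / infdist x F <= m + 2,
          so m is the ceiling of 1 / infdist x F minus 2.\<close>
        define m where "m = nat (\<lceil>1 / infdist x F\<rceil> - 2)"
        have gt: "1 / infdist x F > real k + 1" using False pos by (simp add: field_simps)
        then have fl: "\<lceil>1 / infdist x F\<rceil> \<ge> int k + 2" by linarith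
        then have m: "real m = real_of_int \<lceil>1 / infdist x F\<rceil> - 2" "m \<ge> k"
          by (auto simp: m_def)
        have "real m + 1 < 1 / infdist x F" "1 / infdist x F \<le> real m + 2"
          unfolding m(1) by linarith+
        then have "x \<in> D m" using x pos by (auto simp: D_def field_simps)
        then have "x \<in> D ((m - k) + k)" using m(2) by simp
        then show ?thesis by blast
      qed (use x in \<open>auto simp: A'_def\<close>)
    qed
    then have "hausdorff_outer s (A - F) \<le> hausdorff_outer s A' + hausdorff_outer s (\<Union>j. D (j + k))"
      by (intro order_trans[OF hausdorff_outer_mono hausdorff_outer_Un])
    also have "\<dots> \<le> hausdorff_outer s A' + ennreal e"
      by (intro add_left_mono order_trans[OF hausdorff_outer_UN tail])
    finally have "hausdorff_outer s (A \<inter> F) + hausdorff_outer s (A - F) \<le>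
        (hausdorff_outer s (A \<inter> F) + hausdorff_outer s A') + ennreal e"
      by (simp add: add.assoc add_left_mono)
    also have "hausdorff_outer s (A \<inter> F) + hausdorff_outer s A' \<le> hausdorff_outer s ((A \<inter> F) \<union> A')"
    proof (rule hausdorff_outer_separated)
      fix x y assume "x \<in> A \<inter> F" "y \<in> A'"
      then show "1 / (real k + 1) \<le> dist x y"
        using infdist_le[of x F y] by (auto simp: A'_def dist_commute)
    qed auto
    also have "\<dots> \<le> hausdorff_outer s A" by (intro hausdorff_outer_mono) (auto simp: A'_def)
    finally show "hausdorff_outer s (A \<inter> F) + hausdorff_outer s (A - F) \<le> hausdorff_outer s A + ennreal e"
      by (simp add: add_right_mono)
  qed
qed

lemma
  shows space_hausdorff_measure [simp]: "space (hausdorff_measure s) = UNIV"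
    and sets_hausdorff_measure [simp, measurable_cong]: "sets (hausdorff_measure s :: 'a::metric_space measure) = sets borel"
  using sets.sigma_sets_eq[of "borel :: 'a measure"] by (simp_all add: hausdorff_measure_def)

text \<open>\<open>measure_of\<close> returns the given set function only where it is a measure. By
  Caratheodory, \<open>hausdorff_outer\<close> is a measure on its lambda system; closed sets belong
  to that system by \<open>hausdorff_outer_closed_split\<close>, hence all Borel sets do.\<close>

theorem emeasure_hausdorff_measure:
  fixes A :: "'a::metric_space set"
  assumes "A \<in> sets borel"
  shows "emeasure (hausdorff_measure s) A = hausdorff_outer s A"
proof -
  let ?H = "hausdorff_outer s :: 'a set \<Rightarrow> ennreal"
  interpret sigma_algebra UNIV "Pow (UNIV :: 'a set)" by (rule sigma_algebra_Pow)
  have "outer_measure_space (Pow UNIV) ?H"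
    unfolding outer_measure_space_def positive_def increasing_def countably_subadditive_def
    by (auto intro: hausdorff_outer_mono hausdorff_outer_UN)
  then have ms: "measure_space UNIV (lambda_system UNIV (Pow UNIV) ?H) ?H"
    by (rule caratheodory_lemma)
  have "F \<in> lambda_system UNIV (Pow UNIV) ?H" if "closed F" for F
  proof -
    have "?H (A \<inter> F) + ?H (A - F) = ?H A" for A
      using hausdorff_outer_closed_split[OF that] hausdorff_outer_Un[of s "A \<inter> F" "A - F"]
      by (intro antisym) (auto simp: Int_Diff_Un)
    then show ?thesis by (auto simp: lambda_system_eq[unfolded Pow_UNIV])
  qed
  then have "sigma_sets UNIV (Collect closed) \<subseteq> lambda_system UNIV (Pow UNIV) ?H"
    using ms by (intro sigma_algebra.sigma_sets_subset) (auto simp: measure_space_def)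
  then have sub: "sets borel \<subseteq> lambda_system UNIV (Pow UNIV) ?H"
    by (simp add: borel_eq_closed)
  have "measure_space UNIV (sets borel) ?H"
    using sets.sigma_algebra_axioms[of "borel :: 'a measure"]
    by (intro measure_down[OF ms _ sub]) simp
  then show ?thesis
    using assms unfolding hausdorff_measure_def
    by (intro emeasure_measure_of_sigma) (auto simp: measure_space_def)
qed

section \<open>Upper and lower bounds for the Hausdorff measure of Lipschitz images and flat
  sets\<close>

lemma hausdorff_outer_finite_UN:
  "finite I \<Longrightarrow> hausdorff_outer s (\<Union>i\<in>I. A i) \<le> (\<Sum>i\<in>I. hausdorff_outer s (A i))"
proof (induction I rule: finite_induct)
  case (insert i I)
  then show ?case
    using order_trans[OF hausdorff_outer_Un add_left_mono[OF insert.IH]] by simp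
qed simp

text \<open>The finite family is padded with empty sets to a sequence; they have gauge 0 also for s
  = 0, by the case distinction in \<open>hausdorff_gauge\<close>.\<close>

lemma hausdorff_content_finite_cover:
  assumes "finite I" "A \<subseteq> (\<Union>i\<in>I. Q i)" "0 \<le> \<delta>"
    and "\<And>i. i \<in> I \<Longrightarrow> bounded (Q i)" "\<And>i. i \<in> I \<Longrightarrow> diameter (Q i) \<le> \<delta>"
  shows "hausdorff_content s \<delta> A \<le> (\<Sum>i\<in>I. hausdorff_gauge s (Q i))"
proof -
  obtain h where h: "bij_betw h {..<card I} I"
    using ex_bij_betw_nat_finite[OF assms(1)] by (auto simp: atLeast0LessThan)
  define C where "C i = (if i < card I then Q (h i) else {})" for i
  have hI: "h i \<in> I" if "i < card I" for i using h that by (auto simp: bij_betw_def)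
  have "hausdorff_content s \<delta> A \<le> (\<Sum>i. hausdorff_gauge s (C i))"
  proof (rule hausdorff_content_le)
    show "A \<subseteq> (\<Union>i. C i)"
    proof
      fix x assume "x \<in> A"
      then obtain i where i: "i \<in> I" "x \<in> Q i" using assms(2) by blast
      have "i \<in> h ` {..<card I}" using h i by (simp add: bij_betw_def)
      then obtain k where "k < card I" "i = h k" by (elim imageE) simp
      then have "x \<in> C k" using i by (simp add: C_def)
      then show "x \<in> (\<Union>i. C i)" by (rule UN_I[OF UNIV_I])
    qed
  qed (use assms hI in \<open>auto simp: C_def\<close>)
  also have "\<dots> = (\<Sum>i<card I. hausdorff_gauge s (C i))"
    by (intro suminf_finite) (auto simp: C_def)
  also have "\<dots> = (\<Sum>i<card I. hausdorff_gauge s (Q (h i)))" by (simp add: C_def)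
  also have "\<dots> = (\<Sum>i\<in>I. hausdorff_gauge s (Q i))"
    by (rule sum.reindex_bij_betw[OF h])
  finally show ?thesis .
qed

lemma hausdorff_gauge_le:
  assumes "bounded C" "diameter C \<le> d"
  shows "hausdorff_gauge s C \<le> ennreal (unit_ball_vol (real s) * (d / 2) ^ s)"
  unfolding hausdorff_gauge_def
  using assms diameter_ge_0[OF assms(1)]
  by (auto intro!: ennreal_leI mult_left_mono power_mono)

text \<open>The cover consists of the images of the fibres of a grid of \<open>N\<close> cells per coordinate.\<close>

lemma hausdorff_outer_lipschitz_image_plane:
  fixes b q :: "'a::euclidean_space" and \<psi> :: "'a \<Rightarrow> 'c::real_normed_vector"
  assumes b: "b \<in> Basis" and P: "P \<subseteq> {y. y \<bullet> b = 0} \<inter> cball q \<rho>" and \<rho>: "\<rho> > 0"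
    and \<psi>: "L-lipschitz_on P \<psi>"
  shows "hausdorff_outer (DIM('a) - 1) (\<psi> ` P) \<le>
    ennreal (unit_ball_vol (real (DIM('a) - 1)) * (2 * real DIM('a) * \<rho> * L) ^ (DIM('a) - 1))"
    (is "_ \<le> ennreal (?\<omega> * ?c ^ ?d)")
proof (subst hausdorff_outer_def, rule SUP_least)
  fix \<delta> :: real assume "\<delta> \<in> {0<..}"
  then have \<delta>: "\<delta> > 0" by simp
  have L: "L \<ge> 0" using lipschitz_on_nonneg[OF \<psi>] .
  let ?n = "real DIM('a)"
  define B where "B = Basis - {b}"
  have B: "finite B" "card B = ?d" using b by (auto simp: B_def)
  \<comment> \<open>N makes the cells so fine that the images of the fibres have diameter at most
    \<delta>; the extra 1 keeps N positive.\<close>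
  obtain N :: nat where N: "N > L * ?n * (2 * \<rho>) / \<delta> + 1"
    using reals_Archimedean2 by blast
  have N0: "real N > 0" using N L \<rho> \<delta> by (smt (verit) divide_nonneg_pos mult_nonneg_nonneg of_nat_0_le_iff)
  have small: "L * ?n * (2 * \<rho> / N) \<le> \<delta>" using N N0 \<delta> by (simp add: field_simps)
  \<comment> \<open>The vector of cell indices of y in the coordinates other than b. The right end
    of a coordinate interval gets index N, so N + 1 values are possible; the estimate (N + 1) / N <=
    2 at the end pays for this.\<close>
  define \<kappa> where "\<kappa> y = (\<lambda>j\<in>B. nat \<lfloor>(y \<bullet> j - q \<bullet> j + \<rho>) * N / (2 * \<rho>)\<rfloor>)" for y
  have coord: "\<bar>y \<bullet> j - q \<bullet> j\<bar> \<le> \<rho>" if "y \<in> P" "j \<in> B" for y j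
    using P that Basis_le_norm[of j "y - q"] by (auto simp: B_def inner_diff_left dist_norm norm_minus_commute)
  have \<kappa>_in: "\<kappa> y \<in> B \<rightarrow>\<^sub>E {..N}" if y: "y \<in> P" for y
  proof
    fix j assume j: "j \<in> B"
    have "(y \<bullet> j - q \<bullet> j + \<rho>) * N / (2 * \<rho>) \<le> N"
      using coord[OF y j] \<rho> N0 by (simp add: pos_divide_le_eq mult.commute abs_le_iff)
    then have "\<lfloor>(y \<bullet> j - q \<bullet> j + \<rho>) * N / (2 * \<rho>)\<rfloor> \<le> int N" by linarith
    then show "\<kappa> y j \<in> {..N}" using j by (simp add: \<kappa>_def nat_le_iff)
  qed (simp add: \<kappa>_def)
  define Q where "Q m = \<psi> ` {y \<in> P. \<kappa> y = m}" for m
  have close: "norm (\<psi> y - \<psi> z) \<le> L * ?n * (2 * \<rho> / N)" if "y \<in> P" "z \<in> P" "\<kappa> y = \<kappa> z" for y z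
  proof -
    have "\<bar>(y - z) \<bullet> j\<bar> \<le> 2 * \<rho> / N" if j: "j \<in> Basis" for j
    proof (cases "j = b")
      case True
      moreover have "y \<bullet> b = 0" "z \<bullet> b = 0" using P \<open>y \<in> P\<close> \<open>z \<in> P\<close> by auto
      ultimately show ?thesis using \<rho> by (simp add: inner_diff_left)
    next
      case False
      with j have j: "j \<in> B" by (simp add: B_def)
      let ?f = "\<lambda>y. (y \<bullet> j - q \<bullet> j + \<rho>) * N / (2 * \<rho>)"
      have "nat \<lfloor>?f y\<rfloor> = nat \<lfloor>?f z\<rfloor>" using \<open>\<kappa> y = \<kappa> z\<close> j by (auto simp: \<kappa>_def fun_eq_iff split: if_splits)
      moreover have "?f y \<ge> 0" "?f z \<ge> 0"
        using coord[OF \<open>y \<in> P\<close> j] coord[OF \<open>z \<in> P\<close> j] \<rho> by (auto intro!: divide_nonneg_pos mult_nonneg_nonneg)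
      ultimately have "\<lfloor>?f y\<rfloor> = \<lfloor>?f z\<rfloor>" by (auto simp: nat_eq_iff)
      then have "\<bar>?f y - ?f z\<bar> \<le> 1" by linarith
      moreover have "?f y - ?f z = ((y - z) \<bullet> j) * (N / (2 * \<rho>))"
        by (simp add: inner_diff_left diff_divide_distrib[symmetric] left_diff_distrib[symmetric])
      ultimately have "\<bar>(y - z) \<bullet> j\<bar> * (N / (2 * \<rho>)) \<le> 1"
        using N0 \<rho> by (simp add: abs_mult)
      then show ?thesis using N0 \<rho> by (simp add: field_simps)
    qed
    then have "(\<Sum>j\<in>Basis. \<bar>(y - z) \<bullet> j\<bar>) \<le> (\<Sum>j\<in>(Basis::'a set). 2 * \<rho> / N)"
      by (intro sum_mono)
    then have "norm (y - z) \<le> ?n * (2 * \<rho> / N)"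
      using norm_le_l1[of "y - z"] by simp
    then have "L * norm (y - z) \<le> L * (?n * (2 * \<rho> / N))" using L by (rule mult_left_mono)
    then show ?thesis
      using lipschitz_onD[OF \<psi> that(1,2)] by (simp add: dist_norm mult.assoc)
  qed
  have diam: "diameter (Q m) \<le> L * ?n * (2 * \<rho> / N)" for m
    using close L \<rho> by (intro diameter_le) (auto simp: Q_def)
  have bdd: "bounded (Q m)" for m
    unfolding bounded_any_center[of _ "undefined"]
  proof (cases "Q m = {}")
    case False
    then obtain y where y: "y \<in> P" "\<kappa> y = m" by (auto simp: Q_def)
    have "bounded (Q m)"
      unfolding bounded_def using close[OF y(1)] y(2)
      by (intro exI[of _ "\<psi> y"] exI[of _ "L * ?n * (2 * \<rho> / N)"]) (auto simp: Q_def dist_norm)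
    then show "\<exists>e. \<forall>y\<in>Q m. dist undefined y \<le> e" using bounded_any_center by blast
  qed auto
  have "hausdorff_content ?d \<delta> (\<psi> ` P) \<le> (\<Sum>m\<in>B \<rightarrow>\<^sub>E {..N}. hausdorff_gauge ?d (Q m))"
  proof (rule hausdorff_content_finite_cover)
    show "\<psi> ` P \<subseteq> (\<Union>m\<in>B \<rightarrow>\<^sub>E {..N}. Q m)" using \<kappa>_in by (auto simp: Q_def)
    show "diameter (Q m) \<le> \<delta>" for m using diam[of m] small by simp
  qed (use B \<delta> bdd in \<open>auto intro!: finite_PiE\<close>)
  also have "\<dots> \<le> (\<Sum>m\<in>B \<rightarrow>\<^sub>E {..N}. ennreal (?\<omega> * (L * ?n * (2 * \<rho> / N) / 2) ^ ?d))"
    by (intro sum_mono hausdorff_gauge_le diam bdd)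
  also have "\<dots> = ennreal (real ((N + 1) ^ ?d) * (?\<omega> * (L * ?n * (2 * \<rho> / N) / 2) ^ ?d))"
    using B L \<rho> by (simp add: card_PiE ennreal_mult ennreal_of_nat_eq_real_of_nat del: of_nat_power)
  also have "real ((N + 1) ^ ?d) * (?\<omega> * (L * ?n * (2 * \<rho> / N) / 2) ^ ?d) =
      ?\<omega> * ((N + 1) * (L * ?n * \<rho> / N)) ^ ?d"
  proof -
    have "L * ?n * (2 * \<rho> / N) / 2 = L * ?n * \<rho> / N" by simp
    then show ?thesis
      by (simp only: power_mult_distrib of_nat_power of_nat_add of_nat_1 mult_ac)
  qed
  also have "\<dots> \<le> ?\<omega> * ?c ^ ?d"
  proof -
    have "(real N + 1) / N \<le> 2" using N0 by (simp add: field_simps)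
    then have "(real N + 1) / N * (L * ?n * \<rho>) \<le> 2 * (L * ?n * \<rho>)"
      using L \<rho> by (intro mult_right_mono) auto
    then show ?thesis using L \<rho>
      by (intro mult_left_mono power_mono) (auto simp: field_simps)
  qed
  finally show "hausdorff_content ?d \<delta> (\<psi> ` P) \<le> ennreal (?\<omega> * ?c ^ ?d)" by (simp add: ennreal_leI)
qed

text \<open>If the sets \<open>C i\<close> cover A, then boxes of half side
  \<open>diameter (C i)\<close> around a point of \<open>C i\<close>, of height 1 in direction b,
  cover the prism over A. Their volume is (2 diam)^(n-1), and the factor 4^(n-1) converts this into
  the gauge, which is built on diam / 2. Lebesgue measure thus bounds Hausdorff measure from below
  up to a constant.\<close>

lemma emeasure_prism_le_hausdorff_outer:
  fixes b :: "'a::euclidean_space"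
  assumes b: "b \<in> Basis" and A: "A \<subseteq> {x. x \<bullet> b = 0}"
    and S: "S \<subseteq> {x + t *\<^sub>R b |x t. x \<in> A \<and> 0 \<le> t \<and> t \<le> 1}"
  shows "ennreal (unit_ball_vol (real (DIM('a) - 1)) / 4 ^ (DIM('a) - 1)) * emeasure lborel S \<le>
    hausdorff_outer (DIM('a) - 1) A"
    (is "ennreal ?c * _ \<le> _")
proof -
  let ?d = "DIM('a) - 1"
  have "ennreal ?c * emeasure lborel S \<le> hausdorff_content ?d 1 A"
    unfolding hausdorff_content_def
  proof (rule INF_greatest)
    fix C :: "nat \<Rightarrow> 'a set"
    assume "C \<in> {C. A \<subseteq> \<Union> (range C) \<and> (\<forall>i. bounded (C i) \<and> diameter (C i) \<le> 1)}"
    then have C: "A \<subseteq> \<Union> (range C)" "\<And>i. bounded (C i)" by auto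
    define p where "p i = (SOME p. p \<in> C i)" for i
    define lo hi where "lo i = (\<Sum>j\<in>Basis. (if j = b then 0 else p i \<bullet> j - diameter (C i)) *\<^sub>R j)"
      and "hi i = (\<Sum>j\<in>Basis. (if j = b then 1 else p i \<bullet> j + diameter (C i)) *\<^sub>R j)" for i
    define K where "K i = (if C i = {} then {} else cbox (lo i) (hi i))" for i
    have "S \<subseteq> (\<Union>i. K i)"
    proof
      fix z assume "z \<in> S"
      then obtain x t where z: "z = x + t *\<^sub>R b" "x \<in> A" "0 \<le> t" "t \<le> 1" using S by auto
      then obtain i where i: "x \<in> C i" using C by blast
      then have p: "p i \<in> C i" unfolding p_def by (metis someI)
      have "z \<bullet> j \<ge> lo i \<bullet> j \<and> z \<bullet> j \<le> hi i \<bullet> j" if j: "j \<in> Basis" for j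
      proof (cases "j = b")
        case True
        have "x \<bullet> b = 0" using z A by auto
        then show ?thesis using z b True by (simp add: lo_def hi_def inner_add_left)
      next
        case False
        have "\<bar>(x - p i) \<bullet> j\<bar> \<le> diameter (C i)"
          using Basis_le_norm[OF j, of "x - p i"] diameter_bounded_bound[OF C(2) i p]
          by (simp add: dist_norm)
        moreover have "b \<bullet> j = 0" using False j b by (simp add: inner_Basis)
        ultimately show ?thesis
          using False j z(1) by (simp add: lo_def hi_def inner_add_left inner_diff_left abs_le_iff)
      qed
      then have "z \<in> K i" using i by (auto simp: K_def mem_box)
      then show "z \<in> (\<Union>i. K i)" by blast
    qed
    then have "emeasure lborel S \<le> emeasure lborel (\<Union>i. K i)"
      by (intro emeasure_mono) (auto simp: K_def)
    also have "\<dots> \<le> (\<Sum>i. emeasure lborel (K i))"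
      by (intro emeasure_subadditive_countably) (auto simp: K_def)
    finally have "ennreal ?c * emeasure lborel S \<le> (\<Sum>i. ennreal ?c * emeasure lborel (K i))"
      by (simp add: mult_left_mono)
    also have "\<dots> \<le> (\<Sum>i. hausdorff_gauge ?d (C i))"
    proof (intro suminf_le)
      fix i
      show "ennreal ?c * emeasure lborel (K i) \<le> hausdorff_gauge ?d (C i)"
      proof (cases "C i = {}")
        case False
        have d0: "diameter (C i) \<ge> 0" using C(2) diameter_ge_0 by blast
        have le: "lo i \<bullet> j \<le> hi i \<bullet> j" if "j \<in> Basis" for j
          using that d0 by (simp add: lo_def hi_def)
        have "emeasure lborel (K i) = ennreal (\<Prod>j\<in>Basis. (hi i - lo i) \<bullet> j)"
          using False le by (simp add: K_def)
        also have "(\<Prod>j\<in>Basis. (hi i - lo i) \<bullet> j) = (\<Prod>j\<in>insert b (Basis - {b}). (hi i - lo i) \<bullet> j)"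
          using b by (simp add: insert_absorb)
        also have "\<dots> = ((hi i - lo i) \<bullet> b) * (\<Prod>j\<in>Basis - {b}. (hi i - lo i) \<bullet> j)"
          by (subst prod.insert) auto
        also have "(hi i - lo i) \<bullet> b = 1" using b by (simp add: lo_def hi_def inner_diff_left)
        also have "(\<Prod>j\<in>Basis - {b}. (hi i - lo i) \<bullet> j) = (\<Prod>j\<in>Basis - {b}. 2 * diameter (C i))"
          by (intro prod.cong) (auto simp: lo_def hi_def inner_diff_left)
        also have "\<dots> = (2 * diameter (C i)) ^ ?d"
          using b by simp
        finally have eq: "emeasure lborel (K i) = ennreal ((2 * diameter (C i)) ^ ?d)" by simp
        have "ennreal ?c * emeasure lborel (K i) = ennreal (?c * (2 * diameter (C i)) ^ ?d)"
          unfolding eq using d0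
          by (intro ennreal_mult[symmetric] divide_nonneg_pos unit_ball_vol_nonneg) auto
        also have "?c * (2 * diameter (C i)) ^ ?d = unit_ball_vol (real ?d) * (2 * diameter (C i) / 4) ^ ?d"
          unfolding power_divide by simp
        also have "2 * diameter (C i) / 4 = diameter (C i) / 2" by simp
        finally show ?thesis
          using False by (simp add: hausdorff_gauge_def)
      qed (simp add: K_def)
    qed auto
    finally show "ennreal ?c * emeasure lborel S \<le> (\<Sum>i. hausdorff_gauge ?d (C i))" .
  qed
  also have "\<dots> \<le> hausdorff_outer ?d A"
    by (intro hausdorff_content_le_outer) auto
  finally show ?thesis .
qed

section \<open>Growth of the surface measure of a closed hypersurface\<close>

lemma Ck_on_Suc_0_imp_lipschitz_ball:
  fixes f :: "'a::euclidean_space \<Rightarrow> 'b::real_normed_vector"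
  assumes "open S" "p \<in> S" and f: "Ck_on (Suc 0) S f"
  obtains e L where "e > 0" "ball p e \<subseteq> S" "L-lipschitz_on (ball p e) f"
proof -
  have der: "(f has_derivative frechet_derivative f (at x)) (at x)" if "x \<in> S" for x
    using f that \<open>open S\<close> by (auto simp: differentiable_on_eq_differentiable_at frechet_derivative_works)
  \<comment> \<open>G dominates the operator norm of the derivative and is continuous, hence bounded
    near p.\<close>
  define G where "G x = (\<Sum>b\<in>Basis. norm (partial_deriv b f x))" for x
  have "continuous_on S G"
    using f unfolding G_def by (auto intro!: continuous_intros)
  then have "isCont G p" using \<open>open S\<close> \<open>p \<in> S\<close> by (simp add: continuous_on_eq_continuous_at)
  then have "eventually (\<lambda>x. G x < G p + 1) (at p)"
    by (auto simp: isCont_def intro!: order_tendstoD)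
  then have "eventually (\<lambda>x. G x < G p + 1) (nhds p)" 
    by (simp add: eventually_nhds_conv_at)
  moreover have "eventually (\<lambda>x. x \<in> S) (nhds p)" using \<open>open S\<close> \<open>p \<in> S\<close> by (rule eventually_nhds_in_open)
  ultimately have "eventually (\<lambda>x. x \<in> S \<and> G x < G p + 1) (nhds p)" by eventually_elim simp
  then obtain e where e: "e > 0" "\<And>x. dist x p < e \<Longrightarrow> x \<in> S \<and> G x < G p + 1"
    by (auto simp: eventually_nhds_metric)
  have G0: "G p \<ge> 0" by (auto simp: G_def intro!: sum_nonneg)
  have "(G p + 1)-lipschitz_on (ball p e) f"
  proof (rule lipschitz_onI)
    fix x y assume "x \<in> ball p e" "y \<in> ball p e"
    then show "dist (f x) (f y) \<le> (G p + 1) * dist x y"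
      unfolding dist_norm
    proof (intro differentiable_bound[of "ball p e"])
      fix z assume "z \<in> ball p e"
      then have z: "z \<in> S" "G z < G p + 1" using e by (auto simp: dist_commute)
      show "(f has_derivative frechet_derivative f (at z)) (at z within ball p e)"
        using der[OF z(1)] by (rule has_derivative_at_withinI)
      show "onorm (frechet_derivative f (at z)) \<le> G p + 1"
        using onorm_componentwise[OF has_derivative_bounded_linear[OF der[OF z(1)]]] z(2)
        by (simp add: G_def partial_deriv_def)
    qed auto
  qed (use G0 in auto)
  with e show thesis by (intro that[of e "G p + 1"]) (auto simp: dist_commute)
qed

text \<open>In a slice chart \<Gamma> is the image of a piece of a coordinate hyperplane under the
  Lipschitz map \<Psi>. The ball of radius r may be centred off \<Gamma>, so the planar piece is
  centred at the image of some point q of the intersection, which doubles r.\<close>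

lemma smooth_hypersurface_local_growth:
  fixes \<Gamma> :: "'a::euclidean_space set"
  assumes "smooth_hypersurface \<Gamma>" "p \<in> \<Gamma>"
  shows "\<exists>e>0. \<exists>C\<ge>0. \<forall>x. \<forall>r>0.
    hausdorff_outer (DIM('a) - 1) (\<Gamma> \<inter> ball p e \<inter> ball x r) \<le> ennreal (C * r ^ (DIM('a) - 1))"
proof -
  let ?d = "DIM('a) - 1"
  obtain U V \<Phi> \<Psi> b where ch: "b \<in> (Basis :: 'a set)" "open U" "p \<in> U" "open V"
      "homeomorphism U V \<Phi> \<Psi>" "smooth_on U \<Phi>" "smooth_on V \<Psi>"
      "\<Phi> ` (\<Gamma> \<inter> U) = {y \<in> V. y \<bullet> b = 0}"
    using bspec[OF assms(1)[unfolded smooth_hypersurface_def] assms(2)] by (elim exE bexE conjE)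
  have pV: "\<Phi> p \<in> V" using ch by (auto simp: homeomorphism_def)
  obtain e1 L1 where e1: "e1 > 0" "ball p e1 \<subseteq> U" "L1-lipschitz_on (ball p e1) \<Phi>"
    by (rule Ck_on_Suc_0_imp_lipschitz_ball[of U p \<Phi>]) (use ch in \<open>auto simp: smooth_on_def simp del: Ck_on.simps\<close>)
  obtain e2 L2 where e2: "e2 > 0" "ball (\<Phi> p) e2 \<subseteq> V" "L2-lipschitz_on (ball (\<Phi> p) e2) \<Psi>"
    by (rule Ck_on_Suc_0_imp_lipschitz_ball[of V "\<Phi> p" \<Psi>])
      (use ch pV in \<open>auto simp: smooth_on_def simp del: Ck_on.simps\<close>)
  have L: "L1 \<ge> 0" "L2 \<ge> 0" using e1 e2 lipschitz_on_nonneg by blast+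
  \<comment> \<open>Keeps the image of ball p e under \<Phi> inside the ball on which \<Psi> is
    Lipschitz; L1 + 1 replaces L1 in order to have a positive factor.\<close>
  define e where "e = min e1 (e2 / (L1 + 1))"
  have e: "e > 0" "e \<le> e1" using e1 e2 L by (auto simp: e_def)
  have "(L1 + 1) * e \<le> (L1 + 1) * (e2 / (L1 + 1))"
    using L by (intro mult_left_mono) (auto simp: e_def)
  then have e': "(L1 + 1) * e \<le> e2" using L by simp
  have lip: "dist (\<Phi> x) (\<Phi> y) \<le> (L1 + 1) * dist x y" if "x \<in> ball p e" "y \<in> ball p e" for x y
  proof -
    have "dist (\<Phi> x) (\<Phi> y) \<le> L1 * dist x y"
      using that e by (intro lipschitz_onD[OF e1(3)]) auto
    then show ?thesis using zero_le_dist[of x y] unfolding distrib_right by linarith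
  qed
  define C where "C = unit_ball_vol (real ?d) * (2 * real DIM('a) * ((L1 + 1) * 2) * L2) ^ ?d"
  have "hausdorff_outer ?d (\<Gamma> \<inter> ball p e \<inter> ball x r) \<le> ennreal (C * r ^ ?d)" if r: "r > 0" for x r
  proof (cases "\<Gamma> \<inter> ball p e \<inter> ball x r = {}")
    case False
    then obtain q where q: "q \<in> \<Gamma> \<inter> ball p e \<inter> ball x r" by blast
    define E where "E = \<Gamma> \<inter> ball p e \<inter> ball x r"
    have "hausdorff_outer ?d (\<Psi> ` \<Phi> ` E) \<le>
       ennreal (unit_ball_vol (real ?d) * (2 * real DIM('a) * ((L1 + 1) * (2 * r)) * L2) ^ ?d)"
    proof (rule hausdorff_outer_lipschitz_image_plane[OF ch(1)])
      show "\<Phi> ` E \<subseteq> {y. y \<bullet> b = 0} \<inter> cball (\<Phi> q) ((L1 + 1) * (2 * r))"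
      proof
        fix y assume "y \<in> \<Phi> ` E"
        then obtain z where z: "y = \<Phi> z" "z \<in> E" by blast
        have "dist (\<Phi> q) (\<Phi> z) \<le> (L1 + 1) * dist q z"
          using z q by (intro lip) (auto simp: E_def)
        also have "dist q z \<le> 2 * r"
          using z q dist_triangle_half_r[of x q "2 * r" z] by (auto simp: E_def)
        finally have "dist (\<Phi> q) (\<Phi> z) \<le> (L1 + 1) * (2 * r)" using L by auto
        moreover have "z \<in> \<Gamma> \<inter> U" using z e e1 by (auto simp: E_def)
        then have "\<Phi> z \<bullet> b = 0" using ch(8) by blast
        ultimately show "y \<in> {y. y \<bullet> b = 0} \<inter> cball (\<Phi> q) ((L1 + 1) * (2 * r))" using z by simp
      qed
      show "L2-lipschitz_on (\<Phi> ` E) \<Psi>"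
      proof (rule lipschitz_on_subset[OF e2(3)], clarify)
        fix z assume z: "z \<in> E"
        then have "dist (\<Phi> p) (\<Phi> z) \<le> (L1 + 1) * dist p z"
          using e by (intro lip) (auto simp: E_def)
        also have "\<dots> < (L1 + 1) * e" using z L by (intro mult_strict_left_mono) (auto simp: E_def)
        finally show "\<Phi> z \<in> ball (\<Phi> p) e2" using e' by simp
      qed
    qed (use r L in auto)
    also have "\<Psi> ` \<Phi> ` E = E"
    proof -
      have "\<Psi> (\<Phi> z) = z" if "z \<in> E" for z
      proof -
        have "z \<in> ball p e1" using that e by (simp add: E_def)
        then have "z \<in> U" using e1 by blast
        then show ?thesis using ch(5) by (simp add: homeomorphism_def)
      qed
      then show ?thesis by force
    qed
    also have "unit_ball_vol (real ?d) * (2 * real DIM('a) * ((L1 + 1) * (2 * r)) * L2) ^ ?d = C * r ^ ?d"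
      by (simp only: C_def mult.assoc flip: power_mult_distrib) (simp only: mult_ac)
    finally show ?thesis by (simp add: E_def)
  qed simp
  moreover have "C \<ge> 0" using L by (auto simp: C_def)
  ultimately show ?thesis using e by blast
qed

text \<open>Finitely many chart neighbourhoods cover the compact \<Gamma>, and their constants add
  up. The potential theory sees the regularity of \<Gamma> only through this bound, which is uniform
  in centre and radius.\<close>

theorem smooth_closed_hypersurface_growth:
  fixes \<Gamma> :: "'a::euclidean_space set"
  assumes "smooth_closed_hypersurface \<Gamma>"
  obtains C where "C \<ge> 0"
    "\<And>x r. r > 0 \<Longrightarrow> hausdorff_outer (DIM('a) - 1) (\<Gamma> \<inter> ball x r) \<le> ennreal (C * r ^ (DIM('a) - 1))"
proof -
  let ?d = "DIM('a) - 1"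
  define G where "G p e C \<longleftrightarrow> e > 0 \<and> C \<ge> 0 \<and> (\<forall>x. \<forall>r>0.
    hausdorff_outer ?d (\<Gamma> \<inter> ball p e \<inter> ball x r) \<le> ennreal (C * r ^ ?d))" for p e C
  have "\<forall>p\<in>\<Gamma>. \<exists>e C. G p e C"
    using smooth_hypersurface_local_growth[of \<Gamma>] assms
    unfolding smooth_closed_hypersurface_def G_def by blast
  then obtain e where "\<forall>p\<in>\<Gamma>. \<exists>C. G p (e p) C" by (rule bchoice[THEN exE])
  then obtain C where "\<forall>p\<in>\<Gamma>. G p (e p) (C p)" by (rule bchoice[THEN exE])
  then have eC: "\<And>p. p \<in> \<Gamma> \<Longrightarrow> e p > 0" "\<And>p. p \<in> \<Gamma> \<Longrightarrow> C p \<ge> 0"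
     "\<And>p x r. p \<in> \<Gamma> \<Longrightarrow> r > 0 \<Longrightarrow> hausdorff_outer ?d (\<Gamma> \<inter> ball p (e p) \<inter> ball x r) \<le> ennreal (C p * r ^ ?d)"
    by (simp_all add: G_def)
  have "compact \<Gamma>" using assms by (simp add: smooth_closed_hypersurface_def)
  moreover have "\<Gamma> \<subseteq> (\<Union>p\<in>\<Gamma>. ball p (e p))" using eC(1) by auto
  ultimately obtain D where D: "D \<subseteq> \<Gamma>" "finite D" "\<Gamma> \<subseteq> (\<Union>p\<in>D. ball p (e p))"
    using compactE_image[of \<Gamma> \<Gamma> "\<lambda>p. ball p (e p)"] by blast
  have "hausdorff_outer ?d (\<Gamma> \<inter> ball x r) \<le> ennreal ((\<Sum>p\<in>D. C p) * r ^ ?d)" if r: "r > 0" for x r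
  proof -
    have "hausdorff_outer ?d (\<Gamma> \<inter> ball x r) \<le> hausdorff_outer ?d (\<Union>p\<in>D. \<Gamma> \<inter> ball p (e p) \<inter> ball x r)"
      using D by (intro hausdorff_outer_mono) blast
    also have "\<dots> \<le> (\<Sum>p\<in>D. hausdorff_outer ?d (\<Gamma> \<inter> ball p (e p) \<inter> ball x r))"
      by (rule hausdorff_outer_finite_UN[OF D(2)])
    also have "\<dots> \<le> (\<Sum>p\<in>D. ennreal (C p * r ^ ?d))"
      using D r by (intro sum_mono eC) auto
    also have "\<dots> = ennreal ((\<Sum>p\<in>D. C p) * r ^ ?d)"
      using D eC r by (subst sum_ennreal) (auto simp: sum_distrib_right)
    finally show ?thesis .
  qed
  moreover have "(\<Sum>p\<in>D. C p) \<ge> 0" using D eC by (auto intro!: sum_nonneg)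
  ultimately show thesis by (intro that) auto
qed

section \<open>Smooth functions and Green's identity\<close>

lemma Ck_on_cong_open:
  assumes "open S" "\<And>x. x \<in> S \<Longrightarrow> f x = g x"
  shows "Ck_on k S f \<longleftrightarrow> Ck_on k S g"
  using assms(2)
proof (induction k arbitrary: f g)
  case 0
  then show ?case by (auto intro: continuous_on_cong)
next
  case (Suc k)
  have der: "(f has_derivative D) (at x) \<longleftrightarrow> (g has_derivative D) (at x)" if "x \<in> S" for x D
    using has_derivative_transform_within_open[of f D x UNIV S g]
      has_derivative_transform_within_open[of g D x UNIV S f] Suc.prems that \<open>open S\<close> by auto
  then have "frechet_derivative f (at x) = frechet_derivative g (at x)" if "x \<in> S" for x
    using that by (simp add: frechet_derivative_def)
  then have "Ck_on k S (partial_deriv b f) \<longleftrightarrow> Ck_on k S (partial_deriv b g)" for b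
    by (intro Suc.IH) (simp add: partial_deriv_def)
  moreover have "f differentiable_on S \<longleftrightarrow> g differentiable_on S"
    using \<open>open S\<close> der by (auto simp: differentiable_on_eq_differentiable_at differentiable_def)
  ultimately show ?case by simp
qed

lemma partial_deriv_eqI: "(f has_derivative D) (at x) \<Longrightarrow> partial_deriv b f x = D b"
  unfolding partial_deriv_def by (metis frechet_derivative_at)

lemma Ck_on_SucI:
  assumes "open S" "\<And>x. x \<in> S \<Longrightarrow> (f has_derivative D x) (at x)"
    and "\<And>b. b \<in> Basis \<Longrightarrow> Ck_on k S (\<lambda>x. D x b)"
  shows "Ck_on (Suc k) S f"
proof -
  have "Ck_on k S (partial_deriv b f)" if "b \<in> Basis" for b
    using assms(3)[OF that] Ck_on_cong_open[OF assms(1), of "partial_deriv b f" "\<lambda>x. D x b"]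
      partial_deriv_eqI[OF assms(2)] by auto
  moreover have "f differentiable_on S"
    using assms(1,2) by (auto simp: differentiable_on_eq_differentiable_at differentiable_def)
  ultimately show ?thesis by simp
qed

lemma Ck_on_Suc_has_derivative:
  assumes "open S" "Ck_on (Suc k) S f" "x \<in> S"
  shows "(f has_derivative frechet_derivative f (at x)) (at x)"
  using assms by (auto simp: differentiable_on_eq_differentiable_at frechet_derivative_works)

lemma Ck_on_SucD: "Ck_on (Suc k) S f \<Longrightarrow> Ck_on k S f"
proof (induction k arbitrary: f)
  case 0
  then show ?case by (simp add: differentiable_imp_continuous_on)
next
  case (Suc k)
  have "Ck_on k S (partial_deriv b f)" if "b \<in> Basis" for b
    using Suc.prems that by (intro Suc.IH) simp
  then show ?case using Suc.prems by simp
qed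

lemma Ck_on_const: "open S \<Longrightarrow> Ck_on k S (\<lambda>x. c)"
proof (induction k arbitrary: c)
  case (Suc k)
  then show ?case by (intro Ck_on_SucI[where D="\<lambda>_ _. 0"]) auto
qed auto

lemma Ck_on_inner: "open S \<Longrightarrow> Ck_on k S (\<lambda>x. x \<bullet> c)"
proof (cases k)
  case (Suc k)
  assume "open S"
  then show ?thesis unfolding Suc
    by (intro Ck_on_SucI[where D="\<lambda>_ v. v \<bullet> c"] Ck_on_const)
      (auto intro!: derivative_eq_intros)
qed (auto intro!: continuous_intros)

lemma Ck_on_add:
  assumes "open S" "Ck_on k S f" "Ck_on k S g"
  shows "Ck_on k S (\<lambda>x. f x + g x)"
  using assms(2,3)
proof (induction k arbitrary: f g)
  case (Suc k)
  show ?case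
  proof (rule Ck_on_SucI[OF assms(1)])
    fix x assume "x \<in> S"
    then show "((\<lambda>x. f x + g x) has_derivative
        (\<lambda>v. frechet_derivative f (at x) v + frechet_derivative g (at x) v)) (at x)"
      by (intro has_derivative_add Ck_on_Suc_has_derivative[OF assms(1) Suc.prems(1)]
          Ck_on_Suc_has_derivative[OF assms(1) Suc.prems(2)])
  next
    fix b :: 'a assume "b \<in> Basis"
    then show "Ck_on k S (\<lambda>x. frechet_derivative f (at x) b + frechet_derivative g (at x) b)"
      using Suc.prems by (intro Suc.IH) (auto simp: partial_deriv_def[abs_def])
  qed
qed (auto intro!: continuous_intros)

lemma Ck_on_mult:
  fixes f g :: "'a::euclidean_space \<Rightarrow> real"
  assumes "open S" "Ck_on k S f" "Ck_on k S g"
  shows "Ck_on k S (\<lambda>x. f x * g x)"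
  using assms(2,3)
proof (induction k arbitrary: f g)
  case (Suc k)
  show ?case
  proof (rule Ck_on_SucI[OF assms(1)])
    fix x assume "x \<in> S"
    then show "((\<lambda>x. f x * g x) has_derivative
        (\<lambda>v. f x * frechet_derivative g (at x) v + frechet_derivative f (at x) v * g x)) (at x)"
      by (intro has_derivative_mult Ck_on_Suc_has_derivative[OF assms(1) Suc.prems(1)]
          Ck_on_Suc_has_derivative[OF assms(1) Suc.prems(2)])
  next
    fix b :: 'a assume "b \<in> Basis"
    then show "Ck_on k S (\<lambda>x. f x * frechet_derivative g (at x) b + frechet_derivative f (at x) b * g x)"
      using Suc.prems Ck_on_SucD[OF Suc.prems(1)] Ck_on_SucD[OF Suc.prems(2)]
      by (intro Ck_on_add[OF assms(1)] Suc.IH) (auto simp: partial_deriv_def[abs_def])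
  qed
qed (auto intro!: continuous_intros)

lemma
  assumes "open S"
  shows smooth_on_const: "smooth_on S (\<lambda>x. c)"
    and smooth_on_inner: "smooth_on S (\<lambda>x. x \<bullet> v)"
    and smooth_on_add: "smooth_on S f \<Longrightarrow> smooth_on S g \<Longrightarrow> smooth_on S (\<lambda>x. f x + g x)"
    and smooth_on_mult: "smooth_on S p \<Longrightarrow> smooth_on S q \<Longrightarrow> smooth_on S (\<lambda>x. p x * q x :: real)"
  using assms by (auto simp: smooth_on_def intro: Ck_on_const Ck_on_inner Ck_on_add Ck_on_mult)

lemma smooth_on_sum:
  assumes "open S" "\<And>i. i \<in> I \<Longrightarrow> smooth_on S (f i)"
  shows "smooth_on S (\<lambda>x. \<Sum>i\<in>I. f i x)"
  using assms(2)
  by (induction I rule: infinite_finite_induct)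
    (auto intro!: smooth_on_const smooth_on_add assms(1))

lemma smooth_on_norm_square: "open S \<Longrightarrow> smooth_on S (\<lambda>x::'a::euclidean_space. x \<bullet> x)"
  by (subst euclidean_inner) (intro smooth_on_sum smooth_on_mult smooth_on_inner)

lemma smooth_on_quadratic:
  fixes \<beta> :: "'a::euclidean_space"
  assumes "open S"
  shows "smooth_on S (\<lambda>x. \<alpha> * (x \<bullet> x) - 2 * (x \<bullet> \<beta>) + \<gamma>)"
proof -
  have "smooth_on S (\<lambda>x. \<alpha> * (x \<bullet> x) + (-2) * (x \<bullet> \<beta>) + \<gamma>)"
    using assms by (intro smooth_on_add smooth_on_mult smooth_on_const smooth_on_inner smooth_on_norm_square)
  then show ?thesis by simp
qed

lemma smooth_on_has_derivative:
  "open S \<Longrightarrow> smooth_on S f \<Longrightarrow> x \<in> S \<Longrightarrow> (f has_derivative frechet_derivative f (at x)) (at x)"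
  unfolding smooth_on_def by (metis Ck_on_Suc_has_derivative)

lemma smooth_on_imp_continuous_on: "smooth_on S f \<Longrightarrow> continuous_on S f"
  unfolding smooth_on_def by (metis Ck_on.simps(1))

lemma smooth_on_partial_deriv: "smooth_on S f \<Longrightarrow> b \<in> Basis \<Longrightarrow> smooth_on S (partial_deriv b f)"
  unfolding smooth_on_def by (metis Ck_on.simps(2))

text \<open>Meant for functions known only as antiderivatives, whose smoothness has to be read off
  the derivative.\<close>

lemma smooth_on_intro_derivative:
  assumes "open S" "\<And>x. x \<in> S \<Longrightarrow> (f has_derivative D x) (at x)"
    and "\<And>b. b \<in> Basis \<Longrightarrow> smooth_on S (\<lambda>x. D x b)"
  shows "smooth_on S f"
  unfolding smooth_on_def
proof
  fix k
  have "Ck_on (Suc k) S f"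
    using assms by (intro Ck_on_SucI[where D=D]) (auto simp: smooth_on_def)
  then show "Ck_on k S f" by (rule Ck_on_SucD)
qed

section \<open>Smooth functions of one real variable and the flat bump\<close>

definition smooth_real_on :: "real set \<Rightarrow> (real \<Rightarrow> real) \<Rightarrow> bool" where
  "smooth_real_on T h \<longleftrightarrow> (\<exists>D :: nat \<Rightarrow> real \<Rightarrow> real. D 0 = h \<and>
     (\<forall>k. \<forall>t\<in>T. (D k has_real_derivative D (Suc k) t) (at t)))"

text \<open>The induction treats all derivatives \<open>D j\<close> at once, since differentiating
  \<open>D j\<close> after q produces \<open>D (Suc j)\<close> after q. This is why
  \<open>smooth_real_on\<close> asks for a whole sequence of derivatives.\<close>

lemma smooth_on_compose_real:
  assumes "open S" "smooth_real_on T h" "smooth_on S q" "\<And>x. x \<in> S \<Longrightarrow> q x \<in> T"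
  shows "smooth_on S (\<lambda>x. h (q x))"
proof -
  obtain D where D: "D 0 = h" "\<And>k t. t \<in> T \<Longrightarrow> (D k has_real_derivative D (Suc k) t) (at t)"
    using assms(2) unfolding smooth_real_on_def by blast
  have "Ck_on k S (\<lambda>x. D j (q x))" for k j
  proof (induction k arbitrary: j)
    case 0
    have "continuous_on T (D j)"
      using D(2) by (intro continuous_at_imp_continuous_on) (auto intro: DERIV_isCont)
    then show ?case
      using continuous_on_compose2[of T "D j" S q] smooth_on_imp_continuous_on[OF assms(3)] assms(4) by auto
  next
    case (Suc k)
    show ?case
    proof (rule Ck_on_SucI[OF assms(1)])
      fix x assume x: "x \<in> S"
      show "((\<lambda>x. D j (q x)) has_derivative (\<lambda>v. D (Suc j) (q x) * frechet_derivative q (at x) v)) (at x)"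
        using has_derivative_compose[OF smooth_on_has_derivative[OF assms(1,3) x]
            D(2)[OF assms(4)[OF x], of j, unfolded has_field_derivative_def]] .
    next
      fix b :: 'a assume b: "b \<in> Basis"
      have "Ck_on k S (partial_deriv b q)"
        using smooth_on_partial_deriv[OF assms(3) b] by (simp add: smooth_on_def)
      then show "Ck_on k S (\<lambda>x. D (Suc j) (q x) * frechet_derivative q (at x) b)"
        by (intro Ck_on_mult[OF assms(1)] Suc.IH) (simp add: partial_deriv_def[abs_def])
    qed
  qed
  from this[of _ 0] show ?thesis by (simp add: smooth_on_def D(1))
qed

lemma smooth_real_on_powr: "smooth_real_on {0<..} (\<lambda>t. t powr a)"
  unfolding smooth_real_on_def
proof (intro exI conjI allI ballI)
  fix k and t :: real assume "t \<in> {0<..}"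
  then show "((\<lambda>t. (\<Prod>i<k. a - real i) * t powr (a - real k)) has_real_derivative
      (\<Prod>i<Suc k. a - real i) * t powr (a - real (Suc k))) (at t)"
    by (auto intro!: derivative_eq_intros simp: algebra_simps)
qed simp

definition exp_bump :: "real poly \<Rightarrow> real \<Rightarrow> real" where
  "exp_bump p t = (if 0 < t then poly p (1 / t) * exp (- (1 / t)) else 0)"

lemma tendsto_poly_div_exp_0: "((\<lambda>x::real. poly p x / exp x) \<longlongrightarrow> 0) at_top"
proof -
  have "((\<lambda>x::real. \<Sum>i\<le>degree p. coeff p i * (x ^ i / exp x)) \<longlongrightarrow> (\<Sum>i\<le>degree p. coeff p i * 0)) at_top"
    by (intro tendsto_intros tendsto_power_div_exp_0)
  then show ?thesis by (simp add: poly_altdef sum_divide_distrib)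
qed

text \<open>With s = 1/t, the derivative of p(s) exp(-s) in t is s^2 (p(s) - p'(s)) exp(-s), so the
  family is closed under differentiation; \<open>[:0, 0, 1:]\<close> is s^2. At t = 0 the right
  difference quotient is s p(s) / exp(s) with s tending to infinity, whence
  \<open>pCons 0 p\<close>.\<close>

lemma exp_bump_has_derivative:
  "(exp_bump p has_real_derivative exp_bump ([:0, 0, 1:] * (p - pderiv p)) t) (at t)"
proof (cases t "0::real" rule: linorder_cases)
  case less
  then have "eventually (\<lambda>s. s \<in> {..<0}) (nhds t)" by (intro eventually_nhds_in_open) auto
  then have "eventually (\<lambda>s. exp_bump p s = 0) (nhds t)"
    by eventually_elim (auto simp: exp_bump_def)
  moreover have "((\<lambda>s. 0) has_real_derivative 0) (at t)" by simp
  ultimately have "(exp_bump p has_real_derivative 0) (at t)"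
    by (subst DERIV_cong_ev[OF refl _ refl])
  then show ?thesis using less by (simp add: exp_bump_def)
next
  case greater
  then have "eventually (\<lambda>s. s \<in> {0<..}) (nhds t)" by (intro eventually_nhds_in_open) auto
  then have "eventually (\<lambda>s. exp_bump p s = poly p (1 / s) * exp (- (1 / s))) (nhds t)"
    by eventually_elim (auto simp: exp_bump_def)
  moreover have "((\<lambda>s. poly p (1 / s) * exp (- (1 / s))) has_real_derivative
      exp_bump ([:0, 0, 1:] * (p - pderiv p)) t) (at t)"
    using greater
    by (auto intro!: derivative_eq_intros poly_DERIV[THEN DERIV_chain2]
        simp: exp_bump_def field_simps power2_eq_square)
  ultimately show ?thesis
    by (subst DERIV_cong_ev[OF refl _ refl])
next
  case equal
  have "((\<lambda>h. exp_bump p h / h) \<longlongrightarrow> 0) (at 0)"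
  proof (rule filterlim_split_at)
    show "((\<lambda>h. exp_bump p h / h) \<longlongrightarrow> 0) (at_left 0)"
    proof (rule tendsto_eventually)
      show "eventually (\<lambda>h. exp_bump p h / h = 0) (at_left (0::real))"
        by (auto simp: eventually_at_filter exp_bump_def)
    qed
    have "((\<lambda>h. poly (pCons 0 p) (inverse h) / exp (inverse h)) \<longlongrightarrow> 0) (at_right (0::real))"
      by (rule filterlim_compose[OF tendsto_poly_div_exp_0 filterlim_inverse_at_top_right])
    moreover have "eventually (\<lambda>h. poly (pCons 0 p) (inverse h) / exp (inverse h)
        = exp_bump p h / h) (at_right (0::real))"
      by (auto simp: eventually_at_filter exp_bump_def field_simps exp_minus)
    ultimately show "((\<lambda>h. exp_bump p h / h) \<longlongrightarrow> 0) (at_right 0)"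
      by (rule Lim_transform_eventually)
  qed
  then show ?thesis using equal by (simp add: DERIV_def exp_bump_def)
qed

lemma smooth_real_on_exp_bump: "smooth_real_on UNIV (exp_bump p)"
  unfolding smooth_real_on_def
proof (intro exI conjI allI ballI)
  let ?F = "\<lambda>p :: real poly. [:0, 0, 1:] * (p - pderiv p)"
  fix k t
  show "(exp_bump ((?F ^^ k) p) has_real_derivative exp_bump ((?F ^^ Suc k) p) t) (at t)"
    unfolding funpow.simps o_def by (rule exp_bump_has_derivative)
qed simp

section \<open>Integration by parts for compactly supported functions\<close>

lemma integrable_compact_support:
  fixes f :: "'a::euclidean_space \<Rightarrow> real"
  assumes "compact K" "continuous_on K f" "\<And>x. x \<notin> K \<Longrightarrow> f x = 0"
  shows "integrable lborel f"
proof -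
  have "(\<lambda>x. indicator K x *\<^sub>R f x) = f" using assms(3) by (auto simp: fun_eq_iff indicator_def)
  then show ?thesis using borel_integrable_compact[OF assms(1,2)] by simp
qed

text \<open>By translation invariance every difference quotient of v has integral 0, and dominated
  convergence passes to the derivative. This plays the role of the divergence theorem, compact
  support leaving no boundary term.\<close>

lemma integral_directional_derivative_compact_support:
  fixes v :: "'a::euclidean_space \<Rightarrow> real"
  assumes der: "\<And>x. (v has_derivative D x) (at x)" and cont: "continuous_on UNIV (\<lambda>x. D x b)"
    and K: "compact K" "\<And>x. x \<notin> K \<Longrightarrow> v x = 0"
  shows "(LINT x|lborel. D x b) = 0"
proof -
  have D0: "D x b = 0" if "x \<notin> K" for x
  proof -
    have "open (- K)" using compact_imp_closed[OF K(1)] by (simp add: open_Compl)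
    then have "(v has_derivative (\<lambda>_. 0)) (at x)"
      by (rule has_derivative_transform_within_open[OF has_derivative_const])
        (use that K(2) in simp_all)
    from has_derivative_unique[OF der this] show ?thesis by simp
  qed
  have contv: "continuous_on A v" for A
    using der has_derivative_continuous by (intro continuous_at_imp_continuous_on) blast
  have intv: "integrable lborel v"
    using K contv by (intro integrable_compact_support[of K])
  obtain r where "\<And>x. x \<in> K \<Longrightarrow> norm x \<le> r"
    using compact_imp_bounded[OF K(1)] unfolding bounded_iff by blast
  then have r: "K \<subseteq> cball 0 r" by auto
  have "compact ((\<lambda>x. D x b) ` K)"
    using K(1) cont by (intro compact_continuous_image) (auto intro: continuous_on_subset)
  then obtain M0 where M0: "\<And>x. x \<in> K \<Longrightarrow> \<bar>D x b\<bar> \<le> M0"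
    using compact_imp_bounded bounded_iff by (metis image_eqI real_norm_def)
  define M where "M = max M0 0"
  have M: "\<bar>D x b\<bar> \<le> M" for x using M0[of x] D0[of x] by (cases "x \<in> K") (auto simp: M_def)
  have line: "((\<lambda>u. v (x + u *\<^sub>R b)) has_real_derivative D (x + u *\<^sub>R b) b) (at u)" for x u
  proof -
    have "((\<lambda>u. v (x + u *\<^sub>R b)) has_derivative (\<lambda>w. D (x + u *\<^sub>R b) (w *\<^sub>R b))) (at u)"
      by (rule has_derivative_compose[of "\<lambda>u. x + u *\<^sub>R b" "\<lambda>u. u *\<^sub>R b" u UNIV v])
        (auto intro!: derivative_eq_intros der)
    also have "(\<lambda>w. D (x + u *\<^sub>R b) (w *\<^sub>R b)) = (*) (D (x + u *\<^sub>R b) b)"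
      using linear_scale[OF has_derivative_linear[OF der[of "x + u *\<^sub>R b"]]] by (auto simp: mult.commute)
    finally show ?thesis by (simp add: has_field_derivative_def)
  qed
  \<comment> \<open>Steps of size at most 1 keep the supports of all difference quotients in one
    ball of radius r + norm b.\<close>
  define t where "t m = inverse (real (Suc m))" for m
  have t: "t m > 0" "t m \<le> 1" for m by (auto simp: t_def field_simps)
  define s where "s m x = (v (x + t m *\<^sub>R b) - v x) / t m" for m x
  have "(\<lambda>m. LINT x|lborel. s m x) \<longlonglongrightarrow> (LINT x|lborel. D x b)"
  proof (rule integral_dominated_convergence)
    show "(\<lambda>x. D x b) \<in> borel_measurable lborel"
      using cont by (simp add: borel_measurable_continuous_onI)
    show "s m \<in> borel_measurable lborel" for m
      unfolding s_def using contv[of UNIV]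
      by (intro borel_measurable_divide borel_measurable_diff)
         (auto intro!: borel_measurable_continuous_onI continuous_intros continuous_on_compose2[OF contv[of UNIV]])
    show "integrable lborel (\<lambda>x. indicator (cball 0 (r + norm b)) x *\<^sub>R M)"
      by (intro borel_integrable_compact) auto
    show "AE x in lborel. (\<lambda>m. s m x) \<longlonglongrightarrow> D x b"
    proof (rule AE_I2)
      fix x
      have "((\<lambda>u. v (x + u *\<^sub>R b)) has_real_derivative D x b) (at 0)"
        using line[of x 0] by simp
      then have "((\<lambda>h. (v (x + h *\<^sub>R b) - v x) / h) \<longlongrightarrow> D x b) (at 0)"
        by (simp add: DERIV_def)
      moreover have "t \<longlonglongrightarrow> 0"
        unfolding t_def by (rule LIMSEQ_inverse_real_of_nat)
      then have "filterlim t (at 0) sequentially"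
        using t(1) by (auto simp: filterlim_at less_imp_neq[symmetric])
      ultimately show "(\<lambda>m. s m x) \<longlonglongrightarrow> D x b"
        unfolding s_def by (rule filterlim_compose)
    qed
    show "AE x in lborel. norm (s m x) \<le> indicator (cball 0 (r + norm b)) x *\<^sub>R M" for m
    proof (rule AE_I2)
      fix x
      show "norm (s m x) \<le> indicator (cball 0 (r + norm b)) x *\<^sub>R M"
      proof (cases "x \<in> cball 0 (r + norm b)")
        case True
        have "\<bar>v (x + t m *\<^sub>R b) - v x\<bar> \<le> M * t m"
        proof -
          have "\<exists>z. 0 < z \<and> z < t m \<and> v (x + t m *\<^sub>R b) - v (x + 0 *\<^sub>R b) = (t m - 0) * D (x + z *\<^sub>R b) b"
          proof (rule MVT2)
            show "((\<lambda>u. v (x + u *\<^sub>R b)) has_real_derivative D (x + u *\<^sub>R b) b) (at u)" for u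
              by (rule line)
          qed (rule t)
          then show ?thesis using M t(1)[of m] by (auto simp: abs_mult mult.commute)
        qed
        then show ?thesis using True t(1)[of m] by (simp add: s_def field_simps)
      next
        case False
        have "x \<notin> K" using False r by (smt (verit) norm_ge_zero mem_cball subsetD)
        moreover have "x + t m *\<^sub>R b \<notin> K"
        proof
          assume "x + t m *\<^sub>R b \<in> K"
          then have "norm (x + t m *\<^sub>R b) \<le> r" using r by auto
          moreover have "norm x \<le> norm (x + t m *\<^sub>R b) + norm (t m *\<^sub>R b)"
            using norm_triangle_ineq4[of "x + t m *\<^sub>R b" "t m *\<^sub>R b"] by simp
          moreover have "norm (t m *\<^sub>R b) \<le> norm b" using t[of m] by (simp add: mult_left_le_one_le)
          ultimately show False using False by simp
        qed
        ultimately show ?thesis using False K(2) by (simp add: s_def)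
      qed
    qed
  qed
  moreover have "(LINT x|lborel. s m x) = 0" for m
  proof -
    have m: "v \<in> borel_measurable borel" using contv by (rule borel_measurable_continuous_onI)
    have eq: "integrable lborel (\<lambda>x. v (t m *\<^sub>R b + x)) \<and> (LINT x|lborel. v (t m *\<^sub>R b + x))
        = (LINT x|lborel. v x)"
      using integrable_distr_eq[of "(+) (t m *\<^sub>R b)" lborel borel v]
        integral_distr[of "(+) (t m *\<^sub>R b)" lborel borel v] m intv
      by (simp add: lborel_distr_plus)
    then show ?thesis
      unfolding s_def using intv by (simp add: add.commute[of _ "t m *\<^sub>R b"])
  qed
  ultimately show ?thesis using LIMSEQ_unique[of "\<lambda>_. 0::real"] by simp
qed

section \<open>Laplacians of radial functions and Green's identity\<close>

lemma laplacian_eqI: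
  assumes "open U" "x \<in> U" "\<And>y. y \<in> U \<Longrightarrow> (f has_derivative D y) (at y)"
    and "\<And>b. b \<in> Basis \<Longrightarrow> ((\<lambda>y. D y b) has_derivative E b) (at x)"
  shows "laplacian f x = (\<Sum>b\<in>Basis. E b b)"
  unfolding laplacian_def
proof (rule sum.cong[OF refl])
  fix b :: 'a assume b: "b \<in> Basis"
  have "(partial_deriv b f has_derivative E b) (at x)"
    by (rule has_derivative_transform_within_open[OF assms(4)[OF b] assms(1,2)])
      (simp add: partial_deriv_eqI[OF assms(3)])
  then show "partial_deriv b (partial_deriv b f) x = E b b" by (rule partial_deriv_eqI)
qed

lemma inner_square_sum: "(\<Sum>b\<in>Basis. (y \<bullet> b)\<^sup>2) = y \<bullet> (y :: 'a::euclidean_space)"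
  by (simp add: euclidean_inner[of y y] power2_eq_square)

text \<open>The functions \<open>p \<circ> q\<close> with a quadratic \<open>q\<close> comprise both the (regularised) fundamental
  solution and the corrector of the Green function of the unit ball.\<close>

lemma laplacian_compose_quadratic:
  fixes \<beta> x :: "'a::euclidean_space" and \<alpha> \<gamma> :: real
  defines "q \<equiv> \<lambda>x. \<alpha> * (x \<bullet> x) - 2 * (x \<bullet> \<beta>) + \<gamma>"
  assumes "open T" "q x \<in> T"
    and p': "\<And>t. t \<in> T \<Longrightarrow> (p has_real_derivative p' t) (at t)"
    and p'': "(p' has_real_derivative p2) (at (q x))"
  shows "laplacian (\<lambda>x. p (q x)) x =
    4 * p2 * (\<alpha> * q x - \<alpha> * \<gamma> + \<beta> \<bullet> \<beta>) + 2 * real DIM('a) * \<alpha> * p' (q x)"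
proof -
  have qd: "(q has_derivative (\<lambda>v. 2 * ((\<alpha> *\<^sub>R y - \<beta>) \<bullet> v))) (at y)" for y
    unfolding q_def
    by (auto intro!: derivative_eq_intros simp: algebra_simps inner_commute)
  have "continuous_on UNIV q" unfolding q_def by (intro continuous_intros)
  then have op: "open (q -` T)" using \<open>open T\<close> open_vimage by blast
  have "laplacian (\<lambda>x. p (q x)) x =
      (\<Sum>b\<in>Basis. p2 * (2 * ((\<alpha> *\<^sub>R x - \<beta>) \<bullet> b)) * (2 * ((\<alpha> *\<^sub>R x - \<beta>) \<bullet> b)) + p' (q x) * (2 * \<alpha>))"
  proof (subst laplacian_eqI[OF op, where E="\<lambda>b v. p2 * (2 * ((\<alpha> *\<^sub>R x - \<beta>) \<bullet> v)) * (2 * ((\<alpha> *\<^sub>R x - \<beta>) \<bullet> b)) +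
         p' (q x) * (2 * ((\<alpha> *\<^sub>R v) \<bullet> b))"])
    show "((\<lambda>x. p (q x)) has_derivative (\<lambda>v. p' (q y) * (2 * ((\<alpha> *\<^sub>R y - \<beta>) \<bullet> v)))) (at y)"
      if "y \<in> q -` T" for y
      using has_derivative_compose[OF qd p'[unfolded has_field_derivative_def]] that by simp
    show "((\<lambda>y. p' (q y) * (2 * ((\<alpha> *\<^sub>R y - \<beta>) \<bullet> b))) has_derivative
       (\<lambda>v. p2 * (2 * ((\<alpha> *\<^sub>R x - \<beta>) \<bullet> v)) * (2 * ((\<alpha> *\<^sub>R x - \<beta>) \<bullet> b))
           + p' (q x) * (2 * ((\<alpha> *\<^sub>R v) \<bullet> b)))) (at x)"
      if "b \<in> Basis" for b
      using has_derivative_compose[OF qd p''[unfolded has_field_derivative_def]]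
      by (auto intro!: derivative_eq_intros)
  qed (use assms in \<open>auto intro!: sum.cong\<close>)
  also have "\<dots> = 4 * p2 * (\<Sum>b\<in>Basis. ((\<alpha> *\<^sub>R x - \<beta>) \<bullet> b)\<^sup>2) + 2 * real DIM('a) * \<alpha> * p' (q x)"
  proof -
    define w where "w b = (\<alpha> *\<^sub>R x - \<beta>) \<bullet> b" for b
    show ?thesis
      unfolding w_def[symmetric]
      by (simp add: sum.distrib sum_distrib_left power2_eq_square mult_ac)
  qed
  also have "(\<Sum>b\<in>Basis. ((\<alpha> *\<^sub>R x - \<beta>) \<bullet> b)\<^sup>2) = \<alpha> * q x - \<alpha> * \<gamma> + \<beta> \<bullet> \<beta>"
    unfolding inner_square_sum by (simp add: q_def algebra_simps inner_commute)
  finally show ?thesis .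
qed

text \<open>The linear factor is harmonic, so apart from the radial Laplacian only the cross term of
  the two gradients appears. It is 4 (x \<bullet> c) p', which raises the coefficient 2n of p' to 2n
  + 4.\<close>

lemma laplacian_linear_times_radial:
  fixes c x :: "'a::euclidean_space"
  assumes "open T" "\<And>x::'a. x \<bullet> x \<in> T"
    and p': "\<And>t. t \<in> T \<Longrightarrow> (p has_real_derivative p' t) (at t)"
    and p'': "\<And>t. t \<in> T \<Longrightarrow> (p' has_real_derivative p2 t) (at t)"
  shows "laplacian (\<lambda>x. (x \<bullet> c) * p (x \<bullet> x)) x =
    (x \<bullet> c) * (4 * (x \<bullet> x) * p2 (x \<bullet> x) + (2 * real DIM('a) + 4) * p' (x \<bullet> x))"
proof -
  let ?s = "\<lambda>x::'a. x \<bullet> x"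
  have sd: "(?s has_derivative (\<lambda>v. 2 * (y \<bullet> v))) (at y)" for y
    by (auto intro!: derivative_eq_intros simp: inner_commute)
  have d0: "((\<lambda>x. p (?s x)) has_derivative (\<lambda>v. p' (?s y) * (2 * (y \<bullet> v)))) (at y)" for y
    using has_derivative_compose[OF sd p'[OF assms(2), unfolded has_field_derivative_def]] by simp
  have d1: "((\<lambda>x. p' (?s x)) has_derivative (\<lambda>v. p2 (?s y) * (2 * (y \<bullet> v)))) (at y)" for y
    using has_derivative_compose[OF sd p''[OF assms(2), unfolded has_field_derivative_def]] by simp
  have "laplacian (\<lambda>x. (x \<bullet> c) * p (?s x)) x =
      (\<Sum>b\<in>Basis. (x \<bullet> c) * (p2 (?s x) * (2 * (x \<bullet> b)) * (2 * (x \<bullet> b)) + p' (?s x) * (2 * (b \<bullet> b))) +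
         (b \<bullet> c) * (p' (?s x) * (2 * (x \<bullet> b))) + (b \<bullet> c) * (p' (?s x) * (2 * (x \<bullet> b))))"
  proof (rule laplacian_eqI[OF open_UNIV UNIV_I, where E="\<lambda>b v. 
       (x \<bullet> c) * (p2 (?s x) * (2 * (x \<bullet> v)) * (2 * (x \<bullet> b)) + p' (?s x) * (2 * (v \<bullet> b))) +
         (v \<bullet> c) * (p' (?s x) * (2 * (x \<bullet> b))) + (b \<bullet> c) * (p' (?s x) * (2 * (x \<bullet> v)))"])
    show "((\<lambda>x. (x \<bullet> c) * p (?s x)) has_derivative
        (\<lambda>v. (y \<bullet> c) * (p' (?s y) * (2 * (y \<bullet> v))) + (v \<bullet> c) * p (?s y))) (at y)" for y
      by (auto intro!: derivative_eq_intros d0)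
    show "((\<lambda>y. (y \<bullet> c) * (p' (?s y) * (2 * (y \<bullet> b))) + (b \<bullet> c) * p (?s y)) has_derivative
      (\<lambda>v. (x \<bullet> c) * (p2 (?s x) * (2 * (x \<bullet> v)) * (2 * (x \<bullet> b)) + p' (?s x) * (2 * (v \<bullet> b))) +
         (v \<bullet> c) * (p' (?s x) * (2 * (x \<bullet> b))) + (b \<bullet> c) * (p' (?s x) * (2 * (x \<bullet> v))))) (at x)" for b
      by (auto intro!: derivative_eq_intros d0 d1 simp: algebra_simps)
  qed
  also have "\<dots> = (x \<bullet> c) * (4 * p2 (?s x) * (\<Sum>b\<in>Basis. (x \<bullet> b)\<^sup>2) + 2 * real DIM('a) * p' (?s x)) +
      4 * p' (?s x) * (\<Sum>b\<in>Basis. (x \<bullet> b) * (c \<bullet> b))"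
    by (simp add: sum.distrib sum_distrib_left power2_eq_square algebra_simps inner_commute)
  also have "\<dots> = (x \<bullet> c) * (4 * p2 (?s x) * ?s x + 2 * real DIM('a) * p' (?s x)) + 4 * p' (?s x) * (x \<bullet> c)"
    unfolding inner_square_sum by (simp add: euclidean_inner[of x c])
  finally show ?thesis by (simp add: algebra_simps)
qed

lemma partial_deriv_zero_outside:
  assumes "closed K" "\<And>x. x \<notin> K \<Longrightarrow> f x = 0" "x \<notin> K"
  shows "partial_deriv b f x = 0"
proof -
  have "open (- K)" using assms(1) by (simp add: open_Compl)
  then have "(f has_derivative (\<lambda>_. 0)) (at x)"
    by (rule has_derivative_transform_within_open[OF has_derivative_const])
      (use assms in simp_all)
  then show ?thesis by (rule partial_deriv_eqI)
qed

lemma laplacian_zero_outside: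
  assumes "closed K" "\<And>x. x \<notin> K \<Longrightarrow> f x = 0" "x \<notin> K"
  shows "laplacian f x = 0"
proof -
  have "partial_deriv b f y = 0" if "y \<notin> K" for b y
    using assms(1,2) that by (rule partial_deriv_zero_outside)
  then have "partial_deriv b (partial_deriv b f) x = 0" for b
    using partial_deriv_zero_outside[OF assms(1) _ assms(3)] by blast
  then show ?thesis by (simp add: laplacian_def)
qed

lemma continuous_on_laplacian: "smooth_on S f \<Longrightarrow> continuous_on S (laplacian f)"
  unfolding laplacian_def
  by (intro continuous_on_sum smooth_on_imp_continuous_on smooth_on_partial_deriv)

text \<open>For each basis direction b the difference of the integrands is the b-derivative of the
  function v below, which has compact support. Smoothness of h is assumed only on a neighbourhood U
  of the support of \<phi>, because the Green corrector may have a pole outside the ball.\<close>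

theorem integral_laplacian_symmetric:
  fixes h \<phi> :: "'a::euclidean_space \<Rightarrow> real"
  assumes "open U" and h: "smooth_on U h" and \<phi>: "smooth_on UNIV \<phi>"
    and K: "compact K" "K \<subseteq> U" "\<And>x. x \<notin> K \<Longrightarrow> \<phi> x = 0"
  shows "(LINT x|lborel. h x * laplacian \<phi> x) = (LINT x|lborel. \<phi> x * laplacian h x)"
proof -
  have cl: "closed K" using K(1) by (rule compact_imp_closed)
  have \<phi>U: "smooth_on U \<phi>" if "smooth_on UNIV \<phi>" for \<phi> :: "'a \<Rightarrow> real"
  proof -
    have "Ck_on k UNIV \<phi> \<Longrightarrow> Ck_on k U \<phi>" for k
    proof (induction k arbitrary: \<phi>)
      case (Suc k)
      then show ?case by (auto intro: differentiable_on_subset)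
    qed (auto intro: continuous_on_subset)
    then show ?thesis using that by (simp add: smooth_on_def)
  qed
  have p0: "partial_deriv b \<phi> x = 0" "partial_deriv b (partial_deriv b \<phi>) x = 0" if "x \<notin> K" for b x
    using partial_deriv_zero_outside[OF cl] K(3) that by blast+
  have z: "(LINT x|lborel. h x * partial_deriv b (partial_deriv b \<phi>) x
      - \<phi> x * partial_deriv b (partial_deriv b h) x) = 0"
    and i1: "integrable lborel (\<lambda>x. h x * partial_deriv b (partial_deriv b \<phi>) x)"
    and i2: "integrable lborel (\<lambda>x. \<phi> x * partial_deriv b (partial_deriv b h) x)"
    if b: "b \<in> Basis" for b
  proof -
    note sm = h smooth_on_partial_deriv[OF h b] smooth_on_partial_deriv[OF smooth_on_partial_deriv[OF h b] b]
      \<phi>U[OF \<phi>] \<phi>U[OF smooth_on_partial_deriv[OF \<phi> b]]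
      \<phi>U[OF smooth_on_partial_deriv[OF smooth_on_partial_deriv[OF \<phi> b] b]]
    note cont = sm[THEN smooth_on_imp_continuous_on]
    note der = sm[THEN smooth_on_has_derivative[OF \<open>open U\<close>]]
    show "integrable lborel (\<lambda>x. h x * partial_deriv b (partial_deriv b \<phi>) x)"
      "integrable lborel (\<lambda>x. \<phi> x * partial_deriv b (partial_deriv b h) x)"
      using K p0 by (auto intro!: integrable_compact_support[OF K(1)] continuous_on_mult
          continuous_on_subset[OF cont(1) K(2)] continuous_on_subset[OF cont(3) K(2)]
          continuous_on_subset[OF cont(4) K(2)] continuous_on_subset[OF cont(6) K(2)])
    define v where "v x = h x * partial_deriv b \<phi> x - \<phi> x * partial_deriv b h x" for x
    \<comment> \<open>Off U nothing is known about h, but v vanishes identically near such points,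
      so the zero map is its derivative there.\<close>
    define D where "D x = (if x \<in> U then (\<lambda>w. h x * frechet_derivative (partial_deriv b \<phi>) (at x) w +
        frechet_derivative h (at x) w * partial_deriv b \<phi> x -
        (\<phi> x * frechet_derivative (partial_deriv b h) (at x) w
            + frechet_derivative \<phi> (at x) w * partial_deriv b h x))
        else (\<lambda>_. 0))" for x
    have Db: "D x b = h x * partial_deriv b (partial_deriv b \<phi>) x
        - \<phi> x * partial_deriv b (partial_deriv b h) x" for x
    proof (cases "x \<in> U")
      case True
      then show ?thesis by (simp add: D_def partial_deriv_def)
    next
      case False
      then have "x \<notin> K" using K(2) by blast
      then show ?thesis using False p0(2) K(3) by (simp add: D_def)
    qed
    have "(LINT x|lborel. D x b) = 0"
    proof (rule integral_directional_derivative_compact_support[OF _ _ K(1)])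
      fix x
      show "(v has_derivative D x) (at x)"
      proof (cases "x \<in> U")
        case True
        then show ?thesis
          unfolding v_def D_def using der by (auto intro!: has_derivative_diff has_derivative_mult)
      next
        case False
        then have x: "x \<in> - K" using K(2) by blast
        have "open (- K)" using cl by (simp add: open_Compl)
        then have "(v has_derivative (\<lambda>_. 0)) (at x)"
          by (rule has_derivative_transform_within_open[OF has_derivative_const])
            (use x p0 K(3) in \<open>simp_all add: v_def\<close>)
        then show ?thesis using False by (simp add: D_def)
      qed
    next
      have "continuous_on U (\<lambda>x. D x b)"
        unfolding Db by (intro continuous_intros cont)
      moreover have "continuous_on (- K) (\<lambda>x. D x b)"
        by (rule continuous_on_eq[OF continuous_on_const[of _ 0]]) (use p0 K(3) in \<open>auto simp: Db\<close>)
      moreover have "U \<union> - K = UNIV" using K(2) by blast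
      ultimately show "continuous_on UNIV (\<lambda>x. D x b)"
        using continuous_on_open_Un[of U "- K"] \<open>open U\<close> cl by (metis open_Compl)
    next
      show "v x = 0" if "x \<notin> K" for x
        using p0[OF that] K(3)[OF that] by (simp add: v_def)
    qed
    then show "(LINT x|lborel. h x * partial_deriv b (partial_deriv b \<phi>) x
        - \<phi> x * partial_deriv b (partial_deriv b h) x) = 0"
      by (simp add: Db)
  qed
  have "(LINT x|lborel. h x * laplacian \<phi> x) - (LINT x|lborel. \<phi> x * laplacian h x) =
     (\<Sum>b\<in>Basis. (LINT x|lborel. h x * partial_deriv b (partial_deriv b \<phi>) x) -
        (LINT x|lborel. \<phi> x * partial_deriv b (partial_deriv b h) x))"
    unfolding laplacian_def sum_distrib_left
    by (simp add: Bochner_Integration.integral_sum i1 i2 sum_subtractf)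
  also have "\<dots> = 0"
    using z i1 i2 by (intro sum.neutral) (auto simp: Bochner_Integration.integral_diff)
  finally show "(LINT x|lborel. h x * laplacian \<phi> x) = (LINT x|lborel. \<phi> x * laplacian h x)" by simp
qed

section \<open>The fundamental solution\<close>

lemma smooth_real_on_antiderivative:
  assumes "\<And>t. t \<in> T \<Longrightarrow> (h has_real_derivative h' t) (at t)" "smooth_real_on T h'"
  shows "smooth_real_on T h"
proof -
  obtain D where D: "D 0 = h'" "\<And>k t. t \<in> T \<Longrightarrow> (D k has_real_derivative D (Suc k) t) (at t)"
    using assms(2) unfolding smooth_real_on_def by blast
  then show ?thesis
    using assms(1) unfolding smooth_real_on_def
    by (intro exI[of _ "case_nat h D"]) (auto split: nat.splits)
qed

text \<open>An antiderivative of s^(-n/2). At s = |x|^2 and for n >= 2 it is a positive multiple of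
  the fundamental solution, with the sign that makes its Laplacian a positive point mass; for n = 2
  it is 2 ln |x|. In the squared radius, regularisation means adding \<epsilon>, and the argument of
  the Green corrector becomes a quadratic polynomial in x.\<close>

definition fundamental :: "nat \<Rightarrow> real \<Rightarrow> real" where
  "fundamental n s = (if n = 2 then ln s else s powr (1 - real n / 2) / (1 - real n / 2))"

lemma fundamental_has_derivative:
  assumes "s > 0"
  shows "(fundamental n has_real_derivative s powr (- (real n / 2))) (at s)"
proof (cases "n = 2")
  case True
  have "((\<lambda>s. ln s) has_real_derivative s powr (- (real n / 2))) (at s)"
    using assms True by (auto intro!: derivative_eq_intros simp: powr_minus divide_simps)
  then show ?thesis using True by (simp add: fundamental_def[abs_def])
next
  case False
  define c where "c = 1 - real n / 2"
  have "c \<noteq> 0" using False by (auto simp: c_def)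
  then have "((\<lambda>s. s powr c / c) has_real_derivative s powr (c - 1)) (at s)"
    using assms by (auto intro!: derivative_eq_intros)
  then have "((\<lambda>s. s powr (1 - real n / 2) / (1
      - real n / 2)) has_real_derivative s powr (- (real n / 2))) (at s)"
    by (simp add: c_def)
  then show ?thesis using False by (simp add: fundamental_def[abs_def])
qed

lemma smooth_real_on_fundamental: "smooth_real_on {0<..} (fundamental n)"
  by (rule smooth_real_on_antiderivative[OF _ smooth_real_on_powr]) (auto intro: fundamental_has_derivative)

lemma fundamental_mono:
  assumes "0 < s" "s \<le> t"
  shows "fundamental n s \<le> fundamental n t"
  using assms
  by (intro DERIV_nonneg_imp_nondecreasing[OF assms(2)])
    (auto intro!: exI fundamental_has_derivative)

lemma borel_measurable_fundamental [measurable]: "fundamental n \<in> borel_measurable borel"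
  unfolding fundamental_def[abs_def] by measurable

text \<open>One bound serves the logarithm and the powers alike. Near 0 it gives away a factor
  s^(-1/4), that is |z|^(-1/2) at s = |z|^2; the resulting order n - 3/2 of the singularity is still
  below n - 1, hence integrable against surface measures.\<close>

lemma abs_fundamental_le:
  assumes "n \<ge> 2" "s \<ge> 0"
  shows "\<bar>fundamental n s\<bar> \<le> 4 * s powr (3 / 4 - real n / 2) + 2 * s"
proof (cases "s = 0")
  case False
  with assms have s: "s > 0" by simp
  show ?thesis
  proof (cases "n = 2")
    case True
    have "ln s \<le> s" using s ln_le_minus_one[of s] by linarith
    \<comment> \<open>Applying ln y <= y - 1 to y = s^(-1/4) bounds the logarithm near 0 by this
      power.\<close>
    moreover have "- ln s = 4 * ln (s powr (- 1 / 4))" using s by (simp add: ln_powr)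
    then have "- ln s \<le> 4 * s powr (- 1 / 4)"
      using ln_le_minus_one[of "s powr (- 1 / 4)"] s by simp
    moreover have "s powr (- 1 / 4) \<ge> 0" by simp
    ultimately show ?thesis using True s by (simp add: fundamental_def abs_le_iff)
  next
    case False
    then have n: "real n \<ge> 3" using assms by linarith
    have "\<bar>fundamental n s\<bar> = s powr (1 - real n / 2) / (real n / 2 - 1)"
      using False n by (simp add: fundamental_def abs_divide)
    also have "\<dots> \<le> s powr (1 - real n / 2) / (1 / 2)"
      using n by (intro divide_left_mono) auto
    finally have "\<bar>fundamental n s\<bar> \<le> 2 * s powr (1 - real n / 2)" by simp
    moreover have "s powr (1 - real n / 2) \<le> s powr (3 / 4 - real n / 2) + s"
    proof (cases "s \<le> 1")
      case True
      have "s powr (1 - real n / 2) \<le> s powr (3 / 4 - real n / 2)"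
        using True s by (intro powr_mono') auto
      then show ?thesis using s by linarith
    next
      case False
      have "s powr (1 - real n / 2) \<le> s powr 1" using False n by (intro powr_mono) auto
      then show ?thesis using s by (simp add: add_increasing)
    qed
    ultimately show ?thesis using powr_ge_zero[of s "3 / 4 - real n / 2"] by linarith
  qed
qed (use assms in \<open>auto simp: fundamental_def\<close>)

lemma abs_fundamental_norm_le:
  fixes z :: "'a::real_inner"
  assumes "n \<ge> 2"
  shows "\<bar>fundamental n (z \<bullet> z)\<bar> \<le> 4 * norm z powr (- (real n - 3 / 2)) + 2 * (z \<bullet> z)"
proof -
  have "(z \<bullet> z) powr (3 / 4 - real n / 2) = norm z powr (- (real n - 3 / 2))"
  proof (cases "z = 0")
    case False
    then have "z \<bullet> z = norm z powr 2" by (simp add: dot_square_norm)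
    then have "(z \<bullet> z) powr (3 / 4 - real n / 2) = norm z powr (2 * (3 / 4 - real n / 2))"
      by (simp only: powr_powr)
    then show ?thesis by simp
  qed auto
  then show ?thesis using abs_fundamental_le[OF assms, of "z \<bullet> z"] by simp
qed

section \<open>Singular kernels against measures with controlled growth on balls\<close>

lemma nn_integral_riesz_kernel_le:
  fixes x :: "'a::metric_space" and a C :: real
  assumes sets: "sets M = sets borel" and "0 \<le> a" "a < real d" "C \<ge> 0" "R > 0"
    and growth: "\<And>r. r > 0 \<Longrightarrow> emeasure M (ball x r) \<le> ennreal (C * r ^ d)"
  shows "(\<integral>\<^sup>+y. ennreal (indicator (ball x R) y * dist x y powr (- a)) \<partial>M) \<le>
    ennreal (C * (2 powr a / (1 - 2 powr (a - real d))) * R powr (real d - a))"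
proof -
  have [measurable]: "ball x r \<in> sets M" for r using sets by auto
  \<comment> \<open>Dyadic radii: on the shell between \<open>\<rho> (Suc k)\<close> and
    \<open>\<rho> k\<close> the kernel is at most the power -a of the smaller radius. The growth
    bound turns the sum over the shells into a geometric series of ratio 2^(a-d) < 1.\<close>
  define \<rho> where "\<rho> k = R * 2 powr (- real k)" for k
  have \<rho>: "\<rho> k > 0" "\<rho> (Suc k) = \<rho> k / 2" for k
    using \<open>R > 0\<close> by (auto simp: \<rho>_def powr_diff powr_minus field_simps)
  have lim: "\<rho> \<longlonglongrightarrow> 0"
  proof -
    have "(\<lambda>k. R * (1 / 2) ^ k) \<longlonglongrightarrow> R * 0" by (intro tendsto_intros LIMSEQ_power_zero) auto
    then show ?thesis by (simp add: \<rho>_def[abs_def] powr_minus powr_realpow power_one_over inverse_eq_divide)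
  qed
  have pt: "ennreal (indicator (ball x R) y * dist x y powr (- a)) \<le>
      (\<Sum>k. ennreal (\<rho> (Suc k) powr (- a)) * indicator (ball x (\<rho> k)) y)" for y
  \<comment> \<open>At the centre y = x the integrand is 0, because
    \<open>0 powr (- a) = 0\<close>.\<close>
  proof (cases "y \<in> ball x R \<and> y \<noteq> x")
    case True
    then have d0: "dist x y > 0" by auto
    have ex: "\<exists>k. \<rho> k \<le> dist x y"
      using order_tendstoD(2)[OF lim d0] unfolding eventually_sequentially by (meson le_refl less_imp_le)
    define k where "k = (LEAST k. \<rho> k \<le> dist x y)"
    have k: "\<rho> k \<le> dist x y" "\<And>j. j < k \<Longrightarrow> \<not> \<rho> j \<le> dist x y"
      unfolding k_def using LeastI_ex[OF ex] not_less_Least by blast+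
    have "k \<noteq> 0" using k(1) True by (intro notI) (simp add: \<rho>_def)
    then obtain j where j: "k = Suc j" by (cases k) auto
    have "ennreal (dist x y powr (- a)) \<le> ennreal (\<rho> (Suc j) powr (- a))"
      using k(1)[unfolded j] \<rho>(1) \<open>0 \<le> a\<close> by (intro ennreal_leI powr_mono2') simp_all
    also have "\<dots> = (\<Sum>k\<in>{j}. ennreal (\<rho> (Suc k) powr (- a)) * indicator (ball x (\<rho> k)) y)"
      using k(2)[of j] j by simp
    also have "\<dots> \<le> (\<Sum>k. ennreal (\<rho> (Suc k) powr (- a)) * indicator (ball x (\<rho> k)) y)"
      by (intro sum_le_suminf) auto
    finally show ?thesis using True by simp
  qed auto
  have "(\<integral>\<^sup>+y. ennreal (indicator (ball x R) y * dist x y powr (- a)) \<partial>M) \<le>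
      (\<integral>\<^sup>+y. (\<Sum>k. ennreal (\<rho> (Suc k) powr (- a)) * indicator (ball x (\<rho> k)) y) \<partial>M)"
    by (intro nn_integral_mono pt)
  also have "\<dots> = (\<Sum>k. \<integral>\<^sup>+y. ennreal (\<rho> (Suc k) powr (- a)) * indicator (ball x (\<rho> k)) y \<partial>M)"
    by (intro nn_integral_suminf) measurable
  also have "\<dots> = (\<Sum>k. ennreal (\<rho> (Suc k) powr (- a)) * emeasure M (ball x (\<rho> k)))"
    by (simp add: nn_integral_cmult_indicator)
  also have "\<dots> \<le> (\<Sum>k. ennreal (\<rho> (Suc k) powr (- a)) * ennreal (C * \<rho> k ^ d))"
    by (intro suminf_le mult_left_mono growth \<rho>) auto
  also have "\<dots> = (\<Sum>k. ennreal (C * 2 powr a * R powr (real d - a) * (2 powr (a - real d)) ^ k))"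
  proof (rule suminf_cong)
    fix k
    have "\<rho> (Suc k) powr (- a) = 2 powr a * \<rho> k powr (- a)"
      unfolding \<rho>(2) using \<rho>(1)[of k] by (simp add: powr_divide powr_minus divide_simps)
    then have "\<rho> (Suc k) powr (- a) * (C * \<rho> k ^ d) = C * 2 powr a * \<rho> k powr (real d - a)"
      using \<rho>(1)[of k] by (simp add: powr_realpow[symmetric] powr_add[symmetric] algebra_simps)
    also have "\<rho> k powr (real d - a) = R powr (real d - a) * (2 powr (a - real d)) ^ k"
      using \<open>R > 0\<close> by (simp add: \<rho>_def powr_mult powr_powr powr_realpow[symmetric] algebra_simps)
    finally show "ennreal (\<rho> (Suc k) powr (- a)) * ennreal (C * \<rho> k ^ d) =
        ennreal (C * 2 powr a * R powr (real d - a) * (2 powr (a - real d)) ^ k)"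
      using \<rho>(1)[of k] \<open>C \<ge> 0\<close> by (simp add: ennreal_mult[symmetric] mult_ac)
  qed
  also have "\<dots> = ennreal (C * 2 powr a * R powr (real d - a) * (1 / (1 - 2 powr (a - real d))))"
  proof (rule suminf_ennreal_eq)
    have "2 powr (a - real d) < 2 powr (0::real)" using \<open>a < real d\<close> by (intro powr_less_mono) auto
    then have "2 powr (a - real d) < 1" by simp
    then show "(\<lambda>k. C * 2 powr a * R powr (real d - a) * (2 powr (a - real d)) ^ k) sums
        (C * 2 powr a * R powr (real d - a) * (1 / (1 - 2 powr (a - real d))))"
      by (intro sums_mult geometric_sums) auto
  qed (use \<open>C \<ge> 0\<close> in auto)
  finally show ?thesis by (simp add: mult_ac)
qed

text \<open>The dimension n of the kernel and the growth exponent d of the measure are kept apart: d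
  = n serves Lebesgue measure, d = n - 1 the surface measure.\<close>

lemma nn_integral_fundamental_le:
  fixes y :: "'a::euclidean_space"
  assumes sets: "sets M = sets borel" and "n \<ge> 2" "n - 1 \<le> d" "C \<ge> 0" "R > 0"
    and growth: "\<And>r. r > 0 \<Longrightarrow> emeasure M (ball y r) \<le> ennreal (C * r ^ d)"
  defines "a \<equiv> real n - 3 / 2"
  shows "(\<integral>\<^sup>+x. ennreal (indicator (ball y R) x * \<bar>fundamental n ((x - y) \<bullet> (x - y))\<bar>) \<partial>M) \<le>
    ennreal (4 * (C * (2 powr a / (1 - 2 powr (a - real d))) * R powr (real d - a)) + 2 * R\<^sup>2 * (C * R ^ d))"
proof -
  have a: "0 \<le> a" "a < real d" using assms by (auto simp: a_def)
  have [measurable]: "ball y R \<in> sets M" using sets by auto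
  have [measurable]: "(\<lambda>x. x) \<in> borel_measurable M"
    using sets by (simp add: measurable_def sets_eq_imp_space_eq[OF sets])
  have pt: "indicator (ball y R) x * \<bar>fundamental n ((x - y) \<bullet> (x - y))\<bar> \<le>
      4 * (indicator (ball y R) x * dist y x powr (- a)) + 2 * R\<^sup>2 * indicator (ball y R) x" for x
  proof (cases "x \<in> ball y R")
    case True
    have "(x - y) \<bullet> (x - y) \<le> R\<^sup>2"
      using True by (auto simp: dot_square_norm dist_norm norm_minus_commute intro!: power_mono)
    then show ?thesis
      using abs_fundamental_norm_le[OF \<open>n \<ge> 2\<close>, of "x - y"] True
      by (auto simp: dist_norm norm_minus_commute a_def)
  qed auto
  have pos: "0 \<le> 2 powr a / (1 - 2 powr (a - real d))"
  proof -
    have "2 powr (a - real d) < 2 powr (0::real)" using a by (intro powr_less_mono) auto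
    then show ?thesis by (intro divide_nonneg_nonneg) auto
  qed
  have "(\<integral>\<^sup>+x. ennreal (indicator (ball y R) x * \<bar>fundamental n ((x - y) \<bullet> (x - y))\<bar>) \<partial>M) \<le>
     (\<integral>\<^sup>+x. 4 * ennreal (indicator (ball y R) x * dist y x powr (- a))
         + ennreal (2 * R\<^sup>2) * indicator (ball y R) x \<partial>M)"
    using pt by (intro nn_integral_mono)
      (auto simp: ennreal_mult'[symmetric] ennreal_plus[symmetric] ennreal_indicator[symmetric] ennreal_numeral[symmetric]
        simp del: ennreal_plus ennreal_numeral intro!: ennreal_leI split: split_indicator)
  also have "\<dots> = 4 * (\<integral>\<^sup>+x. ennreal (indicator (ball y R) x * dist y x powr (- a)) \<partial>M)
      + ennreal (2 * R\<^sup>2) * emeasure M (ball y R)"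
    by (simp add: nn_integral_add nn_integral_cmult nn_integral_cmult_indicator)
  also have "\<dots> \<le> 4 * ennreal (C * (2 powr a / (1 - 2 powr (a - real d))) * R powr (real d - a)) +
      ennreal (2 * R\<^sup>2) * ennreal (C * R ^ d)"
    using a assms by (intro add_mono mult_left_mono growth nn_integral_riesz_kernel_le) auto
  also have "\<dots> = ennreal (4 * (C * (2 powr a / (1 - 2 powr (a - real d))) * R powr (real d - a))
      + 2 * R\<^sup>2 * (C * R ^ d))"
  proof -
    have "4 * ennreal x + ennreal y * ennreal z = ennreal (4 * x + y * z)" if "x \<ge> 0" "y \<ge> 0" "z \<ge> 0"
        for x y z :: real
      using that by (simp add: ennreal_mult ennreal_plus)
    moreover have "C * (2 powr a / (1 - 2 powr (a - real d))) * R powr (real d - a) \<ge> 0"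
      using pos \<open>C \<ge> 0\<close> by (intro mult_nonneg_nonneg) auto
    ultimately show ?thesis using \<open>C \<ge> 0\<close> \<open>R > 0\<close> by simp
  qed
  finally show ?thesis .
qed

lemma integrable_fundamental:
  fixes y :: "'a::euclidean_space"
  assumes sets: "sets M = sets borel" and "n \<ge> 2" "n - 1 \<le> d" "C \<ge> 0" "R > 0"
    and growth: "\<And>r. r > 0 \<Longrightarrow> emeasure M (ball y r) \<le> ennreal (C * r ^ d)"
  shows "integrable M (\<lambda>x. indicator (ball y R) x * fundamental n ((x - y) \<bullet> (x - y)))"
proof (rule integrableI_bounded)
  have [measurable]: "ball y R \<in> sets M" using sets by auto
  have [measurable]: "(\<lambda>x. x) \<in> borel_measurable M"
    using sets by (simp add: measurable_def sets_eq_imp_space_eq[OF sets])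
  show "(\<lambda>x. indicator (ball y R) x * fundamental n ((x - y) \<bullet> (x - y))) \<in> borel_measurable M"
    by measurable
  have "(\<integral>\<^sup>+x. ennreal (norm (indicator (ball y R) x * fundamental n ((x - y) \<bullet> (x - y)))) \<partial>M) =
      (\<integral>\<^sup>+x. ennreal (indicator (ball y R) x * \<bar>fundamental n ((x - y) \<bullet> (x - y))\<bar>) \<partial>M)"
    by (simp add: abs_mult)
  also have "\<dots> < top"
    by (rule le_less_trans[OF nn_integral_fundamental_le[OF assms]]) auto
  finally show "(\<integral>\<^sup>+x. ennreal (norm (indicator (ball y R) x * fundamental n ((x - y) \<bullet> (x - y)))) \<partial>M) < \<infinity>"
      by simp
qed

section \<open>The approximate identity behind the fundamental solution\<close>

lemma integrable_radial_tail: 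
  "integrable lborel (\<lambda>w::'a::euclidean_space. (1 + w \<bullet> w) powr (- (real DIM('a) / 2) - 1))"
proof (rule integrableI_bounded)
  let ?n = "DIM('a)"
  let ?f = "\<lambda>w::'a. (1 + w \<bullet> w) powr (- (real ?n / 2) - 1)"
  let ?\<omega> = "unit_ball_vol (real ?n)"
  have [measurable]: "ball (0::'a) r \<in> sets borel" for r by simp
  show "?f \<in> borel_measurable lborel" by measurable
  have pt: "ennreal (norm (?f w)) \<le> (\<Sum>k. ennreal ((1 / 2) ^ ((?n
      + 2) * k)) * indicator (ball 0 (2 ^ Suc k)) w)" for w
  proof -
    obtain m :: nat where "norm w < 2 ^ m" using real_arch_pow[of 2 "norm w"] by auto
    then have ex: "\<exists>k. norm w < 2 ^ Suc k" using power_increasing[of m "Suc m" "2::real"]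
        by (intro exI[of _ m]) linarith
    \<comment> \<open>On the shell of index k the integrand is at most 2^(-(n+2)k), while the ball
      of radius 2^(k+1) has volume of order 2^(nk); the ratio of the series is 1/4. The shell k = 0
      is the whole ball of radius 2.\<close>
    define k where "k = (LEAST k. norm w < 2 ^ Suc k)"
    have k: "norm w < 2 ^ Suc k" "\<And>j. j < k \<Longrightarrow> \<not> norm w < 2 ^ Suc j"
      unfolding k_def using LeastI_ex[OF ex] not_less_Least by blast+
    have "(2 ^ k)\<^sup>2 \<le> 1 + w \<bullet> w"
    proof (cases k)
      case (Suc j)
      then have "2 ^ k \<le> norm w" using k(2)[of j] by simp
      then have "(2 ^ k)\<^sup>2 \<le> (norm w)\<^sup>2" by (intro power_mono) auto
      then show ?thesis unfolding dot_square_norm by linarith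
    qed auto
    then have "?f w \<le> ((2 ^ k)\<^sup>2) powr (- (real ?n / 2) - 1)"
      by (intro powr_mono2') auto
    also have "((2 ^ k)\<^sup>2 :: real) = 2 powr (2 * k)"
      using powr_realpow[of 2 "2 * k"] by (simp add: power_mult[symmetric] mult.commute)
    also have "(2 powr (2 * k)) powr (- (real ?n / 2) - 1) = 2 powr (- real ((?n + 2) * k))"
      by (simp add: powr_powr algebra_simps)
    also have "\<dots> = (1 / 2) ^ ((?n + 2) * k)"
      by (simp add: powr_minus powr_realpow power_one_over inverse_eq_divide del: of_nat_mult of_nat_add)
    finally have "ennreal (norm (?f w)) \<le> (\<Sum>k\<in>{k}. ennreal ((1 / 2) ^ ((?n
        + 2) * k)) * indicator (ball 0 (2 ^ Suc k)) w)"
      using k(1) by (simp add: ennreal_leI)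
    also have "\<dots> \<le> (\<Sum>k. ennreal ((1 / 2) ^ ((?n + 2) * k)) * indicator (ball 0 (2 ^ Suc k)) w)"
      by (intro sum_le_suminf) auto
    finally show ?thesis .
  qed
  have "(\<integral>\<^sup>+w. ennreal (norm (?f w)) \<partial>lborel) \<le>
      (\<integral>\<^sup>+w. (\<Sum>k. ennreal ((1 / 2) ^ ((?n + 2) * k)) * indicator (ball 0 (2 ^ Suc k)) (w::'a)) \<partial>lborel)"
    by (intro nn_integral_mono pt)
  also have "\<dots> = (\<Sum>k. \<integral>\<^sup>+w. ennreal ((1 / 2) ^ ((?n
      + 2) * k)) * indicator (ball 0 (2 ^ Suc k)) (w::'a) \<partial>lborel)"
    by (intro nn_integral_suminf) measurable
  also have "\<dots> = (\<Sum>k. ennreal (?\<omega> * 2 ^ ?n * (1 / 4) ^ k))"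
  proof (rule suminf_cong)
    fix k
    have "(\<integral>\<^sup>+w. ennreal ((1 / 2) ^ ((?n + 2) * k)) * indicator (ball 0 (2 ^ Suc k)) (w::'a) \<partial>lborel) =
        ennreal ((1 / 2) ^ ((?n + 2) * k)) * ennreal (?\<omega> * (2 ^ Suc k) ^ ?n)"
      by (subst nn_integral_cmult_indicator) (auto simp: emeasure_ball)
    also have "\<dots> = ennreal ((1 / 2) ^ ((?n + 2) * k) * (?\<omega> * (2 ^ Suc k) ^ ?n))"
      by (intro ennreal_mult[symmetric] mult_nonneg_nonneg unit_ball_vol_nonneg) auto
    also have "(1 / 2) ^ ((?n + 2) * k) * (?\<omega> * (2 ^ Suc k) ^ ?n) = ?\<omega> * 2 ^ ?n * (1 / 4) ^ k"
    proof -
      have "(2 ^ Suc k) ^ ?n = (2::real) ^ ?n * 2 ^ (?n * k)"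
        by (simp add: power_mult_distrib power_mult[symmetric] mult.commute)
      moreover have "(1 / 2 :: real) ^ ((?n + 2) * k) = (1 / 2) ^ (?n * k) * ((1 / 2)\<^sup>2) ^ k"
        by (simp only: power_mult[symmetric] power_add[symmetric] distrib_right)
      moreover have "((1 / 2)\<^sup>2 :: real) = 1 / 4" by (simp add: power2_eq_square)
      ultimately show ?thesis by (simp add: power_one_over)
    qed
    finally show "(\<integral>\<^sup>+w. ennreal ((1 / 2) ^ ((?n + 2) * k)) * indicator (ball 0 (2 ^ Suc k)) (w::'a) \<partial>lborel) =
        ennreal (?\<omega> * 2 ^ ?n * (1 / 4) ^ k)" .
  qed
  also have "\<dots> = ennreal (?\<omega> * 2 ^ ?n * (1 / (1 - 1 / 4)))"
    by (intro suminf_ennreal_eq sums_mult geometric_sums) auto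
  finally show "(\<integral>\<^sup>+w. ennreal (norm (?f w)) \<partial>lborel) < \<infinity>"
    using le_less_trans by fastforce
qed

text \<open>The type argument carries the dimension. This mass is the normalising factor of the
  Green potential, and its positivity permits the division.\<close>

definition kernel_mass :: "'a::euclidean_space itself \<Rightarrow> real" where
  "kernel_mass _ = (LINT w::'a|lborel. (1 + w \<bullet> w) powr (- (real DIM('a) / 2) - 1))"

lemma kernel_mass_pos: "kernel_mass TYPE('a::euclidean_space) > 0"
proof -
  let ?f = "\<lambda>w::'a. (1 + w \<bullet> w) powr (- (real DIM('a) / 2) - 1)"
  have pos: "?f w > 0" for w by (simp add: add_pos_nonneg less_imp_neq[symmetric])
  have "kernel_mass TYPE('a) \<noteq> 0"
  proof
    assume "kernel_mass TYPE('a) = 0"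
    then have "AE w in lborel. ?f w = 0"
      unfolding kernel_mass_def
      by (subst (asm) integral_nonneg_eq_0_iff_AE[OF integrable_radial_tail]) auto
    then have "AE w::'a in lborel. False" using pos by (simp add: less_imp_neq[symmetric])
    then show False by (simp add: eventually_const_iff ae_filter_eq_bot_iff emeasure_lborel_UNIV)
  qed
  moreover have "kernel_mass TYPE('a) \<ge> 0" unfolding kernel_mass_def by simp
  ultimately show ?thesis by simp
qed

lemma lborel_integral_affine:
  fixes f :: "'a::euclidean_space \<Rightarrow> real"
  assumes [measurable]: "f \<in> borel_measurable borel" and c: "c > 0"
  shows "integrable lborel f \<longleftrightarrow> integrable lborel (\<lambda>w. c ^ DIM('a) * f (t + c *\<^sub>R w))"
    and "(LINT x|lborel. f x) = (LINT w|lborel. c ^ DIM('a) * f (t + c *\<^sub>R w))"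
proof -
  have eq: "lborel = density (distr lborel borel (\<lambda>x. t + c *\<^sub>R x)) (\<lambda>_. ennreal (c ^ DIM('a)))"
    using lborel_affine[of c t] c by simp
  show "integrable lborel f \<longleftrightarrow> integrable lborel (\<lambda>w. c ^ DIM('a) * f (t + c *\<^sub>R w))"
    using c by (subst eq) (simp add: integrable_density integrable_distr_eq)
  show "(LINT x|lborel. f x) = (LINT w|lborel. c ^ DIM('a) * f (t + c *\<^sub>R w))"
    using c by (subst eq) (simp add: integral_density integral_distr)
qed

text \<open>Up to the factor 2n this is the Laplacian of the regularised fundamental solution.
  Rescaling by sqrt \<epsilon> turns it into the fixed profile integrated in
  \<open>kernel_mass\<close>.\<close>

definition approx_kernel :: "real \<Rightarrow> 'a::euclidean_space \<Rightarrow> real" where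
  "approx_kernel \<epsilon> z = \<epsilon> * (z \<bullet> z + \<epsilon>) powr (- (real DIM('a) / 2) - 1)"

lemma approx_kernel_nonneg: "\<epsilon> \<ge> 0 \<Longrightarrow> approx_kernel \<epsilon> z \<ge> 0"
  by (simp add: approx_kernel_def)

lemma borel_measurable_approx_kernel [measurable]: "approx_kernel \<epsilon> \<in> borel_measurable borel"
  unfolding approx_kernel_def[abs_def] by measurable

lemma approx_kernel_scale:
  assumes "\<epsilon> > 0"
  shows "sqrt \<epsilon> ^ DIM('a) * approx_kernel \<epsilon> (sqrt \<epsilon> *\<^sub>R w) =
    (1 + w \<bullet> (w::'a::euclidean_space)) powr (- (real DIM('a) / 2) - 1)"
proof -
  let ?n = "DIM('a)"
  have "(sqrt \<epsilon> *\<^sub>R w) \<bullet> (sqrt \<epsilon> *\<^sub>R w) + \<epsilon> = \<epsilon> * (1 + w \<bullet> w)"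
    using assms by (simp add: algebra_simps real_sqrt_mult[symmetric] mult.assoc[symmetric])
  then have "approx_kernel \<epsilon> (sqrt \<epsilon> *\<^sub>R w) =
      \<epsilon> powr (- (real ?n / 2)) * (1 + w \<bullet> w) powr (- (real ?n / 2) - 1)"
    using assms unfolding approx_kernel_def
    by (simp add: powr_mult powr_diff)
  moreover have "sqrt \<epsilon> ^ ?n = \<epsilon> powr (real ?n / 2)"
    using assms by (simp add: powr_half_sqrt[symmetric] powr_realpow[symmetric] powr_powr)
  ultimately show ?thesis using assms by (simp add: powr_minus field_simps)
qed

lemma
  assumes "\<epsilon> > 0"
  shows integrable_approx_kernel: "integrable lborel (\<lambda>x::'a::euclidean_space. approx_kernel \<epsilon> (x - y))"
    and integral_approx_kernel: "(LINT x|lborel. approx_kernel \<epsilon> (x - y :: 'a)) = kernel_mass TYPE('a)"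
proof -
  have "sqrt \<epsilon> > 0" using assms by simp
  note aff = lborel_integral_affine[of "\<lambda>x::'a. approx_kernel \<epsilon> (x - y)" "sqrt \<epsilon>" y, OF _ this]
  show "integrable lborel (\<lambda>x::'a. approx_kernel \<epsilon> (x - y))"
    by (subst aff) (auto simp: approx_kernel_scale[OF assms] integrable_radial_tail)
  show "(LINT x|lborel. approx_kernel \<epsilon> (x - y :: 'a)) = kernel_mass TYPE('a)"
    by (subst aff) (auto simp: approx_kernel_scale[OF assms] kernel_mass_def)
qed

lemma integrable_approx_kernel_mult:
  fixes f :: "'a::euclidean_space \<Rightarrow> real"
  assumes [measurable]: "f \<in> borel_measurable borel" and B: "\<And>x. \<bar>f x\<bar> \<le> B" and "\<epsilon> > 0"
  shows "integrable lborel (\<lambda>x. approx_kernel \<epsilon> (x - y) * f x)"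
proof (rule Bochner_Integration.integrable_bound)
  show "integrable lborel (\<lambda>x. B * approx_kernel \<epsilon> (x - y))"
    by (intro integrable_mult_right integrable_approx_kernel \<open>\<epsilon> > 0\<close>)
  have "0 \<le> B" using B[of undefined] by linarith
  show "AE x in lborel. norm (approx_kernel \<epsilon> (x - y) * f x) \<le> norm (B * approx_kernel \<epsilon> (x - y))"
  proof (rule AE_I2)
    fix x
    have "0 \<le> approx_kernel \<epsilon> (x - y)" using \<open>\<epsilon> > 0\<close> by (simp add: approx_kernel_nonneg)
    from this mult_right_mono[OF B[of x] this] show "norm (approx_kernel \<epsilon> (x - y) * f x)
        \<le> norm (B * approx_kernel \<epsilon> (x - y))"
      using \<open>0 \<le> B\<close> by (simp add: abs_mult mult.commute)
  qed
qed measurable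

text \<open>The substitution x = y + sqrt \<epsilon> w freezes the kernel and moves \<epsilon> into
  the argument of f, where continuity at y gives the pointwise limit and boundedness the
  majorant.\<close>

theorem approx_kernel_tendsto:
  fixes f :: "'a::euclidean_space \<Rightarrow> real" and \<epsilon> :: "nat \<Rightarrow> real"
  assumes [measurable]: "f \<in> borel_measurable borel" and B: "\<And>x. \<bar>f x\<bar> \<le> B" and "isCont f y"
    and \<epsilon>: "\<And>m. \<epsilon> m > 0" "\<epsilon> \<longlonglongrightarrow> 0"
  shows "(\<lambda>m. LINT x|lborel. approx_kernel (\<epsilon> m) (x - y) * f x) \<longlonglongrightarrow> kernel_mass TYPE('a) * f y"
proof -
  let ?k = "\<lambda>w::'a. (1 + w \<bullet> w) powr (- (real DIM('a) / 2) - 1)"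
  have "(LINT x|lborel. approx_kernel (\<epsilon> m) (x - y) * f x) = (LINT w|lborel. ?k w * f (y
      + sqrt (\<epsilon> m) *\<^sub>R w))" for m
  proof -
    have "(LINT x|lborel. approx_kernel (\<epsilon> m) (x - y) * f x) =
      (LINT w|lborel. sqrt (\<epsilon> m) ^ DIM('a) * (approx_kernel (\<epsilon> m) (y + sqrt (\<epsilon> m) *\<^sub>R w - y) * f (y
          + sqrt (\<epsilon> m) *\<^sub>R w)))"
      using \<epsilon>(1)[of m] by (intro lborel_integral_affine) auto
    also have "\<dots> = (LINT w|lborel. ?k w * f (y + sqrt (\<epsilon> m) *\<^sub>R w))"
      by (simp add: approx_kernel_scale[OF \<epsilon>(1)] mult.assoc[symmetric])
    finally show ?thesis .
  qed
  moreover have "(\<lambda>m. LINT w|lborel. ?k w * f (y + sqrt (\<epsilon> m) *\<^sub>R w)) \<longlonglongrightarrow> (LINT w|lborel. ?k w * f y)"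
  proof (rule integral_dominated_convergence)
    show "integrable lborel (\<lambda>w. B * ?k w)" by (intro integrable_mult_right integrable_radial_tail)
    show "AE w in lborel. (\<lambda>m. ?k w * f (y + sqrt (\<epsilon> m) *\<^sub>R w)) \<longlonglongrightarrow> ?k w * f y"
    proof (intro AE_I2 tendsto_mult tendsto_const)
      fix w
      have "(\<lambda>m. y + sqrt (\<epsilon> m) *\<^sub>R w) \<longlonglongrightarrow> y + sqrt 0 *\<^sub>R w"
        by (intro tendsto_intros \<epsilon>)
      then show "(\<lambda>m. f (y + sqrt (\<epsilon> m) *\<^sub>R w)) \<longlonglongrightarrow> f y"
        using \<open>isCont f y\<close> by (intro isCont_tendsto_compose[of y f]) auto
    qed
    show "AE w in lborel. norm (?k w * f (y + sqrt (\<epsilon> m) *\<^sub>R w)) \<le> B * ?k w" for m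
      using mult_left_mono[OF B, of "?k _"] by (intro AE_I2) (simp add: abs_mult mult.commute)
  qed measurable
  ultimately show ?thesis by (simp add: kernel_mass_def)
qed

text \<open>Since the derivative of \<open>fundamental\<close> is s^(-n/2), the terms of order
  q^(-n/2) cancel and only the discriminant \<alpha> \<gamma> - |\<beta>|^2 survives. It equals
  \<epsilon> for the regularised fundamental solution and 0 for the Green corrector, where \<alpha>
  = |y|^2, \<beta> = y and \<gamma> = 1.\<close>

lemma laplacian_fundamental_quadratic:
  fixes \<beta> x :: "'a::euclidean_space" and \<alpha> \<gamma> :: real
  assumes "\<alpha> * (x \<bullet> x) - 2 * (x \<bullet> \<beta>) + \<gamma> > 0"
  shows "laplacian (\<lambda>x. fundamental DIM('a) (\<alpha> * (x \<bullet> x) - 2 * (x \<bullet> \<beta>) + \<gamma>)) x =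
    2 * real DIM('a) * (\<alpha> * \<gamma> - \<beta> \<bullet> \<beta>) *
    (\<alpha> * (x \<bullet> x) - 2 * (x \<bullet> \<beta>) + \<gamma>) powr (- (real DIM('a) / 2) - 1)"
proof -
  let ?n = "real DIM('a)"
  let ?q = "\<alpha> * (x \<bullet> x) - 2 * (x \<bullet> \<beta>) + \<gamma>"
  have "laplacian (\<lambda>x. fundamental DIM('a) (\<alpha> * (x \<bullet> x) - 2 * (x \<bullet> \<beta>) + \<gamma>)) x =
     4 * (- (?n / 2) * ?q powr (- (?n / 2) - 1)) * (\<alpha> * ?q - \<alpha> * \<gamma> + \<beta> \<bullet> \<beta>) + 2 * ?n * \<alpha> * ?q powr (- (?n / 2))"
    by (rule laplacian_compose_quadratic[of "{0<..}"])
      (use assms in \<open>auto intro!: fundamental_has_derivative derivative_eq_intros\<close>)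
  also have "?q powr (- (?n / 2)) = ?q * ?q powr (- (?n / 2) - 1)"
    using assms by (simp add: powr_diff)
  finally show ?thesis by (simp add: algebra_simps)
qed

lemma quadratic_eq_norm: "1 * (x \<bullet> x) - 2 * (x \<bullet> y) + (y \<bullet> y + \<epsilon>) = (x - y) \<bullet> (x - y) + (\<epsilon> :: real)"
  for x y :: "'a::real_inner"
  by (simp add: algebra_simps inner_commute)

lemma bounded_compact_support:
  fixes f :: "'a::euclidean_space \<Rightarrow> real"
  assumes "compact K" "continuous_on K f" "\<And>x. x \<notin> K \<Longrightarrow> f x = 0"
  obtains M where "M \<ge> 0" "\<And>x. \<bar>f x\<bar> \<le> M"
proof -
  have "bounded (f ` K)"
    using assms by (intro compact_imp_bounded compact_continuous_image)
  then obtain M where M: "\<And>x. x \<in> K \<Longrightarrow> \<bar>f x\<bar> \<le> M"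
    unfolding bounded_iff by auto
  have "\<bar>f x\<bar> \<le> max M 0" for x
    using M[of x] assms(3)[of x] by (cases "x \<in> K") (simp_all add: le_max_iff_disj)
  then show thesis by (intro that[of "max M 0"]) simp_all
qed

text \<open>For the regularised kernel Green's identity holds exactly, with the approximate identity
  on the other side. As \<epsilon> tends to 0, one side converges by domination and the other to a
  multiple of \<phi> y.\<close>

theorem fundamental_solution:
  fixes \<phi> :: "'a::euclidean_space \<Rightarrow> real"
  assumes n: "DIM('a) \<ge> 2" and \<phi>: "smooth_on UNIV \<phi>" and K: "compact K" "\<And>x. x \<notin> K \<Longrightarrow> \<phi> x = 0"
  shows "(LINT x|lborel. fundamental DIM('a) ((x - y) \<bullet> (x - y)) * laplacian \<phi> x) =
      2 * real DIM('a) * kernel_mass TYPE('a) * \<phi> y"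
proof -
  let ?n = "DIM('a)" and ?F = "fundamental DIM('a)"
  let ?s = "\<lambda>x. (x - y) \<bullet> (x - y)"
  have cont: "continuous_on UNIV \<phi>" "continuous_on UNIV (laplacian \<phi>)"
    using \<phi> smooth_on_imp_continuous_on continuous_on_laplacian by blast+
  then have [measurable]: "\<phi> \<in> borel_measurable borel" "laplacian \<phi> \<in> borel_measurable borel"
    by (simp_all add: borel_measurable_continuous_onI)
  have lap0: "laplacian \<phi> x = 0" if "x \<notin> K" for x
    using laplacian_zero_outside[of K \<phi> x] compact_imp_closed[OF K(1)] K(2) that by blast
  obtain R where R: "R > 0" "K \<subseteq> ball y R"
    using bounded_subset_ballD[OF compact_imp_bounded[OF K(1)]] by blast
  obtain M where M: "M \<ge> 0" "\<And>x. \<bar>laplacian \<phi> x\<bar> \<le> M"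
    using bounded_compact_support[OF K(1) continuous_on_subset[OF cont(2) subset_UNIV] lap0] by blast
  obtain Mp where Mp: "\<And>x. \<bar>\<phi> x\<bar> \<le> Mp"
    using bounded_compact_support[OF K(1) continuous_on_subset[OF cont(1) subset_UNIV] K(2)] by blast
  \<comment> \<open>Upper bound for |x - y|^2 + \<epsilon> on the support. As the kernel is
    increasing, the regularised value lies between those at |x - y|^2 and at S, which gives a
    majorant independent of \<epsilon>.\<close>
  define S where "S = R\<^sup>2 + 1"
  have int0: "integrable lborel (\<lambda>x. indicator (ball y R) x * ?F (?s x))"
    by (rule integrable_fundamental[where d="?n" and C="unit_ball_vol (real ?n)"])
      (use n R in \<open>auto simp: emeasure_ball\<close>)
  have ib: "integrable lborel (\<lambda>x. indicator (ball y R) x :: real)"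
    using emeasure_lborel_ball_finite[of y R] by (simp add: integrable_indicator_iff)
  have dom: "integrable lborel (\<lambda>x. M * (\<bar>indicator (ball y R) x * ?F (?s x)\<bar>
      + \<bar>?F S\<bar> * indicator (ball y R) x))"
    by (intro integrable_mult_right Bochner_Integration.integrable_add integrable_abs int0 ib)
  define \<epsilon> where "\<epsilon> m = inverse (real (Suc m))" for m
  have \<epsilon>: "\<epsilon> m > 0" "\<epsilon> m \<le> 1" for m by (auto simp: \<epsilon>_def field_simps)
  have \<epsilon>0: "\<epsilon> \<longlonglongrightarrow> 0" unfolding \<epsilon>_def by (rule LIMSEQ_inverse_real_of_nat)
  have s: "?s x > 0" if "x \<noteq> y" for x using that by simp
  have AEy: "AE x in lborel. x \<noteq> y" by (rule AE_lborel_singleton)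
  have inR: "?s x \<le> R\<^sup>2" if "x \<in> ball y R" for x
    using that by (auto simp: dot_square_norm dist_norm norm_minus_commute intro!: power_mono)
  have lim: "(\<lambda>m. LINT x|lborel. ?F (?s x + \<epsilon> m) * laplacian \<phi> x) \<longlonglongrightarrow> (LINT x|lborel. ?F (?s x) * laplacian \<phi> x)"
  proof (rule integral_dominated_convergence[OF _ _ dom])
    show "AE x in lborel. (\<lambda>m. ?F (?s x + \<epsilon> m) * laplacian \<phi> x) \<longlonglongrightarrow> ?F (?s x) * laplacian \<phi> x"
      using AEy
    proof eventually_elim
      case (elim x)
      have "isCont ?F (?s x)" using fundamental_has_derivative[OF s[OF elim]] by (rule DERIV_isCont)
      moreover have "(\<lambda>m. ?s x + \<epsilon> m) \<longlonglongrightarrow> ?s x + 0" by (intro tendsto_intros \<epsilon>0)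
      ultimately have "(\<lambda>m. ?F (?s x + \<epsilon> m)) \<longlonglongrightarrow> ?F (?s x)"
        by (intro isCont_tendsto_compose[of _ ?F]) auto
      then show ?case by (intro tendsto_intros)
    qed
    show "AE x in lborel. norm (?F (?s x + \<epsilon> m) * laplacian \<phi> x) \<le>
        M * (\<bar>indicator (ball y R) x * ?F (?s x)\<bar> + \<bar>?F S\<bar> * indicator (ball y R) x)" for m
      using AEy
    proof eventually_elim
      case (elim x)
      show ?case
      proof (cases "x \<in> K")
        case True
        with R have x: "x \<in> ball y R" by blast
        have "?F (?s x) \<le> ?F (?s x + \<epsilon> m)" using s[OF elim] \<epsilon>(1)[of m] by (intro fundamental_mono) auto
        moreover have "?F (?s x + \<epsilon> m) \<le> ?F S"
          using \<epsilon>[of m] inR[OF x] by (intro fundamental_mono) (auto simp: S_def add_nonneg_pos)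
        ultimately have "\<bar>?F (?s x + \<epsilon> m)\<bar> \<le> \<bar>?F (?s x)\<bar> + \<bar>?F S\<bar>" by linarith
        then have "\<bar>laplacian \<phi> x\<bar> * \<bar>?F (?s x + \<epsilon> m)\<bar> \<le> M * (\<bar>?F (?s x)\<bar> + \<bar>?F S\<bar>)"
          using M by (intro mult_mono) auto
        then show ?thesis using x by (simp add: abs_mult mult.commute)
      qed (use M lap0 in auto)
    qed
  qed measurable
  have "(LINT x|lborel. ?F (?s x + \<epsilon> m) * laplacian \<phi> x) =
      2 * real ?n * (LINT x|lborel. approx_kernel (\<epsilon> m) (x - y) * \<phi> x)" for m
  proof -
    define h where "h x = ?F (1 * (x \<bullet> x) - 2 * (x \<bullet> y) + (y \<bullet> y + \<epsilon> m))" for x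
    have pos: "1 * (x \<bullet> x) - 2 * (x \<bullet> y) + (y \<bullet> y + \<epsilon> m) > 0" for x
      unfolding quadratic_eq_norm using \<epsilon>(1)[of m] by (simp add: add_nonneg_pos)
    have "smooth_on UNIV h"
      unfolding h_def
      by (rule smooth_on_compose_real[OF open_UNIV smooth_real_on_fundamental smooth_on_quadratic[OF open_UNIV]])
        (use pos in auto)
    then have A: "(LINT x|lborel. h x * laplacian \<phi> x) = (LINT x|lborel. \<phi> x * laplacian h x)"
      by (rule integral_laplacian_symmetric[OF open_UNIV _ \<phi> K(1) subset_UNIV K(2)])
    have B: "laplacian h x = 2 * real ?n * approx_kernel (\<epsilon> m) (x - y)" for x
      using laplacian_fundamental_quadratic[OF pos] 
      unfolding h_def[abs_def] quadratic_eq_norm approx_kernel_def by simp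
    have C: "(LINT x|lborel. \<phi> x * (2 * real ?n * approx_kernel (\<epsilon> m) (x - y))) =
        2 * real ?n * (LINT x|lborel. approx_kernel (\<epsilon> m) (x - y) * \<phi> x)"
      by (subst integral_mult_right_zero[symmetric]) (simp add: mult_ac)
    show ?thesis
      using A unfolding B C unfolding h_def quadratic_eq_norm by simp
  qed
  moreover have "(\<lambda>m. 2 * real ?n * (LINT x|lborel. approx_kernel (\<epsilon> m) (x - y) * \<phi> x)) \<longlonglongrightarrow>
      2 * real ?n * (kernel_mass TYPE('a) * \<phi> y)"
    using cont(1) by (intro tendsto_intros approx_kernel_tendsto[OF _ Mp _ \<epsilon>(1) \<epsilon>0])
      (auto simp: continuous_on_eq_continuous_at)
  ultimately show "(LINT x|lborel. ?F (?s x) * laplacian \<phi> x) = 2 * real ?n * kernel_mass TYPE('a) * \<phi> y"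
    using LIMSEQ_unique[OF lim] by (simp add: mult.assoc)
qed

section \<open>The Green potential of a surface measure\<close>

abbreviation newton :: "'a::euclidean_space \<Rightarrow> real" where
  "newton z \<equiv> fundamental DIM('a) (z \<bullet> z)"

lemma continuous_on_integral_dominated:
  fixes f :: "'b::metric_space \<Rightarrow> 'a \<Rightarrow> real"
  assumes "finite_measure M" and meas: "\<And>x. x \<in> S \<Longrightarrow> f x \<in> borel_measurable M"
    and bound: "\<And>x. x \<in> S \<Longrightarrow> AE y in M. \<bar>f x y\<bar> \<le> B"
    and cont: "AE y in M. continuous_on S (\<lambda>x. f x y)"
  shows "continuous_on S (\<lambda>x. LINT y|M. f x y)"
proof (rule continuous_on_sequentiallyI)
  interpret finite_measure M by fact
  fix u a assume u: "\<forall>n. u n \<in> S" "a \<in> S" "u \<longlonglongrightarrow> a"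
  show "(\<lambda>n. LINT y|M. f (u n) y) \<longlonglongrightarrow> (LINT y|M. f a y)"
  proof (rule integral_dominated_convergence[where w="\<lambda>_. B"])
    show "AE y in M. (\<lambda>n. f (u n) y) \<longlonglongrightarrow> f a y"
      using cont
    proof eventually_elim
      case (elim y)
      then show ?case
        using u by (auto simp: continuous_on_sequentially o_def)
    qed
  qed (use u meas bound in auto)
qed

lemma continuous_on_fundamental: "continuous_on {0<..} (fundamental n)"
  using fundamental_has_derivative by (intro continuous_at_imp_continuous_on) (auto intro: DERIV_isCont)

lemma abs_fundamental_between:
  assumes "0 < l" "l \<le> s" "s \<le> h"
  shows "\<bar>fundamental n s\<bar> \<le> \<bar>fundamental n l\<bar> + \<bar>fundamental n h\<bar>"
  using fundamental_mono[of l s n] fundamental_mono[of s h n] assms by linarith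

text \<open>For y \<noteq> 0 this is |y|^2 times the squared distance of x from the reflected pole y
  / |y|^2; in expanded form y = 0 is no exception. For |x| = 1 it equals |x - y|^2.\<close>

definition green_corrector_arg :: "'a::euclidean_space \<Rightarrow> 'a \<Rightarrow> real" where
  "green_corrector_arg x y = (y \<bullet> y) * (x \<bullet> x) - 2 * (x \<bullet> y) + 1"

abbreviation green_corrector :: "'a::euclidean_space \<Rightarrow> 'a \<Rightarrow> real" where
  "green_corrector x y \<equiv> fundamental DIM('a) (green_corrector_arg x y)"

text \<open>By Cauchy-Schwarz the argument lies between (1 - |x| |y|)^2 and (1 + |x| |y|)^2. The
  corrector thus stays away from its singularity as long as y stays in the smaller ball.\<close>

lemma green_corrector_arg_bounds:
  assumes "norm x \<le> 1" "norm y \<le> \<rho>" "\<rho> < 1"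
  shows "(1 - \<rho>)\<^sup>2 \<le> green_corrector_arg x y" "green_corrector_arg x y \<le> 4"
proof -
  have xy: "norm x * norm y \<le> \<rho>"
    using mult_mono[OF assms(1,2)] norm_ge_zero[of y] assms by auto
  have nn: "0 \<le> norm x * norm y" by simp
  have eq: "green_corrector_arg x y = (norm x * norm y)\<^sup>2 - 2 * (x \<bullet> y) + 1"
    by (simp add: green_corrector_arg_def dot_square_norm power_mult_distrib)
  have cs: "\<bar>x \<bullet> y\<bar> \<le> norm x * norm y" by (rule Cauchy_Schwarz_ineq2)
  have "(1 - \<rho>)\<^sup>2 \<le> (1 - norm x * norm y)\<^sup>2" using xy assms by (intro power_mono) auto
  also have "\<dots> \<le> green_corrector_arg x y" using cs unfolding eq by (simp add: power2_diff abs_le_iff)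
  finally show "(1 - \<rho>)\<^sup>2 \<le> green_corrector_arg x y" .
  have "green_corrector_arg x y \<le> (1 + norm x * norm y)\<^sup>2" using cs unfolding eq
      by (simp add: power2_sum abs_le_iff)
  also have "\<dots> \<le> 2\<^sup>2" using xy assms nn by (intro power_mono) auto
  finally show "green_corrector_arg x y \<le> 4" by simp
qed

text \<open>M stands for Hausdorff measure restricted to \<Gamma>, regarded as a measure on the
  whole space. Growth on balls, support in a smaller ball and a bounded Borel density are what the
  potential theory relies on.\<close>

locale surface_measure =
  fixes M :: "'a::euclidean_space measure" and C \<rho> B :: real and g :: "'a \<Rightarrow> real"
  assumes sets_M [measurable_cong]: "sets M = sets borel"
    and dim: "DIM('a) \<ge> 2" and C: "C \<ge> 0"
    and growth: "\<And>x r. r > 0 \<Longrightarrow> emeasure M (ball x r) \<le> ennreal (C * r ^ (DIM('a) - 1))"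
    and support: "AE y in M. norm y \<le> \<rho>" and \<rho>: "\<rho> < 1"
    and g_measurable [measurable]: "g \<in> borel_measurable borel" and g_bound: "\<And>y. \<bar>g y\<bar> \<le> B"
begin

definition single_layer :: "'a \<Rightarrow> real" where
  "single_layer x = (LINT y|M. g y * newton (y - x))"

definition corrector :: "'a \<Rightarrow> real" where
  "corrector x = (LINT y|M. g y * green_corrector x y)"

definition potential :: "'a \<Rightarrow> real" where
  "potential x = (single_layer x - corrector x) / (2 * real DIM('a) * kernel_mass TYPE('a))"

lemma space_M [simp]: "space M = UNIV"
  using sets_eq_imp_space_eq[OF sets_M] by simp

lemma B_nonneg: "0 \<le> B" using g_bound[of undefined] by linarith

sublocale finite_measure M
proof
  have "emeasure M (space M) \<le> emeasure M (ball 0 1)"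
    using support \<rho> by (intro emeasure_mono_AE) (auto elim!: eventually_mono)
  also have "\<dots> < top" using growth[of 1 0] by (intro le_less_trans[OF growth]) auto
  finally show "emeasure M (space M) \<noteq> \<infinity>" by simp
qed

text \<open>The bound of \<open>nn_integral_fundamental_le\<close> for d = n - 1 and a = n - 3/2;
  here d - a = 1/2 produces the square root. It tends to 0 with R, which is the source of continuity
  of the single layer.\<close>

definition near_bound :: "real \<Rightarrow> real" where
  "near_bound R = 4 * (C * (2 powr (real DIM('a) - 3 / 2) / (1 - 2 powr (- 1 / 2))) * sqrt R) +
     2 * R\<^sup>2 * (C * R ^ (DIM('a) - 1))"

lemma near_bound_nonneg: "R > 0 \<Longrightarrow> 0 \<le> near_bound R"
proof -
  have "2 powr (- 1 / 2 :: real) < 2 powr 0" by (intro powr_less_mono) auto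
  then have "0 \<le> 2 powr (real DIM('a) - 3 / 2) / (1 - 2 powr (- 1 / 2))"
    by (intro divide_nonneg_nonneg) auto
  then show "R > 0 \<Longrightarrow> 0 \<le> near_bound R"
    unfolding near_bound_def using C by (intro add_nonneg_nonneg mult_nonneg_nonneg) auto
qed

lemma
  assumes R: "R > 0"
  shows integrable_near: "integrable M (\<lambda>y. indicator (ball x R) y * newton (y - x))"
    and integral_near_le: "(LINT y|M. indicator (ball x R) y * \<bar>newton (y - x)\<bar>) \<le> near_bound R"
proof -
  show "integrable M (\<lambda>y. indicator (ball x R) y * newton (y - x))"
    by (rule integrable_fundamental[OF sets_M dim order_refl C R growth])
  have d: "real (DIM('a) - 1) = real DIM('a) - 1" using dim by (simp add: of_nat_diff)
  show "(LINT y|M. indicator (ball x R) y * \<bar>newton (y - x)\<bar>) \<le> near_bound R"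
    using nn_integral_fundamental_le[OF sets_M dim order_refl C R growth, of x] near_bound_nonneg[OF R] R
    by (intro integral_real_bounded) (simp_all add: near_bound_def d powr_half_sqrt)
qed

lemma dist_lt_3:
  assumes "norm x \<le> 1"
  shows "AE y in M. y \<in> ball x 3"
  using support
proof eventually_elim
  case (elim y)
  have "dist x y \<le> norm x + norm y" unfolding dist_norm by (rule norm_triangle_ineq4)
  then show ?case using elim assms \<rho> by simp
qed

lemma
  assumes x: "norm x \<le> 1"
  shows integrable_single: "integrable M (\<lambda>y. g y * newton (y - x))"
    and integral_single_le: "(LINT y|M. \<bar>g y * newton (y - x)\<bar>) \<le> B * near_bound 3"
proof -
  note i = integrable_near[of 3 x]
  have "integrable M (\<lambda>y. B * \<bar>indicator (ball x 3) y * newton (y - x)\<bar>)"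
    using i by (intro integrable_mult_right integrable_abs) auto
  moreover have bd: "AE y in M. \<bar>g y * newton (y - x)\<bar> \<le> B * \<bar>indicator (ball x 3) y * newton (y - x)\<bar>"
    using dist_lt_3[OF x]
  proof eventually_elim
    case (elim y)
    then show ?case using mult_right_mono[OF g_bound[of y], of "\<bar>newton (y - x)\<bar>"] by (simp add: abs_mult)
  qed
  ultimately show i2: "integrable M (\<lambda>y. g y * newton (y - x))"
    using B_nonneg by (elim Bochner_Integration.integrable_bound) (auto simp: abs_mult)
  have "(LINT y|M. \<bar>g y * newton (y - x)\<bar>) \<le> (LINT y|M. B * (indicator (ball x 3) y * \<bar>newton (y - x)\<bar>))"
    using integrable_abs[OF i2] integrable_abs[OF i] bd
    by (intro integral_mono_AE integrable_mult_right) (auto simp: abs_mult)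
  also have "\<dots> \<le> B * near_bound 3" using integral_near_le[of 3 x] B_nonneg by (simp add: mult_left_mono)
  finally show "(LINT y|M. \<bar>g y * newton (y - x)\<bar>) \<le> B * near_bound 3" .
qed

lemma corrector_bound:
  assumes "norm x \<le> 1" "norm y \<le> \<rho>"
  shows "\<bar>g y * green_corrector x y\<bar> \<le> B * (\<bar>fundamental DIM('a) ((1 - \<rho>)\<^sup>2)\<bar> + \<bar>fundamental DIM('a) 4\<bar>)"
  using green_corrector_arg_bounds[OF assms \<rho>] \<rho> B_nonneg g_bound[of y] unfolding abs_mult
  by (intro mult_mono abs_fundamental_between) auto

lemma borel_measurable_green_corrector_arg [measurable]:
  "(\<lambda>p. green_corrector_arg (fst p) (snd p)) \<in> borel_measurable (borel \<Otimes>\<^sub>M borel)"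
  unfolding green_corrector_arg_def by measurable

lemma borel_measurable_green_corrector_arg2 [measurable]:
  "green_corrector_arg x \<in> borel_measurable borel"
  unfolding green_corrector_arg_def[abs_def] by measurable

lemma
  assumes x: "norm x \<le> 1"
  shows integrable_corrector: "integrable M (\<lambda>y. g y * green_corrector x y)"
    and integral_corrector_le: "(LINT y|M. \<bar>g y * green_corrector x y\<bar>) \<le>
      B * (\<bar>fundamental DIM('a) ((1 - \<rho>)\<^sup>2)\<bar> + \<bar>fundamental DIM('a) 4\<bar>) * measure M UNIV"
proof -
  have bd: "AE y in M. \<bar>g y * green_corrector x y\<bar> \<le> B * (\<bar>fundamental DIM('a) ((1 - \<rho>)\<^sup>2)\<bar>
      + \<bar>fundamental DIM('a) 4\<bar>)"
    using support by eventually_elim (rule corrector_bound[OF x])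
  then show i: "integrable M (\<lambda>y. g y * green_corrector x y)"
    by (intro integrable_const_bound[where B="B * (\<bar>fundamental DIM('a) ((1 - \<rho>)\<^sup>2)\<bar>
        + \<bar>fundamental DIM('a) 4\<bar>)"]) auto
  have "(LINT y|M. \<bar>g y * green_corrector x y\<bar>) \<le> (LINT y|M. B * (\<bar>fundamental DIM('a) ((1 - \<rho>)\<^sup>2)\<bar>
      + \<bar>fundamental DIM('a) 4\<bar>))"
    using i bd by (intro integral_mono_AE) auto
  then show "(LINT y|M. \<bar>g y * green_corrector x y\<bar>) \<le>
      B * (\<bar>fundamental DIM('a) ((1 - \<rho>)\<^sup>2)\<bar> + \<bar>fundamental DIM('a) 4\<bar>) * measure M UNIV" by (simp add: mult_ac)
qed

lemma continuous_on_corrector: "continuous_on (cball 0 1) corrector"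
  unfolding corrector_def
proof (rule continuous_on_integral_dominated[OF finite_measure_axioms])
  show "AE y in M. \<bar>g y * green_corrector x y\<bar> \<le> B * (\<bar>fundamental DIM('a) ((1 - \<rho>)\<^sup>2)\<bar>
      + \<bar>fundamental DIM('a) 4\<bar>)" if "x \<in> cball 0 1" for x
    using support by eventually_elim (use that in \<open>auto intro: corrector_bound\<close>)
  show "AE y in M. continuous_on (cball 0 1) (\<lambda>x. g y * green_corrector x y)"
    using support
  proof eventually_elim
    case (elim y)
    have "continuous_on (cball 0 1) (\<lambda>x. green_corrector_arg x y)"
      unfolding green_corrector_arg_def by (intro continuous_intros)
    moreover have "green_corrector_arg x y \<in> {0<..}" if "x \<in> cball 0 1" for x
    proof -
      have "0 < (1 - \<rho>)\<^sup>2" using \<rho> by simp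
      also have "\<dots> \<le> green_corrector_arg x y" using that elim \<rho> by (intro green_corrector_arg_bounds) auto
      finally show ?thesis by simp
    qed
    ultimately show ?case
      by (intro continuous_intros continuous_on_compose2[OF continuous_on_fundamental]) auto
  qed
qed measurable

text \<open>Truncating the kernel at distance \<delta> gives functions \<open>A \<delta>\<close>
  that are continuous by dominated convergence. The error comes from ball x \<delta> alone and is at
  most \<open>\<psi> \<delta>\<close>, uniformly in x, so the single layer is a uniform limit of
  continuous functions.\<close>

lemma continuous_on_single_layer: "continuous_on (cball 0 1) single_layer"
proof -
  define A where "A \<delta> x = (LINT y|M. g y * fundamental DIM('a) (max ((y - x) \<bullet> (y - x)) (\<delta>\<^sup>2)))" for \<delta> x
  define \<psi> where "\<psi> \<delta> = B * (near_bound \<delta> + (4 * \<delta> powr (- (real DIM('a) - 3 / 2))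
      + 2 * \<delta>\<^sup>2) * (C * \<delta> ^ (DIM('a) - 1)))" for \<delta>
  have s4: "(y - x) \<bullet> (y - x) \<le> 4" if "norm x \<le> 1" "norm y \<le> \<rho>" for x y :: 'a
  proof -
    have "norm (y - x) \<le> 2" using norm_triangle_ineq4[of y x] that \<rho> by linarith
    then have "(norm (y - x))\<^sup>2 \<le> 2\<^sup>2" by (intro power_mono) auto
    then show ?thesis by (simp add: dot_square_norm)
  qed
  have bd: "AE y in M. \<bar>g y * fundamental DIM('a) (max ((y - x) \<bullet> (y - x)) (\<delta>\<^sup>2))\<bar>
      \<le> B * (\<bar>fundamental DIM('a) (\<delta>\<^sup>2)\<bar> + \<bar>fundamental DIM('a) 4\<bar>)"
    if "0 < \<delta>" "\<delta> \<le> 1" "norm x \<le> 1" for \<delta> x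
    using support
  proof eventually_elim
    case (elim y)
    have "\<delta>\<^sup>2 \<le> 1" using that by (simp add: power_le_one)
    then show ?case
      unfolding abs_mult using s4[OF that(3) elim] that B_nonneg g_bound
      by (intro mult_mono abs_fundamental_between) auto
  qed
  have contA: "continuous_on (cball 0 1) (A \<delta>)" if \<delta>: "0 < \<delta>" "\<delta> \<le> 1" for \<delta>
    unfolding A_def
  proof (rule continuous_on_integral_dominated[OF finite_measure_axioms])
    show "AE y in M. \<bar>g y * fundamental DIM('a) (max ((y - x) \<bullet> (y - x)) (\<delta>\<^sup>2))\<bar>
        \<le> B * (\<bar>fundamental DIM('a) (\<delta>\<^sup>2)\<bar> + \<bar>fundamental DIM('a) 4\<bar>)" if "x \<in> cball 0 1" for x
      using bd[OF \<delta>, of x] that by simp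
    show "AE y in M. continuous_on (cball 0 1) (\<lambda>x. g y * fundamental DIM('a) (max ((y - x) \<bullet> (y - x)) (\<delta>\<^sup>2)))"
    proof (rule AE_I2)
      fix y :: 'a
      have "max ((y - x) \<bullet> (y - x)) (\<delta>\<^sup>2) \<in> {0<..}" for x using \<delta> by (simp add: less_max_iff_disj)
      then show "continuous_on (cball 0 1) (\<lambda>x. g y * fundamental DIM('a) (max ((y - x) \<bullet> (y - x)) (\<delta>\<^sup>2)))"
        by (intro continuous_intros continuous_on_compose2[OF continuous_on_fundamental]) auto
    qed
  qed measurable
  have close: "\<bar>A \<delta> x - single_layer x\<bar> \<le> \<psi> \<delta>" if \<delta>: "0 < \<delta>" "\<delta> \<le> 1" and x: "norm x \<le> 1" for \<delta> x
  proof -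
    let ?s = "\<lambda>y. (y - x) \<bullet> (y - x)"
    have iA: "integrable M (\<lambda>y. g y * fundamental DIM('a) (max (?s y) (\<delta>\<^sup>2)))"
      using bd[OF \<delta> x] by (intro integrable_const_bound) auto
    note iS = integrable_single[OF x]
    have iN: "integrable M (\<lambda>y. indicator (ball x \<delta>) y * \<bar>fundamental DIM('a) (?s y)\<bar>)"
      using integrable_abs[OF integrable_near[OF \<delta>(1), of x]] by (simp add: abs_mult)
    have iB: "integrable M (\<lambda>y. indicator (ball x \<delta>) y :: real)"
      by (simp add: integrable_indicator_iff less_top[symmetric])
    have Fd: "\<bar>fundamental DIM('a) (\<delta>\<^sup>2)\<bar> \<le> 4 * \<delta> powr (- (real DIM('a) - 3 / 2)) + 2 * \<delta>\<^sup>2"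
      using abs_fundamental_norm_le[OF dim, of "\<delta>"] \<delta> by (simp add: power2_eq_square)
    have "\<bar>A \<delta> x - single_layer x\<bar> = \<bar>LINT y|M. g y * fundamental DIM('a) (max (?s y) (\<delta>\<^sup>2))
        - g y * fundamental DIM('a) (?s y)\<bar>"
      unfolding A_def single_layer_def by (simp add: Bochner_Integration.integral_diff[OF iA iS])
    also have "\<dots> \<le> (LINT y|M. \<bar>g y * fundamental DIM('a) (max (?s y) (\<delta>\<^sup>2))
        - g y * fundamental DIM('a) (?s y)\<bar>)"
      by (rule integral_abs_bound)
    also have "\<dots> \<le> (LINT y|M. B * (indicator (ball x \<delta>) y * \<bar>fundamental DIM('a) (?s y)\<bar>
        + \<bar>fundamental DIM('a) (\<delta>\<^sup>2)\<bar> * indicator (ball x \<delta>) y))"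
    proof (intro integral_mono integrable_abs Bochner_Integration.integrable_diff iA iS integrable_mult_right
        Bochner_Integration.integrable_add iN iB)
      fix y
      show "\<bar>g y * fundamental DIM('a) (max (?s y) (\<delta>\<^sup>2)) - g y * fundamental DIM('a) (?s y)\<bar> \<le>
          B * (indicator (ball x \<delta>) y * \<bar>fundamental DIM('a) (?s y)\<bar>
              + \<bar>fundamental DIM('a) (\<delta>\<^sup>2)\<bar> * indicator (ball x \<delta>) y)"
      proof (cases "y \<in> ball x \<delta>")
        case True
        then have "?s y \<le> \<delta>\<^sup>2"
          by (auto simp: dot_square_norm dist_norm norm_minus_commute intro!: power_mono)
        then have "\<bar>g y * fundamental DIM('a) (max (?s y) (\<delta>\<^sup>2)) - g y * fundamental DIM('a) (?s y)\<bar>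
            = \<bar>g y\<bar> * \<bar>fundamental DIM('a) (\<delta>\<^sup>2) - fundamental DIM('a) (?s y)\<bar>"
          by (simp add: max_absorb2 abs_mult[symmetric] algebra_simps)
        also have "\<dots> \<le> B * (\<bar>fundamental DIM('a) (?s y)\<bar> + \<bar>fundamental DIM('a) (\<delta>\<^sup>2)\<bar>)"
          using g_bound[of y] B_nonneg by (intro mult_mono) auto
        finally show ?thesis using True by simp
      next
        case False
        then have "\<delta>\<^sup>2 \<le> ?s y" using \<delta>
          by (auto simp: dot_square_norm dist_norm norm_minus_commute intro!: power_mono)
        then show ?thesis using False by (simp add: max_absorb1)
      qed
    qed
    also have "\<dots> = B * ((LINT y|M. indicator (ball x \<delta>) y * \<bar>fundamental DIM('a) (?s y)\<bar>)
        + \<bar>fundamental DIM('a) (\<delta>\<^sup>2)\<bar> * measure M (ball x \<delta>))"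
      using iN iB by (simp add: Bochner_Integration.integral_add)
    also have "\<dots> \<le> \<psi> \<delta>"
    proof -
      have "measure M (ball x \<delta>) \<le> C * \<delta> ^ (DIM('a) - 1)"
        using growth[OF \<delta>(1), of x] C \<delta> by (simp add: emeasure_eq_measure)
      then show ?thesis
        unfolding \<psi>_def using integral_near_le[OF \<delta>(1), of x] Fd B_nonneg
        by (intro mult_left_mono add_mono mult_mono) auto
    qed
    finally show ?thesis .
  qed
  define \<delta> where "\<delta> m = inverse (real (Suc m))" for m
  have \<delta>: "0 < \<delta> m" "\<delta> m \<le> 1" for m by (auto simp: \<delta>_def field_simps)
  have \<delta>0: "\<delta> \<longlonglongrightarrow> 0" unfolding \<delta>_def by (rule LIMSEQ_inverse_real_of_nat)
  have \<psi>0: "(\<lambda>m. \<psi> (\<delta> m)) \<longlonglongrightarrow> 0"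
  proof -
    define c where "c = 2 powr (real DIM('a) - 3 / 2) / (1 - 2 powr (- 1 / 2))"
    let ?d = "DIM('a) - 1"
    have d: "real ?d = real DIM('a) - 1" using dim by (simp add: of_nat_diff)
    have "\<psi> t = B * (4 * (C * c * sqrt t) + 2 * t\<^sup>2 * (C * t ^ ?d) + 4 * C * sqrt t
        + 2 * t\<^sup>2 * (C * t ^ ?d))" if "t > 0" for t
    proof -
      \<comment> \<open>The exponents add up to (n - 1) - (n - 3/2) = 1/2, so the truncated value
        times the mass of the ball still tends to 0.\<close>
      have "t powr (- (real DIM('a) - 3 / 2)) * t ^ ?d = sqrt t"
        using that by (simp add: powr_realpow[symmetric] powr_add[symmetric] d powr_half_sqrt[symmetric])
      then show ?thesis by (simp add: \<psi>_def near_bound_def c_def algebra_simps)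
    qed
    then have "(\<lambda>m. \<psi> (\<delta> m)) = (\<lambda>m. B * (4 * (C * c * sqrt (\<delta> m)) + 2 * (\<delta> m)\<^sup>2 * (C * \<delta> m ^ ?d) +
        4 * C * sqrt (\<delta> m) + 2 * (\<delta> m)\<^sup>2 * (C * \<delta> m ^ ?d)))"
      using \<delta>(1) by auto
    moreover have "(\<lambda>m. B * (4 * (C * c * sqrt (\<delta> m)) + 2 * (\<delta> m)\<^sup>2 * (C * \<delta> m ^ ?d) +
        4 * C * sqrt (\<delta> m) + 2 * (\<delta> m)\<^sup>2 * (C * \<delta> m ^ ?d))) \<longlonglongrightarrow>
        B * (4 * (C * c * sqrt 0) + 2 * 0\<^sup>2 * (C * 0 ^ ?d) + 4 * C * sqrt 0 + 2 * 0\<^sup>2 * (C * 0 ^ ?d))"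
      by (intro tendsto_intros \<delta>0)
    ultimately show ?thesis by simp
  qed
  have "uniform_limit (cball 0 1) (\<lambda>m. A (\<delta> m)) single_layer sequentially"
  proof (rule uniform_limitI)
    fix e :: real assume "e > 0"
    then have "eventually (\<lambda>m. \<psi> (\<delta> m) < e) sequentially" using \<psi>0 by (rule order_tendstoD(2)[rotated])
    then show "eventually (\<lambda>m. \<forall>x\<in>cball 0 1. dist (A (\<delta> m) x) (single_layer x) < e) sequentially"
    proof eventually_elim
      case (elim m)
      show ?case
      proof
        fix x :: 'a assume "x \<in> cball 0 1"
        then show "dist (A (\<delta> m) x) (single_layer x) < e"
          using close[OF \<delta>, of x m] elim by (simp add: dist_real_def)
      qed
    qed
  qed
  then show ?thesis
    by (rule uniform_limit_theorem[rotated]) (use contA \<delta> in \<open>auto intro: always_eventually\<close>)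
qed

lemma continuous_on_potential: "continuous_on (cball 0 1) potential"
  unfolding potential_def using kernel_mass_pos[where 'a='a]
  by (intro continuous_intros continuous_on_single_layer continuous_on_corrector) auto

text \<open>On the unit sphere the corrector kernel coincides with the singular one, so the single
  layer and the corrector agree there.\<close>

lemma potential_boundary:
  assumes "norm x = 1"
  shows "potential x = 0"
proof -
  have "green_corrector_arg x y = (y - x) \<bullet> (y - x)" for y
    using assms by (simp add: green_corrector_arg_def norm_eq_1 algebra_simps inner_commute)
  then show ?thesis by (simp add: potential_def single_layer_def corrector_def)
qed

text \<open>Serves both the single layer and the corrector. Integrability on the product follows
  from the bound D, uniform in x, and an integrable h vanishing off the ball.\<close>

lemma kernel_Fubini:
  fixes k :: "'a \<Rightarrow> 'a \<Rightarrow> real"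
  assumes k [measurable]: "(\<lambda>p. k (fst p) (snd p)) \<in> borel_measurable (borel \<Otimes>\<^sub>M borel)"
    and int: "\<And>x. norm x \<le> 1 \<Longrightarrow> integrable M (\<lambda>y. g y * k x y)"
    and D: "\<And>x. norm x \<le> 1 \<Longrightarrow> (LINT y|M. \<bar>g y * k x y\<bar>) \<le> D"
    and h: "integrable lborel h" "\<And>x. x \<notin> ball 0 1 \<Longrightarrow> h x = 0"
  shows "integrable lborel (\<lambda>x. (LINT y|M. g y * k x y) * h x)"
    and "(LINT x|lborel. (LINT y|M. g y * k x y) * h x) = (LINT y|M. g y * (LINT x|lborel. k x y * h x))"
proof -
  interpret lM: pair_sigma_finite lborel M ..
  have [measurable]: "h \<in> borel_measurable borel" using h(1) by (simp add: borel_measurable_integrable)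
  have [measurable]: "(\<lambda>(x, y). k x y) \<in> borel_measurable (borel \<Otimes>\<^sub>M borel)" using k
      by (simp add: case_prod_beta')
  define f where "f p = g (snd p) * k (fst p) (snd p) * h (fst p)" for p
  have [measurable]: "f \<in> borel_measurable (lborel \<Otimes>\<^sub>M M)" unfolding f_def by measurable
  have z: "f (x, y) = 0" if "\<not> norm x \<le> 1" for x y using h(2)[of x] that by (simp add: f_def)
  have i: "integrable (lborel \<Otimes>\<^sub>M M) f"
  proof (rule lM.Fubini_integrable)
    show "AE x in lborel. integrable M (\<lambda>y. f (x, y))"
    proof (rule AE_I2)
      fix x show "integrable M (\<lambda>y. f (x, y))"
        using int[of x] h(2)[of x] by (cases "norm x \<le> 1") (auto simp: f_def)
    qed
    show "integrable lborel (\<lambda>x. LINT y|M. norm (f (x, y)))"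
    proof (rule Bochner_Integration.integrable_bound)
      show "integrable lborel (\<lambda>x. D * \<bar>h x\<bar>)" using h(1) by simp
      show "AE x in lborel. norm (LINT y|M. norm (f (x, y))) \<le> norm (D * \<bar>h x\<bar>)"
      proof (rule AE_I2)
        fix x
        show "norm (LINT y|M. norm (f (x, y))) \<le> norm (D * \<bar>h x\<bar>)"
        proof (cases "norm x \<le> 1")
          case True
          have "(LINT y|M. norm (f (x, y))) = (LINT y|M. \<bar>g y * k x y\<bar>) * \<bar>h x\<bar>"
            by (simp add: f_def abs_mult)
          also have "\<dots> \<le> D * \<bar>h x\<bar>" using D[OF True] by (intro mult_right_mono) auto
          finally show ?thesis by (simp add: abs_of_nonneg integral_nonneg)
        qed (simp add: z)
      qed
    qed measurable
  qed measurable
  have e1: "(LINT y|M. f (x, y)) = (LINT y|M. g y * k x y) * h x" for x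
    by (simp add: f_def)
  have e2: "(LINT x|lborel. f (x, y)) = g y * (LINT x|lborel. k x y * h x)" for y
    by (simp add: f_def mult.assoc)
  show "integrable lborel (\<lambda>x. (LINT y|M. g y * k x y) * h x)"
    using lM.integrable_fst'[OF i] by (simp add: e1)
  show "(LINT x|lborel. (LINT y|M. g y * k x y) * h x) = (LINT y|M. g y * (LINT x|lborel. k x y * h x))"
    using lM.Fubini_integral[of "\<lambda>x y. f (x, y)"] i by (simp add: e1 e2)
qed

text \<open>After Fubini, the integral in x is a fixed multiple of \<phi> y for the singular kernel,
  by the fundamental solution, and 0 for the corrector, which is harmonic on a neighbourhood of the
  support of \<phi>.\<close>

theorem potential_weak_solution:
  assumes \<phi>: "\<phi> \<in> test_functions (ball 0 1)"
  shows "(LINT x|lborel. potential x * laplacian \<phi> x) = (LINT y|M. g y * \<phi> y)"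
proof -
  define K where "K = closure {x. \<phi> x \<noteq> 0}"
  have sm: "smooth_on UNIV \<phi>" and K: "compact K" "K \<subseteq> ball 0 1" "\<And>x. x \<notin> K \<Longrightarrow> \<phi> x = 0"
    using \<phi> closure_subset[of "{x. \<phi> x \<noteq> 0}"] by (auto simp: test_functions_def K_def)
  let ?c = "2 * real DIM('a) * kernel_mass TYPE('a)"
  have c: "?c > 0" using kernel_mass_pos[where 'a='a] by simp
  have lap0: "laplacian \<phi> x = 0" if "x \<notin> K" for x
    using laplacian_zero_outside[of K \<phi> x] compact_imp_closed[OF K(1)] K(3) that by blast
  have contL: "continuous_on UNIV (laplacian \<phi>)" using sm by (rule continuous_on_laplacian)
  have iL: "integrable lborel (laplacian \<phi>)"
    using K(1) continuous_on_subset[OF contL subset_UNIV] lap0 by (rule integrable_compact_support)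
  have L1: "laplacian \<phi> x = 0" if "x \<notin> ball 0 1" for x using lap0 that K(2) by blast
  have F1: "integrable lborel (\<lambda>x. single_layer x * laplacian \<phi> x)"
    "(LINT x|lborel. single_layer x * laplacian \<phi> x) = (LINT y|M. g y * (LINT x|lborel. newton (y
        - x) * laplacian \<phi> x))"
    unfolding single_layer_def
    by (rule kernel_Fubini[OF _ integrable_single integral_single_le iL L1]; (measurable | assumption))+
  have F2: "integrable lborel (\<lambda>x. corrector x * laplacian \<phi> x)"
    "(LINT x|lborel. corrector x * laplacian \<phi> x)
        = (LINT y|M. g y * (LINT x|lborel. green_corrector x y * laplacian \<phi> x))"
    unfolding corrector_def
    by (rule kernel_Fubini[OF _ integrable_corrector integral_corrector_le iL L1]; (measurable | assumption))+
  have single: "(LINT x|lborel. newton (y - x) * laplacian \<phi> x) = ?c * \<phi> y" for y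
  proof -
    have "(y - x) \<bullet> (y - x) = (x - y) \<bullet> (x - y)" for x by (simp add: algebra_simps inner_commute)
    then show ?thesis using fundamental_solution[OF dim sm K(1,3), of y] by simp
  qed
  have corr: "(LINT x|lborel. green_corrector x y * laplacian \<phi> x) = 0" if y: "norm y \<le> \<rho>" for y
  proof -
    \<comment> \<open>The region where the corrector with pole parameter y is smooth; it is open and
      contains the unit ball, so Green's identity applies on it.\<close>
    define U where "U = {x. green_corrector_arg x y > 0}"
    have "open U" unfolding U_def green_corrector_arg_def by (intro open_Collect_less continuous_intros)
    have "ball 0 1 \<subseteq> U"
    proof
      fix x :: 'a assume "x \<in> ball 0 1"
      then have le: "(1 - \<rho>)\<^sup>2 \<le> green_corrector_arg x y" using y \<rho> by (intro green_corrector_arg_bounds) auto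
      have "0 < (1 - \<rho>)\<^sup>2" using \<rho> by simp
      also note le
      finally show "x \<in> U" unfolding U_def by simp
    qed
    then have KU: "K \<subseteq> U" using K(2) by blast
    have sF: "smooth_on U (\<lambda>x. green_corrector x y)"
      unfolding green_corrector_arg_def
      by (rule smooth_on_compose_real[OF \<open>open U\<close> smooth_real_on_fundamental smooth_on_quadratic[OF \<open>open U\<close>]])
        (simp add: U_def green_corrector_arg_def)
    have "(LINT x|lborel. green_corrector x y * laplacian \<phi> x) =
        (LINT x|lborel. \<phi> x * laplacian (\<lambda>x. green_corrector x y) x)"
      by (rule integral_laplacian_symmetric[OF \<open>open U\<close> sF sm K(1) KU K(3)])
    also have "\<dots> = (LINT x::'a|lborel. (0::real))"
    proof (rule Bochner_Integration.integral_cong[OF refl])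
      fix x
      show "\<phi> x * laplacian (\<lambda>x. green_corrector x y) x = 0"
      proof (cases "x \<in> K")
        case True
        then have "green_corrector_arg x y > 0" using KU by (auto simp: U_def)
        then have "laplacian (\<lambda>x. green_corrector x y) x = 0"
          unfolding green_corrector_arg_def by (subst laplacian_fundamental_quadratic) auto
        then show ?thesis by simp
      qed (simp add: K(3))
    qed
    finally show ?thesis by simp
  qed
  have "(LINT x|lborel. potential x * laplacian \<phi> x) =
      ((LINT x|lborel. single_layer x * laplacian \<phi> x) - (LINT x|lborel. corrector x * laplacian \<phi> x)) / ?c"
  proof -
    have "potential x * laplacian \<phi> x = (single_layer x * laplacian \<phi> x - corrector x * laplacian \<phi> x) / ?c"
        for x
      by (simp add: potential_def left_diff_distrib)
    then show ?thesis by (simp add: Bochner_Integration.integral_diff[OF F1(1) F2(1)])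
  qed
  \<comment> \<open>The inner integral is known to vanish only for norm y <= \<rho>, that is almost
    everywhere, which is why its measurability in y has to be established.\<close>
  also have "(LINT x|lborel. corrector x * laplacian \<phi> x) = (LINT y|M. 0)"
    unfolding F2(2)
  proof (rule integral_cong_AE)
    show "AE y in M. g y * (LINT x|lborel. green_corrector x y * laplacian \<phi> x) = 0"
      using support by eventually_elim (simp add: corr)
    have [measurable]: "laplacian \<phi> \<in> borel_measurable borel" using contL
        by (rule borel_measurable_continuous_onI)
    have "(\<lambda>p. fundamental DIM('a) (green_corrector_arg (snd p) (fst p)) * laplacian \<phi> (snd p))
        \<in> borel_measurable (M \<Otimes>\<^sub>M lborel)"
      unfolding green_corrector_arg_def by measurable
    then show "(\<lambda>y. g y * (LINT x|lborel. green_corrector x y * laplacian \<phi> x)) \<in> borel_measurable M"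
      by (intro borel_measurable_times lborel.borel_measurable_lebesgue_integral) (auto simp: case_prod_beta')
  qed simp
  also have "(LINT x|lborel. single_layer x * laplacian \<phi> x) = ?c * (LINT y|M. g y * \<phi> y)"
    unfolding F1(2) single by (subst integral_mult_right_zero[symmetric]) (simp add: mult_ac)
  finally show ?thesis using kernel_mass_pos[where 'a='a] by simp
qed

end

section \<open>Uniqueness\<close>

abbreviation bump :: "real \<Rightarrow> real" where "bump \<equiv> exp_bump 1"
abbreviation bump' :: "real \<Rightarrow> real" where "bump' \<equiv> exp_bump ([:0, 0, 1:] * (1 - pderiv 1))"

lemma bump'_eq: "bump' t = (if 0 < t then (1 / t)\<^sup>2 * exp (- (1 / t)) else 0)"
  by (simp add: exp_bump_def power2_eq_square)

lemma bump_simps: "0 \<le> bump t" "t \<le> 0 \<Longrightarrow> bump t = 0" "0 < t \<Longrightarrow> 0 < bump t" "bump t \<le> 1"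
  by (auto simp: exp_bump_def)

lemma bump'_simps: "0 \<le> bump' t" "t \<le> 0 \<Longrightarrow> bump' t = 0" "0 < t \<Longrightarrow> 0 < bump' t"
  unfolding bump'_eq by auto

lemma continuous_on_exp_bump: "continuous_on A (exp_bump p)"
  using exp_bump_has_derivative by (intro continuous_at_imp_continuous_on) (auto intro: DERIV_isCont)

lemma test_functionsI:
  assumes "smooth_on UNIV \<phi>" "compact K" "K \<subseteq> S" "\<And>x. x \<notin> K \<Longrightarrow> \<phi> x = 0"
  shows "\<phi> \<in> test_functions S"
proof -
  have sub: "closure {x. \<phi> x \<noteq> 0} \<subseteq> K"
    using assms(4) compact_imp_closed[OF assms(2)] by (intro closure_minimal) auto
  then have "compact (closure {x. \<phi> x \<noteq> 0})"
    using assms(2) by (metis closed_closure closed_Int_compact inf.absorb_iff1)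
  with sub show ?thesis using assms by (auto simp: test_functions_def)
qed

text \<open>A radial test function whose Laplacian is an approximate identity, with a negative sign, near
  \<open>a\<close> and nonnegative elsewhere. Integrating against it yields a mean value inequality.\<close>

lemma radial_test_function:
  fixes a :: "'a::euclidean_space"
  assumes \<epsilon>: "\<epsilon> > 0" and r: "r > 0"
  obtains \<phi> where "smooth_on UNIV \<phi>" "\<And>x. x \<notin> cball a r \<Longrightarrow> \<phi> x = 0"
    "\<And>x. laplacian \<phi> x = - 2 * real DIM('a) * approx_kernel \<epsilon> (x - a) * bump (r\<^sup>2 - (x - a) \<bullet> (x - a)) +
      4 * ((x - a) \<bullet> (x - a)) * ((x - a) \<bullet> (x - a) + \<epsilon>) powr (- (real DIM('a) / 2)) * bump' (r\<^sup>2 - (x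
          - a) \<bullet> (x - a))"
proof -
  let ?n = "real DIM('a)"
  \<comment> \<open>The cut-off multiplies the derivative of the radial profile, not the profile
    itself: cutting off the fundamental solution directly would leave terms without definite sign in
    the Laplacian.\<close>
  define p' where "p' s = - ((s + \<epsilon>) powr (- (?n / 2)) * bump (r\<^sup>2 - s))" for s
  define p2 where "p2 s = ?n / 2 * (s + \<epsilon>) powr (- (?n / 2) - 1) * bump (r\<^sup>2 - s) +
      (s + \<epsilon>) powr (- (?n / 2)) * bump' (r\<^sup>2 - s)" for s
  have bd: "((\<lambda>s. bump (r\<^sup>2 - s)) has_real_derivative - bump' (r\<^sup>2 - s)) (at s)" for s
  proof -
    have "((\<lambda>s. r\<^sup>2 - s) has_real_derivative - 1) (at s)" by (auto intro!: derivative_eq_intros)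
    from DERIV_chain2[OF exp_bump_has_derivative[of 1] this] show ?thesis by simp
  qed
  have p'2: "(p' has_real_derivative p2 s) (at s)" if "s > - \<epsilon>" for s
    unfolding p'_def p2_def using that
    by (auto intro!: derivative_eq_intros bd simp: algebra_simps)
  have "\<exists>F. \<forall>s :: real. ereal (- \<epsilon>) < ereal s \<longrightarrow> ereal s < \<infinity> \<longrightarrow> (F has_vector_derivative p' s) (at s)"
    by (intro einterval_antiderivative) (auto intro: DERIV_isCont p'2)
  then obtain F where F: "\<And>s. s > - \<epsilon> \<Longrightarrow> (F has_real_derivative p' s) (at s)"
    by (auto simp: has_real_derivative_iff_has_vector_derivative)
  \<comment> \<open>Normalised at r^2: beyond that point p' is 0, hence so is p.\<close>
  define p where "p s = F s - F (r\<^sup>2)" for s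
  have pd: "(p has_real_derivative p' s) (at s)" if "s > - \<epsilon>" for s
    unfolding p_def using F[OF that] by (auto intro!: derivative_eq_intros)
  have p0: "p s = 0" if s: "s \<ge> r\<^sup>2" for s
  proof (cases "s = r\<^sup>2")
    case False
    with s have s: "r\<^sup>2 < s" by simp
    have "\<exists>z. r\<^sup>2 < z \<and> z < s \<and> F s - F (r\<^sup>2) = (s - r\<^sup>2) * p' z"
    proof (rule MVT2[OF s])
      fix z assume "r\<^sup>2 \<le> z"
      moreover have "0 \<le> r\<^sup>2" by simp
      ultimately have "z > - \<epsilon>" using \<epsilon> by linarith
      then show "(F has_real_derivative p' z) (at z)" by (rule F)
    qed
    then show ?thesis by (auto simp: p_def p'_def bump_simps)
  qed (simp add: p_def)
  define q where "q x = 1 * (x \<bullet> x) - 2 * (x \<bullet> a) + a \<bullet> a" for x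
  have q: "q x = (x - a) \<bullet> (x - a)" for x
    by (simp add: q_def algebra_simps inner_commute)
  have qpos: "q x > - \<epsilon>" for x unfolding q using \<epsilon> inner_ge_zero[of "x - a"] by linarith
  have qpos\<epsilon>: "q x + \<epsilon> > 0" for x using qpos[of x] by linarith
  have qs: "smooth_on UNIV q" unfolding q_def by (rule smooth_on_quadratic[OF open_UNIV])
  define \<phi> where "\<phi> x = p (q x)" for x
  have "smooth_on UNIV \<phi>"
  proof (rule smooth_on_intro_derivative[OF open_UNIV])
    fix x
    have "(q has_derivative (\<lambda>v. 2 * ((x - a) \<bullet> v))) (at x)"
      unfolding q_def by (auto intro!: derivative_eq_intros simp: algebra_simps inner_commute)
    from has_derivative_compose[OF this pd[OF qpos, unfolded has_field_derivative_def]]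
    show "(\<phi> has_derivative (\<lambda>v. p' (q x) * (2 * ((x - a) \<bullet> v)))) (at x)"
      unfolding \<phi>_def .
  next
    fix b :: 'a
    have "smooth_on UNIV (\<lambda>x. ((- 1) * ((q x + \<epsilon>) powr (- (?n / 2)) * bump (r\<^sup>2
        + (- 1) * q x))) * (2 * (x \<bullet> b + (- (a \<bullet> b)))))"
    proof (intro smooth_on_mult smooth_on_add smooth_on_const smooth_on_inner open_UNIV)
      show "smooth_on UNIV (\<lambda>x. (q x + \<epsilon>) powr (- (?n / 2)))"
        by (rule smooth_on_compose_real[OF open_UNIV smooth_real_on_powr smooth_on_add[OF open_UNIV qs smooth_on_const]])
          (use qpos\<epsilon> in auto)
      show "smooth_on UNIV (\<lambda>x. bump (r\<^sup>2 + (- 1) * q x))"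
        by (rule smooth_on_compose_real[OF open_UNIV smooth_real_on_exp_bump smooth_on_add[OF open_UNIV
            smooth_on_const[OF open_UNIV] smooth_on_mult[OF open_UNIV smooth_on_const[OF open_UNIV] qs]]]) simp
    qed
    then show "smooth_on UNIV (\<lambda>x. p' (q x) * (2 * ((x - a) \<bullet> b)))"
      by (simp add: p'_def inner_diff_left)
  qed
  moreover have "\<phi> x = 0" if "x \<notin> cball a r" for x
  proof -
    have "r\<^sup>2 \<le> (norm (x - a))\<^sup>2" using that r by (intro power_mono) (auto simp: dist_norm norm_minus_commute)
    then show ?thesis by (simp add: \<phi>_def q dot_square_norm p0)
  qed
  moreover have "laplacian \<phi> x = - 2 * ?n * approx_kernel \<epsilon> (x - a) * bump (r\<^sup>2 - (x - a) \<bullet> (x - a)) +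
      4 * ((x - a) \<bullet> (x - a)) * ((x - a) \<bullet> (x - a) + \<epsilon>) powr (- (?n / 2)) * bump' (r\<^sup>2 - (x - a) \<bullet> (x - a))"
          for x
  proof -
    have "laplacian \<phi> x = 4 * p2 (q x) * (1 * q x - 1 * (a \<bullet> a) + a \<bullet> a) + 2 * ?n * 1 * p' (q x)"
      unfolding \<phi>_def q_def
      by (rule laplacian_compose_quadratic[of "{- \<epsilon><..}"])
        (use pd p'2 qpos in \<open>auto simp: q_def\<close>)
    also have "\<dots> = 4 * q x * p2 (q x) + 2 * ?n * p' (q x)" by simp
    also have "\<dots> = - 2 * ?n * (\<epsilon> * (q x + \<epsilon>) powr (- (?n / 2) - 1)) * bump (r\<^sup>2 - q x) +
        4 * q x * (q x + \<epsilon>) powr (- (?n / 2)) * bump' (r\<^sup>2 - q x)"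
    proof -
      have "(q x + \<epsilon>) powr (- (?n / 2)) = (q x + \<epsilon>) * (q x + \<epsilon>) powr (- (?n / 2) - 1)"
        using qpos[of x] by (simp add: powr_diff)
      then have p': "p' (q x) = - ((q x + \<epsilon>) * (q x + \<epsilon>) powr (- (?n / 2) - 1) * bump (r\<^sup>2 - q x))"
        by (simp only: p'_def)
      show ?thesis unfolding p' p2_def by (simp add: algebra_simps)
    qed
    finally show ?thesis unfolding q approx_kernel_def .
  qed
  ultimately show thesis by (rule that)
qed

lemma integral_laplacian_compact_support:
  assumes "smooth_on UNIV \<phi>" "compact K" "\<And>x. x \<notin> K \<Longrightarrow> \<phi> x = 0"
  shows "(LINT x|lborel. laplacian \<phi> x) = 0"
proof -
  have "laplacian (\<lambda>_::'a. 1) x = 0" for x :: 'a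
    by (subst laplacian_eqI[OF open_UNIV, where D="\<lambda>_ _. 0" and E="\<lambda>_ _. 0"]) auto
  then show ?thesis
    using integral_laplacian_symmetric[OF open_UNIV smooth_on_const[OF open_UNIV] assms(1,2) subset_UNIV assms(3), of 1]
    by simp
qed

text \<open>Testing with the radial function with pole a expresses the integral of w a - w against a
  nonnegative weight by an average of f against the approximate identity, which tends to a multiple
  of f a = 0. The nonnegative integrand h therefore vanishes almost everywhere, against its
  positivity near a point x with w x < w a.\<close>

lemma weakly_harmonic_mean_inequality:
  fixes w :: "'a::euclidean_space \<Rightarrow> real"
  assumes cont: "continuous_on UNIV w" and r: "r > 0" and le: "\<And>x. w x \<le> w a"
    and weak: "\<And>\<phi>. smooth_on UNIV \<phi> \<Longrightarrow> (\<And>x. x \<notin> cball a r \<Longrightarrow> \<phi> x = 0) \<Longrightarrow> (LINT x|lborel. w x * laplacian \<phi> x) = 0"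
    and x: "x \<in> ball a r"
  shows "w x = w a"
proof (rule ccontr)
  assume ne: "w x \<noteq> w a"
  let ?n = "real DIM('a)"
  let ?s = "\<lambda>x. (x - a) \<bullet> (x - a)"
  let ?K = "cball a r"
  \<comment> \<open>The weight with \<epsilon> replaced by 1 lies below all weights with \<epsilon>
    <= 1 and does not change in the limit.\<close>
  define h where "h x = (w a - w x) * (4 * ?s x * (?s x + 1) powr (- (?n / 2)) * bump' (r\<^sup>2 - ?s x))" for x
  define f where "f x = bump (r\<^sup>2 - ?s x) * (w a - w x)" for x
  have s1: "?s x + 1 \<noteq> 0" for x using inner_ge_zero[of "x - a"] by linarith
  have cont_bump: "continuous_on A (\<lambda>x. exp_bump p (r\<^sup>2 - ?s x))" for A p
    by (intro continuous_on_compose2[OF continuous_on_exp_bump[of UNIV]] continuous_intros) auto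
  have out: "r\<^sup>2 - ?s x \<le> 0" if "x \<notin> ?K" for x
  proof -
    have "r\<^sup>2 \<le> (norm (x - a))\<^sup>2" using that r by (intro power_mono) (auto simp: dist_norm norm_minus_commute)
    then show ?thesis by (simp add: dot_square_norm)
  qed
  have cw: "continuous_on A w" for A using cont continuous_on_subset by blast
  have hcont: "continuous_on UNIV h"
    unfolding h_def by (intro continuous_intros cw cont_bump) (use s1 in auto)
  have ih: "integrable lborel h"
    using continuous_on_subset[OF hcont subset_UNIV] bump'_simps(2)[OF out]
    by (intro integrable_compact_support[of ?K]) (auto simp: h_def)
  have h0: "h x \<ge> 0" for x
    unfolding h_def using le bump'_simps(1) by (intro mult_nonneg_nonneg) auto
  have fcont: "continuous_on UNIV f" unfolding f_def by (intro continuous_intros cw cont_bump)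
  then have [measurable]: "f \<in> borel_measurable borel" by (rule borel_measurable_continuous_onI)
  have f0: "f x = 0" if "x \<notin> ?K" for x using bump_simps(2)[OF out[OF that]] by (simp add: f_def)
  obtain B where B: "\<And>x. \<bar>f x\<bar> \<le> B"
    using bounded_compact_support[OF compact_cball continuous_on_subset[OF fcont subset_UNIV] f0] by blast
  have key: "(LINT x|lborel. h x) \<le> 2 * ?n * (LINT x|lborel. approx_kernel \<epsilon> (x - a) * f x)"
    if \<epsilon>: "0 < \<epsilon>" "\<epsilon> \<le> 1" for \<epsilon>
  proof -
    obtain \<phi> where \<phi>: "smooth_on UNIV \<phi>" "\<And>x. x \<notin> ?K \<Longrightarrow> \<phi> x = 0"
      "\<And>x. laplacian \<phi> x = - 2 * ?n * approx_kernel \<epsilon> (x - a) * bump (r\<^sup>2 - ?s x) +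
        4 * ?s x * (?s x + \<epsilon>) powr (- (?n / 2)) * bump' (r\<^sup>2 - ?s x)"
      using radial_test_function[OF \<epsilon>(1) r, where a=a] by blast
    have lapc: "continuous_on A (laplacian \<phi>)" for A
      using continuous_on_laplacian[OF \<phi>(1)] continuous_on_subset by blast
    have lap0: "laplacian \<phi> x = 0" if "x \<notin> ?K" for x
      using laplacian_zero_outside[of ?K \<phi> x] \<phi>(2) that by blast
    have i1: "integrable lborel (laplacian \<phi>)" "integrable lborel (\<lambda>x. w x * laplacian \<phi> x)"
      by (rule integrable_compact_support[of ?K]; auto intro!: continuous_intros cw lapc simp: lap0)+
    define h\<epsilon> where "h\<epsilon> x = (w a - w x) * (4 * ?s x * (?s x + \<epsilon>) powr (- (?n / 2)) * bump' (r\<^sup>2 - ?s x))" for x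
    have s\<epsilon>: "?s x + \<epsilon> \<noteq> 0" for x using inner_ge_zero[of "x - a"] \<epsilon> by linarith
    have "continuous_on ?K h\<epsilon>"
      unfolding h\<epsilon>_def by (intro continuous_intros cw cont_bump) (use s\<epsilon> in auto)
    then have ih\<epsilon>: "integrable lborel h\<epsilon>"
      using bump'_simps(2)[OF out] by (intro integrable_compact_support[of ?K]) (auto simp: h\<epsilon>_def)
    have ik: "integrable lborel (\<lambda>x. approx_kernel \<epsilon> (x - a) * f x)"
      by (rule integrable_approx_kernel_mult[OF _ B \<epsilon>(1)]) measurable
    have "(LINT x|lborel. h x) \<le> (LINT x|lborel. h\<epsilon> x)"
    proof (intro integral_mono ih ih\<epsilon>)
      fix x
      have "(?s x + 1) powr (- (?n / 2)) \<le> (?s x + \<epsilon>) powr (- (?n / 2))"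
        using \<epsilon> by (intro powr_mono2') (auto simp: add_nonneg_pos)
      then show "h x \<le> h\<epsilon> x"
        unfolding h_def h\<epsilon>_def using le bump'_simps(1)
        by (intro mult_left_mono mult_right_mono) auto
    qed
    also have "\<dots> = 2 * ?n * (LINT x|lborel. approx_kernel \<epsilon> (x - a) * f x)"
    proof -
      have "(w a - w x) * laplacian \<phi> x = h\<epsilon> x - 2 * ?n * (approx_kernel \<epsilon> (x - a) * f x)" for x
        unfolding \<phi>(3) h\<epsilon>_def f_def by (simp add: algebra_simps)
      then have "(LINT x|lborel. w a * laplacian \<phi> x - w x * laplacian \<phi> x) =
          (LINT x|lborel. h\<epsilon> x - 2 * ?n * (approx_kernel \<epsilon> (x - a) * f x))"
        by (simp add: left_diff_distrib)
      \<comment> \<open>The constant w a drops out because the Laplacian of a compactly supported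
        function has integral 0; the term with w is 0 by assumption.\<close>
      moreover have "(LINT x|lborel. w a * laplacian \<phi> x - w x * laplacian \<phi> x) = 0"
        using i1 weak[OF \<phi>(1,2)] integral_laplacian_compact_support[OF \<phi>(1) compact_cball \<phi>(2)]
        by (simp add: Bochner_Integration.integral_diff)
      ultimately show ?thesis
        using ih\<epsilon> ik by (simp add: Bochner_Integration.integral_diff)
    qed
    finally show ?thesis .
  qed
  define \<epsilon> where "\<epsilon> m = inverse (real (Suc m))" for m
  have \<epsilon>: "0 < \<epsilon> m" "\<epsilon> m \<le> 1" for m by (auto simp: \<epsilon>_def field_simps)
  have \<epsilon>0: "\<epsilon> \<longlonglongrightarrow> 0" unfolding \<epsilon>_def by (rule LIMSEQ_inverse_real_of_nat)
  have "(\<lambda>m. 2 * ?n * (LINT x|lborel. approx_kernel (\<epsilon> m) (x - a) * f x))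
      \<longlonglongrightarrow> 2 * ?n * (kernel_mass TYPE('a) * f a)"
    using fcont by (intro tendsto_intros approx_kernel_tendsto[OF _ B _ \<epsilon>(1) \<epsilon>0])
      (auto simp: continuous_on_eq_continuous_at)
  then have "(LINT x|lborel. h x) \<le> 2 * ?n * (kernel_mass TYPE('a) * f a)"
    by (rule LIMSEQ_le_const) (use key[OF \<epsilon>] in blast)
  then have "(LINT x|lborel. h x) \<le> 0" by (simp add: f_def)
  then have "(LINT x|lborel. h x) = 0" by (intro antisym Bochner_Integration.integral_nonneg h0)
  then have AE0: "AE x in lborel. h x = 0"
    using integral_nonneg_eq_0_iff_AE[OF ih] h0 by auto
  have "x \<noteq> a" using ne by auto
  have "w x < w a" using ne le[of x] by simp
  have "h x > 0"
  proof -
    have "(norm (x - a))\<^sup>2 < r\<^sup>2" using x r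
        by (intro power_strict_mono) (auto simp: dist_norm norm_minus_commute)
    then have "bump' (r\<^sup>2 - ?s x) > 0" by (intro bump'_simps) (simp add: dot_square_norm)
    moreover have "(?s x + 1) powr (- (?n / 2)) > 0" using s1[of x] by simp
    moreover have "?s x > 0" using \<open>x \<noteq> a\<close> by simp
    ultimately show ?thesis using \<open>w x < w a\<close> s1[of x] unfolding h_def by (intro mult_pos_pos) auto
  qed
  then have "eventually (\<lambda>y. 0 < h y) (nhds x)"
    using hcont by (auto simp: continuous_on_eq_continuous_at continuous_at eventually_nhds_conv_at intro: order_tendstoD)
  then obtain d where d: "d > 0" "\<And>y. dist y x < d \<Longrightarrow> 0 < h y" by (auto simp: eventually_nhds_metric)
  have "AE y in lborel. y \<notin> ball x d"
    using AE0 by eventually_elim (use d in \<open>force simp: dist_commute\<close>)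
  then have "emeasure lborel (ball x d) = 0" by (subst (asm) AE_iff_measurable[of "ball x d"]) auto
  then show False using d(1) unit_ball_vol_pos[of "real DIM('a)"] by (simp add: emeasure_ball)
qed

text \<open>If w were positive somewhere, take a maximum point a farthest from the origin. It is
  interior, since w vanishes off the open ball, and w is constant on a small ball around it; that
  ball contains points of larger norm.\<close>

theorem weakly_harmonic_nonpos:
  fixes w :: "'a::euclidean_space \<Rightarrow> real"
  assumes cont: "continuous_on UNIV w" and out: "\<And>x. x \<notin> ball 0 1 \<Longrightarrow> w x = 0"
    and weak: "\<And>\<phi>. \<phi> \<in> test_functions (ball 0 1) \<Longrightarrow> (LINT x|lborel. w x * laplacian \<phi> x) = 0"
  shows "w x \<le> 0"
proof (rule ccontr)
  assume pos: "\<not> w x \<le> 0"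
  have cw: "continuous_on A w" for A using cont continuous_on_subset by blast
  have "x \<in> cball 0 1" using pos out[of x] by (cases "x \<in> ball 0 1") auto
  obtain m where m: "m \<in> cball 0 1" "\<And>y. y \<in> cball 0 1 \<Longrightarrow> w y \<le> w m"
    using continuous_attains_sup[OF compact_cball _ cw, of 0 1]
        by (metis cball_eq_empty less_le_not_le not_one_less_zero)
  have wm: "w m > 0" using m(2)[OF \<open>x \<in> cball 0 1\<close>] pos by linarith
  have max: "w y \<le> w m" for y using m(2)[of y] out[of y] wm by (cases "y \<in> ball 0 1") auto
  define Z where "Z = {y \<in> cball 0 1. w y = w m}"
  have "closed {y. w y = w m}" using cont by (intro closed_Collect_eq continuous_on_const) auto
  from compact_Int_closed[OF compact_cball[of 0 1] this]
  have "compact Z" by (simp add: Z_def Int_def)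
  moreover have "m \<in> Z" using m by (simp add: Z_def)
  ultimately obtain a where a: "a \<in> Z" "\<And>y. y \<in> Z \<Longrightarrow> norm y \<le> norm a"
    using continuous_attains_sup[of Z norm] by (auto intro: continuous_intros)
  have "a \<in> ball 0 1" using a(1) wm out[of a] by (auto simp: Z_def)
  then have na: "norm a < 1" by simp
  define r where "r = (1 - norm a) / 2"
  have r: "r > 0" using na by (simp add: r_def)
  have sub: "cball a r \<subseteq> ball 0 1"
  proof
    fix y assume "y \<in> cball a r"
    then have "norm y \<le> norm a + r" using norm_triangle_ineq2[of y a]
        by (auto simp: dist_norm norm_minus_commute)
    then show "y \<in> ball 0 1" using na by (simp add: r_def field_simps)
  qed
  \<comment> \<open>The outward direction at a, or any basis vector if a = 0.\<close>
  obtain u :: 'a where u: "norm u = 1" "norm (a + (r / 2) *\<^sub>R u) > norm a"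
  proof (cases "a = 0")
    case True
    obtain b :: 'a where "b \<in> Basis" using nonempty_Basis by blast
    then show thesis using that[of b] True r by simp
  next
    case False
    define c where "c = r / 2 / norm a"
    have c: "c \<ge> 0" "c * norm a = r / 2" using False r by (auto simp: c_def)
    have "(r / 2) *\<^sub>R (a /\<^sub>R norm a) = c *\<^sub>R a"
      by (simp only: c_def scaleR_scaleR divide_inverse)
    then have "a + (r / 2) *\<^sub>R (a /\<^sub>R norm a) = (1 + c) *\<^sub>R a"
      by (simp only: scaleR_left_distrib scaleR_one)
    then have "norm (a + (r / 2) *\<^sub>R (a /\<^sub>R norm a)) = (1 + c) * norm a"
      using c(1) by simp
    then have "norm (a + (r / 2) *\<^sub>R (a /\<^sub>R norm a)) = norm a + r / 2"
      using c(2) by (simp only: distrib_right mult_1)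
    moreover have "norm (a /\<^sub>R norm a) = 1" using False by simp
    ultimately show thesis using r by (intro that[of "a /\<^sub>R norm a"]) linarith+
  qed
  define b where "b = a + (r / 2) *\<^sub>R u"
  have b: "b \<in> ball a r" using u r by (simp add: b_def dist_norm)
  have "w b = w a"
  proof (rule weakly_harmonic_mean_inequality[OF cont r _ _ b])
    show "w y \<le> w a" for y using max[of y] a(1) by (simp add: Z_def)
    show "(LINT x|lborel. w x * laplacian \<phi> x) = 0"
      if "smooth_on UNIV \<phi>" "\<And>x. x \<notin> cball a r \<Longrightarrow> \<phi> x = 0" for \<phi>
      by (rule weak[OF test_functionsI[OF that(1) compact_cball sub that(2)]])
  qed
  moreover have "b \<in> cball 0 1" using subsetD[OF sub, of b] b by auto
  ultimately have "b \<in> Z" using a(1) by (simp add: Z_def)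
  then show False using a(2)[of b] u(2) by (simp add: b_def)
qed

lemma test_function_support:
  assumes "\<phi> \<in> test_functions S"
  shows "\<exists>K. compact K \<and> K \<subseteq> S \<and> (\<forall>x. x \<notin> K \<longrightarrow> \<phi> x = 0 \<and> laplacian \<phi> x = 0)"
proof -
  define K where "K = closure {x. \<phi> x \<noteq> 0}"
  have K: "compact K" "K \<subseteq> S" "\<And>x. x \<notin> K \<Longrightarrow> \<phi> x = 0"
    using assms closure_subset[of "{x. \<phi> x \<noteq> 0}"] by (auto simp: test_functions_def K_def)
  moreover have "laplacian \<phi> x = 0" if "x \<notin> K" for x
    using laplacian_zero_outside[of K \<phi> x] compact_imp_closed[OF K(1)] K(3) that by blast
  ultimately show ?thesis by (intro exI[of _ K]) simp
qed

lemma set_integral_laplacian_test_function: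
  assumes "\<phi> \<in> test_functions S"
  shows "(LINT x:S|lborel. f x * laplacian \<phi> x) = (LINT x|lborel. f x * laplacian \<phi> x)"
  unfolding set_lebesgue_integral_def
proof (rule Bochner_Integration.integral_cong[OF refl])
  fix x
  obtain K where K: "K \<subseteq> S" and lap0: "\<forall>x. x \<notin> K \<longrightarrow> \<phi> x = 0 \<and> laplacian \<phi> x = 0"
    using test_function_support[OF assms] by auto
  show "indicat_real S x *\<^sub>R (f x * laplacian \<phi> x) = f x * laplacian \<phi> x"
    using K lap0 by (cases "x \<in> K") auto
qed

text \<open>The maximum principle gives one inequality for an arbitrary pair of solutions;
  exchanging them gives the other.\<close>

theorem weak_solution_unique:
  fixes u v :: "'a::euclidean_space \<Rightarrow> real"
  assumes u: "weak_solution (ball 0 1) \<Gamma> g u" and v: "weak_solution (ball 0 1) \<Gamma> g v"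
    and x: "x \<in> closure (ball 0 1)"
  shows "v x = u x"
proof -
  have nonpos: "v x - u x \<le> 0" if u: "weak_solution (ball 0 1) \<Gamma> g u" and v: "weak_solution (ball 0 1) \<Gamma> g v"
    and x: "x \<in> cball 0 1" for u v :: "'a \<Rightarrow> real" and x
  proof -
    \<comment> \<open>Both solutions vanish on the sphere, so the difference extended by 0 is
      continuous on the whole space, as the maximum principle requires.\<close>
    define w where "w x = (if x \<in> cball 0 1 then v x - u x else 0)" for x
    have cu: "continuous_on (cball 0 1) u" "continuous_on (cball 0 1) v"
      and bu: "\<And>x. norm x = 1 \<Longrightarrow> u x = 0" "\<And>x. norm x = 1 \<Longrightarrow> v x = 0"
      using u v by (auto simp: weak_solution_def)
    have "continuous_on (cball 0 1 \<union> - ball 0 1) w"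
      unfolding w_def
    proof (rule continuous_on_cases)
      show "closed (- ball 0 1 :: 'a set)" by (simp add: closed_Compl)
      show "\<forall>x. x \<in> cball 0 1 \<and> x \<notin> cball 0 1 \<or> x \<in> - ball 0 1 \<and> x \<in> cball 0 1 \<longrightarrow> v x - u x = 0"
        using bu by auto
    qed (auto intro!: continuous_intros cu)
    moreover have "cball 0 1 \<union> - ball 0 1 = (UNIV :: 'a set)" by auto
    ultimately have cw: "continuous_on UNIV w" by simp
    have wb: "w x = 0" if "x \<notin> ball 0 1" for x using that bu[of x] by (auto simp: w_def)
    have "(LINT x|lborel. w x * laplacian \<phi> x) = 0" if \<phi>: "\<phi> \<in> test_functions (ball 0 1)" for \<phi>
    proof -
      have sm: "smooth_on UNIV \<phi>" using \<phi> by (simp add: test_functions_def)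
      obtain K where K: "compact K" "K \<subseteq> ball 0 1"
        and K0: "\<forall>x. x \<notin> K \<longrightarrow> \<phi> x = 0 \<and> laplacian \<phi> x = 0"
        using test_function_support[OF \<phi>] by auto
      have lap0: "laplacian \<phi> x = 0" if "x \<notin> K" for x using K0 that by simp
      have i: "integrable lborel (\<lambda>x. f x * laplacian \<phi> x)" if "continuous_on (cball 0 1) f" for f
      proof (rule integrable_compact_support[OF K(1)])
        show "continuous_on K (\<lambda>x. f x * laplacian \<phi> x)"
          using K(2) by (intro continuous_intros continuous_on_subset[OF that]
            continuous_on_subset[OF continuous_on_laplacian[OF sm]]) auto
      qed (simp add: lap0)
      have "(LINT x|lborel. w x * laplacian \<phi> x) = (LINT x|lborel. v x * laplacian \<phi> x - u x * laplacian \<phi> x)"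
      proof (rule Bochner_Integration.integral_cong[OF refl])
        fix x
        show "w x * laplacian \<phi> x = v x * laplacian \<phi> x - u x * laplacian \<phi> x"
          using lap0[of x] K(2) by (cases "x \<in> K") (auto simp: w_def left_diff_distrib)
      qed
      also have "\<dots> = (LINT x|lborel. v x * laplacian \<phi> x) - (LINT x|lborel. u x * laplacian \<phi> x)"
        by (rule Bochner_Integration.integral_diff[OF i[OF cu(2)] i[OF cu(1)]])
      also have "(LINT x|lborel. v x * laplacian \<phi> x) = (LINT x|lborel. u x * laplacian \<phi> x)"
        using u v \<phi> set_integral_laplacian_test_function[OF \<phi>] unfolding weak_solution_def by metis
      finally show ?thesis by simp
    qed
    from weakly_harmonic_nonpos[OF cw wb this, of x] show ?thesis using x by (simp add: w_def)
  qed
  have "x \<in> cball 0 1" using x by simp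
  from nonpos[OF u v this] nonpos[OF v u this] show ?thesis by simp
qed

section \<open>Failure of the Lipschitz property\<close>

lemma exp_bump_bounded: "\<exists>E\<ge>0. \<forall>t\<le>R. \<bar>exp_bump p t\<bar> \<le> E"
proof -
  have "bounded (exp_bump p ` {0..R})"
    by (intro compact_imp_bounded compact_continuous_image continuous_on_exp_bump compact_Icc)
  then obtain E where "\<forall>z\<in>exp_bump p ` {0..R}. norm z \<le> E"
    unfolding bounded_iff by blast
  then have E: "\<bar>exp_bump p t\<bar> \<le> E" if "t \<in> {0..R}" for t using that by auto
  have "\<bar>exp_bump p t\<bar> \<le> max E 0" if "t \<le> R" for t
    using E[of t] that by (cases "t \<ge> 0") (simp_all add: le_max_iff_disj exp_bump_def)
  then show ?thesis by (intro exI[of _ "max E 0"]) auto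
qed

lemma bump_mono: "0 < s \<Longrightarrow> s \<le> t \<Longrightarrow> bump s \<le> bump t"
  by (simp add: exp_bump_def divide_left_mono)

text \<open>Half the derivative in direction c of the regularised fundamental solution, times a
  cut-off. Pairing its Laplacian with a smooth u would give, in the limit, a multiple of the
  derivative of u at 0 and terms from the cut-off.\<close>

definition dipole :: "'a::euclidean_space \<Rightarrow> real \<Rightarrow> real \<Rightarrow> 'a \<Rightarrow> real" where
  "dipole c r \<epsilon> x = (x \<bullet> c) * ((x \<bullet> x + \<epsilon>) powr (- (real DIM('a) / 2)) * bump (r\<^sup>2 - x \<bullet> x))"

lemma smooth_on_dipole:
  fixes c :: "'a::euclidean_space"
  assumes "\<epsilon> > 0"
  shows "smooth_on UNIV (dipole c r \<epsilon>)"
  unfolding dipole_def[abs_def]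
proof (intro smooth_on_mult smooth_on_inner open_UNIV)
  show "smooth_on UNIV (\<lambda>x::'a. (x \<bullet> x + \<epsilon>) powr (- (real DIM('a) / 2)))"
    by (rule smooth_on_compose_real[OF open_UNIV smooth_real_on_powr smooth_on_add[OF open_UNIV
        smooth_on_norm_square[OF open_UNIV] smooth_on_const[OF open_UNIV]]])
      (use assms in \<open>auto simp: add_nonneg_pos\<close>)
  have "smooth_on UNIV (\<lambda>x::'a. bump (r\<^sup>2 + (- 1) * (x \<bullet> x)))"
    by (rule smooth_on_compose_real[OF open_UNIV smooth_real_on_exp_bump smooth_on_add[OF open_UNIV
        smooth_on_const[OF open_UNIV] smooth_on_mult[OF open_UNIV smooth_on_const[OF open_UNIV]
        smooth_on_norm_square[OF open_UNIV]]]]) simp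
  then show "smooth_on UNIV (\<lambda>x::'a. bump (r\<^sup>2 - x \<bullet> x))" by simp
qed

lemma radius_outside: "x \<notin> cball 0 r \<Longrightarrow> r > 0 \<Longrightarrow> r\<^sup>2 - x \<bullet> (x::'a::euclidean_space) \<le> 0"
  using power_mono[of r "norm x" 2] by (simp add: dot_square_norm)

lemma dipole_outside: "x \<notin> cball 0 r \<Longrightarrow> r > 0 \<Longrightarrow> dipole c r \<epsilon> x = 0"
  using bump_simps(2)[OF radius_outside[of x r]] by (simp add: dipole_def)

lemma dipole_test_function:
  assumes "\<epsilon> > 0" "r > 0" "cball 0 r \<subseteq> S"
  shows "dipole c r \<epsilon> \<in> test_functions S"
  by (rule test_functionsI[OF smooth_on_dipole[OF assms(1)] compact_cball assms(3) dipole_outside[OF _ assms(2)]])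

text \<open>Without the cut-off the Laplacian is, up to a factor, a derivative of the approximate
  identity; weighted by norm x it is bounded by a multiple of \<open>approx_kernel\<close>, whose
  mass does not depend on \<epsilon>. Terms with derivatives of the cut-off, weighted likewise, are
  at most a multiple of |x|^(2-n), which is locally integrable. The radius 2 r provides an open ball
  around the support.\<close>

lemma dipole_laplacian_bound:
  fixes c :: "'a::euclidean_space"
  assumes r: "r > 0" and c: "norm c = 1"
  shows "\<exists>D\<ge>0. \<forall>\<epsilon> x. 0 < \<epsilon> \<longrightarrow> norm x * \<bar>laplacian (dipole c r \<epsilon>) x\<bar> \<le>
    real DIM('a) * (real DIM('a) + 2) * approx_kernel \<epsilon> x +
    D * (indicator (ball 0 (2 * r)) x * dist 0 x powr (- (real DIM('a) - 2)))"
proof -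
  let ?n = "real DIM('a)"
  \<comment> \<open>\<open>exp_bump q2\<close> is the second derivative of
    \<open>bump\<close>.\<close>
  define q2 :: "real poly" where "q2 = [:0, 0, 1:] * (([:0, 0, 1:] * (1 - pderiv 1))
      - pderiv ([:0, 0, 1:] * (1 - pderiv 1)))"
  obtain E1 where E1: "E1 \<ge> 0" "\<And>t. t \<le> r\<^sup>2 \<Longrightarrow> \<bar>bump' t\<bar> \<le> E1" using exp_bump_bounded by metis
  obtain E2 where E2: "E2 \<ge> 0" "\<And>t. t \<le> r\<^sup>2 \<Longrightarrow> \<bar>exp_bump q2 t\<bar> \<le> E2" using exp_bump_bounded by metis
  \<comment> \<open>With s = |x|^2 <= t = s + \<epsilon>, the factor of the first derivative of the
    cut-off satisfies 4 n s + (2 n + 4) t <= (6 n + 4) t, and that of the second satisfies 4 s <= 4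
    r^2.\<close>
  define D where "D = (6 * ?n + 4) * E1 + 4 * r\<^sup>2 * E2"
  have D0: "D \<ge> 0" using E1 E2 by (auto simp: D_def)
  have bound: "norm x * \<bar>laplacian (dipole c r \<epsilon>) x\<bar> \<le> ?n * (?n + 2) * approx_kernel \<epsilon> x +
    D * (indicator (ball 0 (2 * r)) x * dist 0 x powr (- (?n - 2)))" if \<epsilon>: "\<epsilon> > 0" for \<epsilon> and x :: 'a
  proof -
    define p where "p s = (s + \<epsilon>) powr (- (?n / 2)) * bump (r\<^sup>2 - s)" for s
    define p' where "p' s = - (?n / 2) * (s + \<epsilon>) powr (- (?n / 2) - 1) * bump (r\<^sup>2 - s) -
        (s + \<epsilon>) powr (- (?n / 2)) * bump' (r\<^sup>2 - s)" for s
    define p2 where "p2 s = ?n / 2 * (?n / 2 + 1) * (s + \<epsilon>) powr (- (?n / 2) - 1 - 1) * bump (r\<^sup>2 - s) +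
        ?n * (s + \<epsilon>) powr (- (?n / 2) - 1) * bump' (r\<^sup>2 - s) + (s + \<epsilon>) powr (- (?n / 2)) * exp_bump q2 (r\<^sup>2
            - s)" for s
    have minus: "((\<lambda>s. r\<^sup>2 - s) has_real_derivative - 1) (at s)" for s
      by (auto intro!: derivative_eq_intros)
    have b1: "((\<lambda>s. bump (r\<^sup>2 - s)) has_real_derivative - bump' (r\<^sup>2 - s)) (at s)" for s
      using DERIV_chain2[OF exp_bump_has_derivative[of 1] minus] by simp
    have b2: "((\<lambda>s. bump' (r\<^sup>2 - s)) has_real_derivative - exp_bump q2 (r\<^sup>2 - s)) (at s)" for s
      using DERIV_chain2[OF exp_bump_has_derivative[of "[:0, 0, 1:] * (1 - pderiv 1)"] minus]
      by (simp add: q2_def)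
    have pw: "((\<lambda>s. (s + \<epsilon>) powr a) has_real_derivative a * (s + \<epsilon>) powr (a - 1)) (at s)" if "s > - \<epsilon>" for s a
      using that by (auto intro!: derivative_eq_intros)
    have pd: "(p has_real_derivative p' s) (at s)" if "s > - \<epsilon>" for s
      unfolding p_def p'_def
      by (rule DERIV_cong[OF DERIV_mult[OF pw[OF that] b1]]) (simp add: algebra_simps)
    have pd2: "(p' has_real_derivative p2 s) (at s)" if "s > - \<epsilon>" for s
      using DERIV_diff[OF DERIV_cmult[OF DERIV_mult[OF pw[OF that, of "- (?n / 2) - 1"] b1], of "- (?n / 2)"]
         DERIV_mult[OF pw[OF that, of "- (?n / 2)"] b2]]
      unfolding p2_def p'_def by (simp add: algebra_simps)
    let ?s = "x \<bullet> x"
    have s0: "?s \<ge> 0" by simp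
    define t where "t = ?s + \<epsilon>"
    have t: "t > 0" "?s \<le> t" "t - ?s = \<epsilon>" using s0 \<epsilon> by (auto simp: t_def intro: add_nonneg_pos)
    \<comment> \<open>With the lowest power of t factored out, the remaining powers are t P and t t
      P, and the decisive cancellation t - s = \<epsilon> becomes polynomial algebra.\<close>
    define P where "P = t powr (- (?n / 2) - 1 - 1)"
    have shift: "t powr b = t * t powr (b - 1)" for b using t by (simp add: powr_diff)
    have P: "t powr (- (?n / 2) - 1) = t * P" "t powr (- (?n / 2)) = t * t * P" "P \<ge> 0"
      unfolding P_def using shift[of "- (?n / 2)"] shift[of "- (?n / 2) - 1"]
          by (simp_all only: mult.assoc powr_ge_zero)
    define e e1 e2 where "e = bump (r\<^sup>2 - ?s)" and "e1 = bump' (r\<^sup>2 - ?s)" and "e2 = exp_bump q2 (r\<^sup>2 - ?s)"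
    have e: "0 \<le> e" "e \<le> 1" "\<bar>e1\<bar> \<le> E1" "\<bar>e2\<bar> \<le> E2"
      using E1(2)[of "r\<^sup>2 - ?s"] E2(2)[of "r\<^sup>2 - ?s"] s0 bump_simps(1,4) by (auto simp: e_def e1_def e2_def)
    have "laplacian (dipole c r \<epsilon>) x = (x \<bullet> c) * (4 * ?s * p2 ?s + (2 * ?n + 4) * p' ?s)"
      unfolding dipole_def[abs_def] p_def[symmetric]
      by (rule laplacian_linear_times_radial[of "{- \<epsilon><..}"])
        (use pd pd2 \<epsilon> in \<open>auto intro: less_le_trans[OF _ inner_ge_zero]\<close>)
    also have "4 * ?s * p2 ?s + (2 * ?n + 4) * p' ?s =
        - (?n * (?n + 2) * \<epsilon> * P * e) + (4 * ?n * ?s * (t * P) - (2 * ?n + 4) * (t * t * P)) * e1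
            + 4 * ?s * (t * t * P) * e2"
    proof -
      have p2s: "p2 ?s = ?n / 2 * (?n / 2 + 1) * P * e + ?n * (t * P) * e1 + t * t * P * e2"
        by (simp only: p2_def t_def[symmetric] e_def e1_def e2_def P_def[symmetric] P(1,2))
      have p's: "p' ?s = - (?n / 2) * (t * P) * e - t * t * P * e1"
        by (simp only: p'_def t_def[symmetric] e_def e1_def e2_def P(1,2))
      show ?thesis unfolding p2s p's t(3)[symmetric] by (simp add: field_simps)
    qed
    finally have lap: "laplacian (dipole c r \<epsilon>) x = (x \<bullet> c) * (- (?n * (?n + 2) * \<epsilon> * P * e) +
        (4 * ?n * ?s * (t * P) - (2 * ?n + 4) * (t * t * P)) * e1 + 4 * ?s * (t * t * P) * e2)" .
    show ?thesis
    proof (cases "x \<in> cball 0 r")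
      case False
      then have z: "r\<^sup>2 - ?s \<le> 0" using r radius_outside by blast
      then have "e = 0" "e1 = 0" "e2 = 0" by (auto simp: e_def e1_def e2_def exp_bump_def)
      then show ?thesis unfolding lap using D0 \<epsilon> by (simp add: approx_kernel_nonneg)
    next
      case True
      have "(norm x)\<^sup>2 \<le> r\<^sup>2" using True by (intro power_mono) auto
      then have sr: "?s \<le> r\<^sup>2" by (simp add: dot_square_norm)
      have st: "?s * (t * t * P) \<le> dist 0 x powr (- (?n - 2))"
      proof (cases "x = 0")
        case False
        then have "?s > 0" by simp
        then have "?s * t powr (- (?n / 2)) \<le> ?s * ?s powr (- (?n / 2))"
          using t by (intro mult_left_mono powr_mono2') auto
        also have "\<dots> = ?s powr (1 - ?n / 2)" using powr_add[of ?s 1 "- (?n / 2)"] \<open>?s > 0\<close> by simp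
        also have "\<dots> = (norm x powr 2) powr (1 - ?n / 2)" using False by (simp add: dot_square_norm)
        also have "\<dots> = norm x powr (2 * (1 - ?n / 2))" by (simp only: powr_powr)
        finally show ?thesis by (simp add: P algebra_simps)
      qed simp
      have "\<bar>x \<bullet> c\<bar> \<le> norm x" using Cauchy_Schwarz_ineq2[of x c] c by simp
      moreover have "\<bar>- (?n * (?n + 2) * \<epsilon> * P * e) + (4 * ?n * ?s * (t * P) - (2 * ?n
          + 4) * (t * t * P)) * e1 + 4 * ?s * (t * t * P) * e2\<bar>
         \<le> ?n * (?n + 2) * \<epsilon> * P + (6 * ?n + 4) * (t * t * P) * E1 + 4 * r\<^sup>2 * (t * t * P) * E2"
      proof -
        have "\<bar>- (?n * (?n + 2) * \<epsilon> * P * e)\<bar> \<le> ?n * (?n + 2) * \<epsilon> * P"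
          using e P \<epsilon> mult_left_mono[of e 1 "?n * (?n + 2) * \<epsilon> * P"] by (simp add: abs_mult)
        moreover have "\<bar>(4 * ?n * ?s * (t * P) - (2 * ?n + 4) * (t * t * P)) * e1\<bar> \<le> (6 * ?n
            + 4) * (t * t * P) * E1"
          unfolding abs_mult
        proof (rule mult_mono)
          have "4 * ?n * ?s * (t * P) \<le> 4 * ?n * t * (t * P)"
            using t P by (intro mult_right_mono mult_left_mono) auto
          moreover have "0 \<le> 4 * ?n * ?s * (t * P)" "0 \<le> ?n * (t * t * P)" "0 \<le> t * t * P" using t P by auto
          ultimately show "\<bar>4 * ?n * ?s * (t * P) - (2 * ?n + 4) * (t * t * P)\<bar> \<le> (6 * ?n + 4) * (t * t * P)"
            unfolding abs_le_iff by (simp add: algebra_simps)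
        qed (use e E1 t P in auto)
        moreover have "\<bar>4 * ?s * (t * t * P) * e2\<bar> \<le> 4 * r\<^sup>2 * (t * t * P) * E2"
          unfolding abs_mult using sr e t P by (intro mult_mono) auto
        ultimately show ?thesis by linarith
      qed
      ultimately have "\<bar>laplacian (dipole c r \<epsilon>) x\<bar> \<le> norm x *
          (?n * (?n + 2) * \<epsilon> * P + (6 * ?n + 4) * (t * t * P) * E1 + 4 * r\<^sup>2 * (t * t * P) * E2)"
        unfolding lap abs_mult by (intro mult_mono) auto
      then have "norm x * \<bar>laplacian (dipole c r \<epsilon>) x\<bar> \<le> norm x * (norm x *
          (?n * (?n + 2) * \<epsilon> * P + (6 * ?n + 4) * (t * t * P) * E1 + 4 * r\<^sup>2 * (t * t * P) * E2))"
        by (intro mult_left_mono) auto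
      also have "\<dots> = ?s * (?n * (?n + 2) * \<epsilon> * P + (6 * ?n + 4) * (t * t * P) * E1
          + 4 * r\<^sup>2 * (t * t * P) * E2)"
        by (simp add: dot_square_norm power2_eq_square mult.assoc)
      also have "\<dots> = ?n * (?n + 2) * \<epsilon> * (?s * P) + D * (?s * (t * t * P))"
        by (simp add: D_def algebra_simps)
      also have "\<dots> \<le> ?n * (?n + 2) * \<epsilon> * (t * P) + D * dist 0 x powr (- (?n - 2))"
        using t P \<epsilon> D0 st by (intro add_mono mult_left_mono mult_right_mono) auto
      also have "?n * (?n + 2) * \<epsilon> * (t * P) = ?n * (?n + 2) * approx_kernel \<epsilon> x"
        by (simp add: approx_kernel_def t_def[symmetric] P)
      finally show ?thesis using True r by simp
    qed
  qed
  then show ?thesis using D0 by blast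
qed

lemma dipole_integral_bound:
  fixes u :: "'a::euclidean_space \<Rightarrow> real" and c :: 'a
  assumes n: "DIM('a) \<ge> 2" and r: "r > 0" and c: "norm c = 1" and lip: "L-lipschitz_on (cball 0 r) u"
  shows "\<exists>B. \<forall>\<epsilon>>0. \<bar>LINT x|lborel. u x * laplacian (dipole c r \<epsilon>) x\<bar> \<le> B"
proof -
  let ?n = "real DIM('a)" and ?K = "cball 0 r"
  have L: "L \<ge> 0" using lipschitz_on_nonneg[OF lip] .
  have contu: "continuous_on ?K u" using lipschitz_on_continuous_on[OF lip] .
  obtain D where D: "D \<ge> 0" "\<And>\<epsilon> x. 0 < \<epsilon> \<Longrightarrow> norm x * \<bar>laplacian (dipole c r \<epsilon>) x\<bar> \<le>
      ?n * (?n + 2) * approx_kernel \<epsilon> x + D * (indicator (ball 0 (2 * r)) x * dist 0 x powr (- (?n - 2)))"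
    using dipole_laplacian_bound[OF r c] by blast
  define J where "J x = indicator (ball 0 (2 * r)) x * dist 0 x powr (- (?n - 2))" for x :: 'a
  have iJ: "integrable lborel J"
  proof (rule integrableI_bounded)
    have [measurable]: "ball (0::'a) (2 * r) \<in> sets borel" by simp
    show "J \<in> borel_measurable lborel" unfolding J_def by measurable
    have "(\<integral>\<^sup>+x. ennreal (norm (J x)) \<partial>lborel)
        = (\<integral>\<^sup>+x. ennreal (indicator (ball 0 (2 * r)) (x::'a) * dist 0 x powr (- (?n - 2))) \<partial>lborel)"
      by (simp add: J_def)
    \<comment> \<open>The Riesz bound for Lebesgue measure with d = n and a = n - 2; here n >= 2
      makes a nonnegative.\<close>
    also have "\<dots> \<le> ennreal (unit_ball_vol ?n * (2 powr (?n - 2) / (1 - 2 powr (?n - 2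
        - ?n))) * (2 * r) powr (?n - (?n - 2)))"
      by (rule nn_integral_riesz_kernel_le) (use n r in \<open>auto simp: emeasure_ball\<close>)
    finally show "(\<integral>\<^sup>+x. ennreal (norm (J x)) \<partial>lborel) < \<infinity>"
      using le_less_trans by fastforce
  qed
  have "\<bar>LINT x|lborel. u x * laplacian (dipole c r \<epsilon>) x\<bar> \<le>
      L * (?n * (?n + 2) * kernel_mass TYPE('a) + D * (LINT x|lborel. J x))" if \<epsilon>: "\<epsilon> > 0" for \<epsilon>
  proof -
    let ?l = "laplacian (dipole c r \<epsilon>)"
    have sm: "smooth_on UNIV (dipole c r \<epsilon>)" using \<epsilon> by (rule smooth_on_dipole)
    have z: "?l x = 0" if "x \<notin> ?K" for x
      using laplacian_zero_outside[of ?K "dipole c r \<epsilon>" x] dipole_outside[OF _ r] that by blast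
    have cl: "continuous_on ?K ?l" using continuous_on_subset[OF continuous_on_laplacian[OF sm] subset_UNIV] .
    have i1: "integrable lborel ?l" using compact_cball cl z by (rule integrable_compact_support)
    have i2: "integrable lborel (\<lambda>x. u x * ?l x)"
      by (rule integrable_compact_support[OF compact_cball]) (auto intro!: continuous_intros contu cl simp: z)
    have iK: "integrable lborel (\<lambda>x::'a. approx_kernel \<epsilon> x)"
        using integrable_approx_kernel[OF \<epsilon>, of "0::'a"] by simp
    have K1: "(LINT x|lborel. approx_kernel \<epsilon> (x::'a)) = kernel_mass TYPE('a)"
      using integral_approx_kernel[OF \<epsilon>, of "0::'a"] by simp
    have "(LINT x|lborel. ?l x) = 0"
      using sm compact_cball dipole_outside[OF _ r] by (rule integral_laplacian_compact_support)
    then have "(LINT x|lborel. u x * ?l x) = (LINT x|lborel. u x * ?l x - u 0 * ?l x)"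
      using i1 i2 by (simp add: Bochner_Integration.integral_diff)
    then have "\<bar>LINT x|lborel. u x * ?l x\<bar> \<le> (LINT x|lborel. \<bar>u x * ?l x - u 0 * ?l x\<bar>)"
      using integral_abs_bound by metis
    also have "\<dots> \<le> (LINT x|lborel. L * (?n * (?n + 2) * approx_kernel \<epsilon> x + D * J x))"
    proof (intro integral_mono integrable_abs Bochner_Integration.integrable_diff i2 integrable_mult_right i1
        Bochner_Integration.integrable_add iK iJ)
      fix x
      show "\<bar>u x * ?l x - u 0 * ?l x\<bar> \<le> L * (?n * (?n + 2) * approx_kernel \<epsilon> x + D * J x)"
      proof (cases "x \<in> ?K")
        case True
        have "\<bar>u x - u 0\<bar> \<le> L * norm x"
          using lipschitz_onD[OF lip True, of 0] r by (simp add: dist_real_def)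
        then have "\<bar>u x - u 0\<bar> * \<bar>?l x\<bar> \<le> L * norm x * \<bar>?l x\<bar>" by (rule mult_right_mono) simp
        also have "\<dots> \<le> L * (?n * (?n + 2) * approx_kernel \<epsilon> x + D * J x)"
          using mult_left_mono[OF D(2)[OF \<epsilon>, of x] L] by (simp add: J_def mult.assoc)
        finally show ?thesis by (simp add: left_diff_distrib[symmetric] abs_mult)
      next
        case False
        then show ?thesis using z[OF False] L D(1) \<epsilon> by (simp add: J_def approx_kernel_nonneg)
      qed
    qed
    also have "\<dots> = L * (?n * (?n + 2) * kernel_mass TYPE('a) + D * (LINT x|lborel. J x))"
      using iK iJ by (simp add: Bochner_Integration.integral_add K1)
    finally show ?thesis .
  qed
  then show ?thesis by blast
qed

text \<open>A flat box in the hyperplane orthogonal to bN. As 3/4 > 1/2, the boxes with t = 2^-k are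
  disjoint, while the coordinate along b1 stays comparable to t.\<close>

definition dyadic_box :: "'a::euclidean_space \<Rightarrow> 'a \<Rightarrow> real \<Rightarrow> 'a set" where
  "dyadic_box b1 bN t = cbox (\<Sum>b\<in>Basis. (if b = bN then 0 else if b = b1 then 3 / 4 * t else - t) *\<^sub>R b)
     (\<Sum>b\<in>Basis. (if b = bN then 0 else t) *\<^sub>R b)"

lemma mem_dyadic_box:
  assumes "b1 \<in> Basis" "bN \<in> Basis" "b1 \<noteq> bN"
  shows "x \<in> dyadic_box b1 bN t \<longleftrightarrow> x \<bullet> bN = 0 \<and> 3 / 4 * t \<le> x \<bullet> b1 \<and> x \<bullet> b1 \<le> t \<and>
    (\<forall>b\<in>Basis - {b1, bN}. - t \<le> x \<bullet> b \<and> x \<bullet> b \<le> t)"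
  using assms by (auto simp: dyadic_box_def mem_box)

lemma dyadic_box_hausdorff:
  fixes b1 bN :: "'a::euclidean_space"
  assumes b: "b1 \<in> Basis" "bN \<in> Basis" "b1 \<noteq> bN"
  shows "\<exists>c>0. \<forall>t>0. ennreal (c * t ^ (DIM('a) - 1)) \<le> hausdorff_outer (DIM('a) - 1) (dyadic_box b1 bN t)"
proof -
  let ?d = "DIM('a) - 1"
  \<comment> \<open>The constant of the prism estimate times the volume of the prism of height 1
    over the box with t = 1: side 1/4 along b1 and side 2 in the other n - 2 directions.\<close>
  define c where "c = unit_ball_vol (real ?d) / 4 ^ ?d * (2 ^ (DIM('a) - 2) / 4)"
  have card: "card (Basis - {b1, bN} :: 'a set) = DIM('a) - 2" "DIM('a) \<ge> 2"
    using b card_mono[of "Basis :: 'a set" "{b1, bN}"] by (auto simp: card_Diff_subset)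
  have "ennreal (c * t ^ ?d) \<le> hausdorff_outer ?d (dyadic_box b1 bN t)" if t: "t > 0" for t
  proof -
    define lo hi :: 'a where "lo = (\<Sum>b\<in>Basis. (if b = bN then 0 else if b = b1 then 3 / 4 * t else - t) *\<^sub>R b)"
      and "hi = (\<Sum>b\<in>Basis. (if b = bN then 1 else t) *\<^sub>R b)"
    have "ennreal (unit_ball_vol (real ?d) / 4 ^ ?d) * emeasure lborel (cbox lo hi)
        \<le> hausdorff_outer ?d (dyadic_box b1 bN t)"
    proof (rule emeasure_prism_le_hausdorff_outer[OF b(2)])
      show "dyadic_box b1 bN t \<subseteq> {x. x \<bullet> bN = 0}" by (auto simp: mem_dyadic_box[OF b])
      show "cbox lo hi \<subseteq> {x + s *\<^sub>R bN |x s. x \<in> dyadic_box b1 bN t \<and> 0 \<le> s \<and> s \<le> 1}"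
      proof
        fix z assume z: "z \<in> cbox lo hi"
        define x where "x = z - (z \<bullet> bN) *\<^sub>R bN"
        have "x \<bullet> bN = 0" using b by (simp add: x_def inner_diff_left)
        moreover have "x \<bullet> b' = z \<bullet> b'" if "b' \<in> Basis" "b' \<noteq> bN" for b'
          using that b by (simp add: x_def inner_diff_left inner_not_same_Basis)
        ultimately have "x \<in> dyadic_box b1 bN t"
          using z b by (auto simp: mem_dyadic_box[OF b] mem_box lo_def hi_def)
        moreover have "0 \<le> z \<bullet> bN" "z \<bullet> bN \<le> 1" using z b by (auto simp: mem_box lo_def hi_def)
        moreover have "z = x + (z \<bullet> bN) *\<^sub>R bN" by (simp add: x_def)
        ultimately show "z \<in> {x + s *\<^sub>R bN |x s. x \<in> dyadic_box b1 bN t \<and> 0 \<le> s \<and> s \<le> 1}" by blast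
      qed
    qed
    also have "emeasure lborel (cbox lo hi) = ennreal (\<Prod>b\<in>Basis. (hi - lo) \<bullet> b)"
      using t by (intro emeasure_lborel_cbox) (auto simp: lo_def hi_def)
    also have "(\<Prod>b\<in>Basis. (hi - lo) \<bullet> b) = (\<Prod>b\<in>insert bN (insert b1 (Basis - {b1, bN})). (hi - lo) \<bullet> b)"
      using b by (intro prod.cong) auto
    also have "\<dots> = ((hi - lo) \<bullet> bN) * (((hi - lo) \<bullet> b1) * (\<Prod>b\<in>Basis - {b1, bN}. (hi - lo) \<bullet> b))"
      using b by (subst prod.insert, simp, simp, subst prod.insert) auto
    also have "(\<Prod>b\<in>Basis - {b1, bN}. (hi - lo) \<bullet> b) = (\<Prod>b\<in>Basis - {b1, bN}. 2 * t)"
      by (intro prod.cong) (auto simp: lo_def hi_def inner_diff_left)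
    also have "\<dots> = (2 * t) ^ (DIM('a) - 2)" by (simp add: card)
    also have "(hi - lo) \<bullet> bN = 1" using b by (simp add: lo_def hi_def inner_diff_left)
    also have "(hi - lo) \<bullet> b1 = t / 4" using b by (simp add: lo_def hi_def inner_diff_left)
    also have "ennreal (unit_ball_vol (real ?d) / 4 ^ ?d) * ennreal (1 * (t / 4 * (2 * t) ^ (DIM('a) - 2))) =
        ennreal (unit_ball_vol (real ?d) / 4 ^ ?d * (1 * (t / 4 * (2 * t) ^ (DIM('a) - 2))))"
      using t by (intro ennreal_mult[symmetric] divide_nonneg_pos unit_ball_vol_nonneg) auto
    also have "unit_ball_vol (real ?d) / 4 ^ ?d * (1 * (t / 4 * (2 * t) ^ (DIM('a) - 2))) = c * t ^ ?d"
    proof -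
      have "?d = Suc (DIM('a) - 2)" using card(2) by simp
      then have "t ^ ?d = t * t ^ (DIM('a) - 2)" by simp
      then show ?thesis unfolding c_def power_mult_distrib by (simp only: mult_1_left divide_inverse mult_ac)
    qed
    finally show ?thesis .
  qed
  moreover have "c > 0" unfolding c_def using unit_ball_vol_pos[of "real ?d"]
      by (intro mult_pos_pos divide_pos_pos) auto
  ultimately show ?thesis by blast
qed

lemma dyadic_box_norm:
  fixes b1 bN :: "'a::euclidean_space"
  assumes b: "b1 \<in> Basis" "bN \<in> Basis" "b1 \<noteq> bN" and t: "t > 0" and y: "y \<in> dyadic_box b1 bN t"
  shows "y \<bullet> y \<le> real DIM('a) * t\<^sup>2"
proof -
  have "- t \<le> y \<bullet> b \<and> y \<bullet> b \<le> t" if "b \<in> Basis" for b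
    using y that t unfolding mem_dyadic_box[OF b] by (cases "b = bN"; cases "b = b1") auto
  then have "\<bar>y \<bullet> b\<bar> \<le> t" if "b \<in> Basis" for b
    using that unfolding abs_le_iff by (simp add: minus_le_iff)
  then have "(y \<bullet> b)\<^sup>2 \<le> t\<^sup>2" if "b \<in> Basis" for b
    using that t by (simp add: abs_le_square_iff[symmetric])
  then have "(\<Sum>b\<in>Basis. (y \<bullet> b)\<^sup>2) \<le> (\<Sum>b\<in>(Basis::'a set). t\<^sup>2)" by (intro sum_mono) auto
  then show ?thesis by (simp add: inner_square_sum)
qed

section \<open>The surface density\<close>

lemma smooth_on_subset_imp_continuous_on:
  assumes "smooth_on_subset A f"
  shows "continuous_on A f"
  unfolding continuous_on_eq_continuous_within
proof
  fix x assume x: "x \<in> A"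
  obtain U F where U: "open U" "x \<in> U" "smooth_on U F" "\<forall>y\<in>A \<inter> U. F y = f y"
    using assms x unfolding smooth_on_subset_def by blast
  have "isCont F x"
    using smooth_on_imp_continuous_on[OF U(3)] U(1,2) by (simp add: continuous_on_eq_continuous_at)
  then have "(F \<longlongrightarrow> F x) (at x within A)"
    by (simp add: isCont_def Lim_at_imp_Lim_at_within)
  moreover have "eventually (\<lambda>y. F y = f y) (at x within A)"
    using U unfolding eventually_at_topological by (intro exI[of _ U]) simp
  ultimately have "(f \<longlongrightarrow> F x) (at x within A)"
    by (rule Lim_transform_eventually)
  moreover have "F x = f x" using U(2,4) x by blast
  ultimately show "continuous (at x within A) f" by (simp add: continuous_within)
qed

lemma borel_measurable_eta [measurable]: "eta \<in> borel_measurable borel"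
  unfolding eta_def[abs_def] by measurable

lemma eta_nonneg: "0 \<le> eta t" by (simp add: eta_def)

lemma eta_le:
  assumes "t < 1/2"
  shows "eta t \<le> 1 / ln 2"
proof (cases "0 < t")
  case True
  have "ln t \<le> ln (1/2)" using True assms by (intro ln_mono) auto
  then have "ln 2 \<le> \<bar>ln t\<bar>" by (simp add: ln_div)
  then show ?thesis using True by (simp add: eta_def frac_le)
qed (simp add: eta_def)

text \<open>The lower bound on t gives - ln t <= k ln 2 + ln (4/3) <= k + 1, and t < 1 makes - ln t
  the absolute value.\<close>

lemma eta_dyadic:
  assumes "3 / 4 * (1/2) ^ k \<le> t" "t < 1"
  shows "1 / (real k + 1) \<le> eta t"
proof -
  have p: "0 < 3 / 4 * (1/2 :: real) ^ k" by simp
  with assms have t: "0 < t" by linarith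
  have "ln (3 / 4 * (1/2) ^ k) \<le> ln t" using assms p by (intro ln_mono)
  moreover have "ln (3 / 4 * (1/2) ^ k) = ln (3 / 4) - real k * ln 2"
    by (simp add: ln_mult ln_realpow ln_div)
  moreover have "ln (3 / 4 :: real) \<ge> - 1"
    using ln_le_minus_one[of "4 / 3"] by (simp add: ln_div)
  moreover have "real k * ln 2 \<le> real k"
    using ln_le_minus_one[of 2] by (simp add: mult_left_le)
  ultimately have "- ln t \<le> real k + 1" by linarith
  moreover have "ln t < 0" using t assms by simp
  ultimately have "1 / (real k + 1) \<le> 1 / \<bar>ln t\<bar>" by (intro frac_le) auto
  then show ?thesis using t by (simp add: eta_def)
qed

lemma lebesgue_integral_density_indicator:
  fixes f :: "'a \<Rightarrow> real"
  assumes "A \<in> sets M" "f \<in> borel_measurable M"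
  shows "(LINT x|density M (\<lambda>x. ennreal (indicator A x)). f x) = (LINT x:A|M. f x)"
  unfolding set_lebesgue_integral_def using assms by (subst integral_density) auto

lemma emeasure_density_indicator:
  assumes "A \<in> sets M" "B \<in> sets M"
  shows "emeasure (density M (\<lambda>x. ennreal (indicator A x))) B = emeasure M (A \<inter> B)"
proof -
  have "emeasure (density M (\<lambda>x. ennreal (indicator A x))) B
      = (\<integral>\<^sup>+x. ennreal (indicator A x) * indicator B x \<partial>M)"
    using assms by (intro emeasure_density) auto
  also have "\<dots> = (\<integral>\<^sup>+x. indicator (A \<inter> B) x \<partial>M)"
    by (intro nn_integral_cong) (auto split: split_indicator)
  finally show ?thesis using assms by simp
qed

text \<open>The pairing of \<open>g\<close> with the dipole is bounded below by a harmonic sum, one summand for each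
  dyadic box, and above by the Lipschitz constant of the weak solution.\<close>

theorem weak_solution_not_lipschitz:
  fixes \<Gamma> :: "'a::euclidean_space set" and b1 bN :: 'a
  assumes b: "b1 \<in> Basis" "bN \<in> Basis" "b1 \<noteq> bN"
    and \<Gamma>: "\<Gamma> \<in> sets borel" and fin: "emeasure (hausdorff_measure (DIM('a) - 1)) \<Gamma> < \<infinity>"
    and flat: "\<Gamma> \<inter> ball 0 (1/2) = {x. x \<bullet> bN = 0} \<inter> ball 0 (1/2)"
    and geta: "\<And>x. x \<in> \<Gamma> \<inter> ball 0 (1/2) \<Longrightarrow> g x = eta (x \<bullet> b1)"
    and u: "weak_solution (ball 0 1) \<Gamma> g u"
  shows "\<not> locally_lipschitz_on (ball 0 1) u"
proof
  assume "locally_lipschitz_on (ball 0 1) u"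
  then obtain e L where e: "e > 0" "L-lipschitz_on (ball 0 e \<inter> ball 0 1) u"
    unfolding locally_lipschitz_on_def by (metis centre_in_ball zero_less_one)
  let ?n = "real DIM('a)" and ?d = "DIM('a) - 1" and ?H = "hausdorff_measure (DIM('a) - 1) :: 'a measure"
  have n2: "DIM('a) \<ge> 2" using b card_mono[of "Basis :: 'a set" "{b1, bN}"] by auto
  \<comment> \<open>e / 2 places the support of the dipole where u is Lipschitz, 1 / 4 places it
    where \<Gamma> is flat.\<close>
  define r where "r = min (e / 2) (1 / 4)"
  have r: "r > 0" "r \<le> 1/4" "r < e" using e by (auto simp: r_def)
  have r2: "r\<^sup>2 > 0" using r by simp
  have cb: "cball 0 r \<subseteq> ball 0 e \<inter> ball (0::'a) 1" "cball 0 r \<subseteq> ball (0::'a) 1" using r by auto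
  obtain B where B: "\<And>\<epsilon>. \<epsilon> > 0 \<Longrightarrow> \<bar>LINT x|lborel. u x * laplacian (dipole b1 r \<epsilon>) x\<bar> \<le> B"
    using dipole_integral_bound[OF n2 r(1) norm_Basis[OF b(1)] lipschitz_on_subset[OF e(2) cb(1)]] by blast
  obtain c where c: "c > 0" "\<And>t. t > 0 \<Longrightarrow> ennreal (c * t ^ ?d) \<le> hausdorff_outer ?d (dyadic_box b1 bN t)"
    using dyadic_box_hausdorff[OF b] by blast
  \<comment> \<open>From index k0 on the boxes lie in |y|^2 <= r^2 / 2, where the cut-off is at
    least bump (r^2 / 2).\<close>
  obtain k0 :: nat where k0: "?n * ((1/4) ^ k0) \<le> r\<^sup>2 / 2"
  proof -
    obtain k0 where "(1/4 :: real) ^ k0 < r\<^sup>2 / (2 * ?n)"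
      using real_arch_pow_inv[of "r\<^sup>2 / (2 * ?n)" "1/4"] r2 by auto
    then show thesis by (intro that[of k0]) (simp add: field_simps)
  qed
  define t where "t k = (1/2 :: real) ^ k" for k
  have t: "t k > 0" "(t k)\<^sup>2 = (1/4) ^ k" for k
    by (simp_all add: t_def power_mult[symmetric] mult.commute power2_eq_square flip: power_mult_distrib)
  define A where "A k = dyadic_box b1 bN (t k)" for k
  have A_norm: "y \<bullet> y \<le> ?n * (t k)\<^sup>2" if "y \<in> A k" for y k
    using dyadic_box_norm[OF b t(1)] that by (simp add: A_def)
  have A_small: "y \<bullet> y \<le> r\<^sup>2 / 2" if "y \<in> A k" "k \<ge> k0" for y k
  proof -
    have "(1/4 :: real) ^ k \<le> (1/4) ^ k0" using that(2) by (intro power_decreasing) auto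
    then have "?n * (t k)\<^sup>2 \<le> ?n * (1/4) ^ k0" unfolding t by (rule mult_left_mono) simp
    then show ?thesis using A_norm[OF that(1)] k0 by linarith
  qed
  have in_ball: "y \<in> ball 0 (1/2)" if "y \<bullet> y \<le> r\<^sup>2" for y :: 'a
  proof -
    have "norm y \<le> r" using that r by (simp add: dot_square_norm abs_le_square_iff[symmetric])
    then show ?thesis using r by simp
  qed
  have A_sub: "A k \<subseteq> \<Gamma>" if "k \<ge> k0" for k
  proof
    fix y assume y: "y \<in> A k"
    have "y \<bullet> y \<le> r\<^sup>2" using A_small[OF y that] r2 by linarith
    then have "y \<in> ball 0 (1/2)" by (rule in_ball)
    moreover have "y \<bullet> bN = 0" using y by (simp add: A_def mem_dyadic_box[OF b])
    ultimately show "y \<in> \<Gamma>" using flat by blast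
  qed
  have A_meas [measurable]: "A k \<in> sets borel" for k by (simp add: A_def dyadic_box_def)
  have A_fin: "emeasure ?H (A k) < \<infinity>" if "k \<ge> k0" for k
    using emeasure_mono[OF A_sub[OF that], of ?H] \<Gamma> fin by (auto intro: le_less_trans)
  have A_low: "c * t k ^ ?d \<le> measure ?H (A k)" if "k \<ge> k0" for k
  proof -
    have "ennreal (c * t k ^ ?d) \<le> emeasure ?H (A k)"
      using c(2)[OF t(1), of k] unfolding A_def[symmetric] emeasure_hausdorff_measure[OF A_meas] .
    also have "\<dots> = ennreal (measure ?H (A k))"
      using A_fin[OF that] by (simp add: emeasure_eq_ennreal_measure less_top)
    finally show ?thesis by (simp only: ennreal_le_iff[OF measure_nonneg])
  qed
  \<comment> \<open>Lower bound for the dipole on the k-th box apart from powers of t k: 3/4 from y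
    \<bullet> b1 >= 3/4 t k, the power of n + 1 from |y|^2 + \<epsilon> <= (n + 1) (t k)^2, the last
    factor from the cut-off.\<close>
  define c1 where "c1 = 3 / 4 * (?n + 1) powr (- (?n / 2)) * bump (r\<^sup>2 / 2)"
  have c1: "c1 > 0" using bump_simps(3)[of "r\<^sup>2 / 2"] r2
      by (auto simp: c1_def add_nonneg_pos intro!: mult_pos_pos)
  have disj: "y \<notin> A k" if y: "y \<in> A j" and "k \<noteq> j" for y j k
  proof
    assume y': "y \<in> A k"
    have *: "3 / 4 * t i \<le> y \<bullet> b1" "y \<bullet> b1 \<le> t i" if "y \<in> A i" for i
      using that by (auto simp: A_def mem_dyadic_box[OF b])
    \<comment> \<open>With t taken at the smaller index, the box of larger index forces y \<bullet>
      b1 <= t / 2 and the other one y \<bullet> b1 >= 3 t / 4.\<close>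
    have "t (max j k) \<le> t (Suc (min j k))" using \<open>k \<noteq> j\<close> unfolding t_def by (intro power_decreasing) auto
    then have "t (max j k) \<le> t (min j k) / 2" by (simp add: t_def)
    moreover have "3 / 4 * t (min j k) \<le> y \<bullet> b1" "y \<bullet> b1 \<le> t (max j k)"
      using *[OF y] *[OF y'] by (auto simp: min_def max_def)
    ultimately show False using t(1)[of "min j k"] by linarith
  qed
  have sum_le: "(\<Sum>k=k0..<N. c * c1 / (real k + 1)) \<le> B" for N
  proof -
    \<comment> \<open>This is (t N)^2, hence at most (t k)^2 for all k < N: the regularisation acts
      below the scales in use.\<close>
    define \<epsilon> where "\<epsilon> = (1/4 :: real) ^ N"
    have \<epsilon>: "\<epsilon> > 0" by (simp add: \<epsilon>_def)
    let ?\<psi> = "dipole b1 r \<epsilon>"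
    define f where "f y = indicator \<Gamma> y * (g y * ?\<psi> y)" for y
    have \<psi>out: "?\<psi> y = 0" if "y \<notin> ball 0 (1/2)" for y
      using that r by (intro dipole_outside) auto
    have f_eq: "f y = indicator (\<Gamma> \<inter> ball 0 (1/2)) y * (eta (y \<bullet> b1) * ?\<psi> y)" for y
      using geta[of y] \<psi>out[of y] by (auto simp: f_def split: split_indicator)
    \<comment> \<open>The dipole is negative only where y \<bullet> b1 < 0, and there
      \<open>eta\<close> vanishes. This allows discarding everything outside the boxes.\<close>
    have f_nonneg: "f y \<ge> 0" for y
    proof (cases "0 < y \<bullet> b1")
      case True
      then show ?thesis unfolding f_eq dipole_def
        by (intro mult_nonneg_nonneg eta_nonneg bump_simps) auto
    next
      case False
      then show ?thesis by (simp add: f_eq eta_def)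
    qed
    have cont\<psi>: "continuous_on UNIV ?\<psi>" using smooth_on_imp_continuous_on[OF smooth_on_dipole[OF \<epsilon>]] .
    then have [measurable]: "?\<psi> \<in> borel_measurable borel" by (rule borel_measurable_continuous_onI)
    obtain M where M: "M \<ge> 0" "\<And>x. \<bar>?\<psi> x\<bar> \<le> M"
      using bounded_compact_support[OF compact_cball continuous_on_subset[OF cont\<psi> subset_UNIV] dipole_outside[OF _ r(1)]] by blast
    note \<Gamma> [measurable]
    have int_f: "integrable ?H f"
    proof (rule Bochner_Integration.integrable_bound)
      show "integrable ?H (\<lambda>y. indicator \<Gamma> y * (1 / ln 2 * M))"
        using \<Gamma> fin by (intro integrable_mult_left) (simp add: integrable_indicator_iff)
      have [measurable]: "ball (0::'a) (1/2) \<in> sets borel" by simp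
      have "f \<in> borel_measurable borel" unfolding f_eq[abs_def] by measurable
      then show "f \<in> borel_measurable ?H"
        by (simp add: measurable_cong_sets[OF sets_hausdorff_measure refl])
      show "AE y in ?H. norm (f y) \<le> norm (indicator \<Gamma> y * (1 / ln 2 * M))"
      proof (rule AE_I2)
        fix y
        show "norm (f y) \<le> norm (indicator \<Gamma> y * (1 / ln 2 * M))"
        proof (cases "y \<in> \<Gamma> \<inter> ball 0 (1/2)")
          case True
          have "y \<bullet> b1 < 1/2" using Basis_le_norm[OF b(1), of y] True by auto
          then have "\<bar>eta (y \<bullet> b1)\<bar> * \<bar>?\<psi> y\<bar> \<le> 1 / ln 2 * M"
            using eta_le eta_nonneg M by (intro mult_mono) auto
          then show ?thesis using True M by (simp add: f_eq abs_mult)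
        qed (auto simp: f_eq)
      qed
    qed
    have low: "c1 * (t k / t k ^ DIM('a)) / (real k + 1) \<le> f y" if y: "y \<in> A k" and k: "k0 \<le> k" "k < N" for y k
    proof -
      have ys: "y \<bullet> y \<le> r\<^sup>2 / 2" using A_small[OF y k(1)] .
      then have "y \<bullet> y \<le> r\<^sup>2" using r2 by linarith
      then have "y \<in> \<Gamma> \<inter> ball 0 (1/2)" using subsetD[OF A_sub[OF k(1)] y] in_ball by blast
      then have fy: "f y = eta (y \<bullet> b1) * ((y \<bullet> b1) * ((y \<bullet> y + \<epsilon>) powr (- (?n / 2)) * bump (r\<^sup>2 - y \<bullet> y)))"
        by (simp add: f_eq dipole_def)
      have y1: "3 / 4 * t k \<le> y \<bullet> b1" using y by (simp add: A_def mem_dyadic_box[OF b])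
      have "y \<bullet> b1 < 1/2" using Basis_le_norm[OF b(1), of y] \<open>y \<in> \<Gamma> \<inter> ball 0 (1/2)\<close> by auto
      then have e1: "1 / (real k + 1) \<le> eta (y \<bullet> b1)" using y1 unfolding t_def by (intro eta_dyadic) auto
      have "\<epsilon> \<le> (t k)\<^sup>2" unfolding \<epsilon>_def t using k(2) by (intro power_decreasing) auto
      then have "y \<bullet> y + \<epsilon> \<le> (?n + 1) * (t k)\<^sup>2" using A_norm[OF y] by (simp add: algebra_simps)
      moreover have "0 < y \<bullet> y + \<epsilon>" using \<epsilon> by (simp add: add_nonneg_pos)
      ultimately have "((?n + 1) * (t k)\<^sup>2) powr (- (?n / 2)) \<le> (y \<bullet> y + \<epsilon>) powr (- (?n / 2))"
        by (intro powr_mono2') auto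
      moreover have "((?n + 1) * (t k)\<^sup>2) powr (- (?n / 2)) = (?n + 1) powr (- (?n / 2)) * (1 / t k ^ DIM('a))"
      proof -
        have "(t k)\<^sup>2 = t k powr 2" using t(1)[of k] by simp
        then have "((t k)\<^sup>2) powr (- (?n / 2)) = t k powr (- ?n)" by (simp add: powr_powr)
        also have "\<dots> = 1 / t k ^ DIM('a)" using t(1)[of k]
            by (simp add: powr_minus powr_realpow inverse_eq_divide)
        finally show ?thesis by (simp add: powr_mult)
      qed
      ultimately have e2: "(?n + 1) powr (- (?n / 2)) * (1 / t k ^ DIM('a)) \<le> (y \<bullet> y + \<epsilon>) powr (- (?n / 2))"
          by simp
      have e3: "bump (r\<^sup>2 / 2) \<le> bump (r\<^sup>2 - y \<bullet> y)" using ys r2 by (intro bump_mono) auto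
      have "1 / (real k + 1) * (3 / 4 * t k * ((?n
          + 1) powr (- (?n / 2)) * (1 / t k ^ DIM('a)) * bump (r\<^sup>2 / 2))) \<le> f y"
        unfolding fy
        by (intro mult_mono e1 y1 e2 e3 mult_nonneg_nonneg bump_simps eta_nonneg)
          (use y1 t(1)[of k] in \<open>auto intro: less_imp_le\<close>)
      then show ?thesis by (simp add: c1_def mult_ac)
    qed
    \<comment> \<open>The bound of \<open>low\<close> on the k-th box. The box has measure at least
      c (t k)^(n-1), which cancels the power (t k)^(1-n) and leaves 1 / (k + 1).\<close>
    define v where "v k = c1 * (t k / t k ^ DIM('a)) / (real k + 1)" for k
    have v0: "v k \<ge> 0" for k using c1 t(1)[of k]
        by (auto simp: v_def intro!: divide_nonneg_nonneg mult_nonneg_nonneg)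
    have int_A: "integrable ?H (\<lambda>y. v k * indicator (A k) y)" if "k \<ge> k0" for k
      using A_fin[OF that] by (intro integrable_mult_right) (simp add: integrable_indicator_iff)
    have "(\<Sum>k=k0..<N. c * c1 / (real k + 1)) \<le> (\<Sum>k=k0..<N. v k * measure ?H (A k))"
    proof (intro sum_mono)
      fix k assume "k \<in> {k0..<N}"
      then have "v k * (c * t k ^ ?d) \<le> v k * measure ?H (A k)"
        using A_low v0 by (intro mult_left_mono) auto
      moreover have "v k * (c * t k ^ ?d) = c * c1 / (real k + 1)"
      proof -
        have "DIM('a) = Suc ?d" using n2 by simp
        then have "t k ^ DIM('a) = t k * t k ^ ?d" by (metis power_Suc)
        then have "t k / t k ^ DIM('a) * t k ^ ?d = 1" using t(1)[of k] by simp
        then have "c1 * (t k / t k ^ DIM('a) * t k ^ ?d) * c / (real k + 1) = c * c1 / (real k + 1)" by simp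
        then show ?thesis by (simp add: v_def mult_ac)
      qed
      ultimately show "c * c1 / (real k + 1) \<le> v k * measure ?H (A k)" by simp
    qed
    also have "\<dots> = (LINT y|?H. (\<Sum>k=k0..<N. v k * indicator (A k) y))"
      using int_A by (subst Bochner_Integration.integral_sum) auto
    also have "\<dots> \<le> (LINT y|?H. f y)"
    proof (intro integral_mono Bochner_Integration.integrable_sum int_A int_f)
      fix y
      show "(\<Sum>k=k0..<N. v k * indicator (A k) y) \<le> f y"
      proof (cases "\<exists>j\<in>{k0..<N}. y \<in> A j")
        case True
        then obtain j where j: "j \<in> {k0..<N}" "y \<in> A j" by blast
        have "(\<Sum>k=k0..<N. v k * indicator (A k) y) = (\<Sum>k\<in>{j}. v k * indicator (A k) y)"
          using j disj by (intro sum.mono_neutral_right) auto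
        also have "\<dots> \<le> f y" using low[OF j(2)] j by (simp add: v_def)
        finally show ?thesis .
      next
        case False
        then have "(\<Sum>k=k0..<N. v k * indicator (A k) y) = 0" by (intro sum.neutral) auto
        then show ?thesis using f_nonneg[of y] by simp
      qed
    qed auto
    also have "\<dots> = (LINT y:\<Gamma>|?H. g y * ?\<psi> y)" by (simp add: set_lebesgue_integral_def f_def)
    also have "\<dots> = (LINT x:ball 0 1|lborel. u x * laplacian ?\<psi> x)"
      using u dipole_test_function[OF \<epsilon> r(1) cb(2)] by (simp add: weak_solution_def)
    also have "\<dots> = (LINT x|lborel. u x * laplacian ?\<psi> x)"
      by (rule set_integral_laplacian_test_function[OF dipole_test_function[OF \<epsilon> r(1) cb(2)]])
    also have "\<dots> \<le> B" using B[OF \<epsilon>] by linarith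
    finally show ?thesis .
  qed
  \<comment> \<open>B is independent of \<epsilon>, hence of N, so all partial sums of a shifted
    harmonic series are bounded by it.\<close>
  have "summable (\<lambda>k. c * c1 / (real (k + k0) + 1))"
  proof (rule summableI_nonneg_bounded)
    show "0 \<le> c * c1 / (real (k + k0) + 1)" for k using c(1) c1 by simp
    show "(\<Sum>k<m. c * c1 / (real (k + k0) + 1)) \<le> B" for m
      using sum_le[of "k0 + m"] sum.shift_bounds_nat_ivl[of "\<lambda>k. c * c1 / (real k + 1)" 0 k0 m]
      by (simp add: atLeast0LessThan add.commute)
  qed
  then have "summable (\<lambda>k. inverse (c * c1) * (c * c1 / (real (k + k0) + 1)))" by (rule summable_mult)
  then have "summable (\<lambda>k. inverse (real (k + Suc k0)))" using c(1) c1 by (simp add: field_simps)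
  then have "summable (\<lambda>k. inverse (real k))" by (subst (asm) summable_iff_shift)
  then show False using not_summable_harmonic[where 'a=real] by simp
qed

text \<open>Brings \<Gamma> and g into the form of \<open>surface_measure\<close>. Finiteness of the
  surface measure is recorded as well, because the pairing of g with the dipole has to be
  integrable.\<close>

lemma smooth_closed_hypersurface_weak_solution:
  fixes \<Gamma> :: "'a::euclidean_space set" and b1 :: 'a
  assumes n: "DIM('a) \<ge> 2" and b1: "b1 \<in> Basis" and hyp: "smooth_closed_hypersurface \<Gamma>" and sub: "\<Gamma> \<subseteq> ball 0 1"
    and smooth: "smooth_on_subset (\<Gamma> - ball 0 (1/2)) g"
    and geta: "\<And>x. x \<in> \<Gamma> \<inter> ball 0 (1/2) \<Longrightarrow> g x = eta (x \<bullet> b1)"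
  shows "\<exists>u. weak_solution (ball 0 1) \<Gamma> g u"
    and "emeasure (hausdorff_measure (DIM('a) - 1)) \<Gamma> < \<infinity>"
proof -
  let ?d = "DIM('a) - 1" and ?H = "hausdorff_measure (DIM('a) - 1) :: 'a measure"
  have comp: "compact \<Gamma>" using hyp by (simp add: smooth_closed_hypersurface_def)
  have \<Gamma> [measurable]: "\<Gamma> \<in> sets borel" using comp by (simp add: borel_compact)
  obtain C where C: "C \<ge> 0" "\<And>x r. r > 0 \<Longrightarrow> hausdorff_outer ?d (\<Gamma> \<inter> ball x r) \<le> ennreal (C * r ^ ?d)"
    using smooth_closed_hypersurface_growth[OF hyp] by blast
  have "hausdorff_outer ?d \<Gamma> \<le> ennreal (C * 1 ^ ?d)" using C(2)[of 1 0] sub by (simp add: Int_absorb2)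
  then show fin: "emeasure ?H \<Gamma> < \<infinity>"
    by (simp add: emeasure_hausdorff_measure[OF \<Gamma>] le_less_trans)
  define M where "M = density ?H (\<lambda>x. ennreal (indicator \<Gamma> x))"
  \<comment> \<open>g is controlled on \<Gamma> only. This version agrees with g there and is 0
    elsewhere; it is Borel and bounded on the whole space, being \<open>eta\<close> on the flat part
    and continuous on the compact rest of \<Gamma>.\<close>
  define g' where "g' x = indicator (\<Gamma> \<inter> ball 0 (1/2)) x * eta (x \<bullet> b1) + indicator (\<Gamma>
      - ball 0 (1/2)) x * g x" for x
  have g': "g' x = g x" if "x \<in> \<Gamma>" for x 
    using geta[of x] that by (cases "x \<in> ball 0 (1/2)") (simp_all add: g'_def indicator_def)
  have cg: "continuous_on (\<Gamma> - ball 0 (1/2)) g" using smooth by (rule smooth_on_subset_imp_continuous_on)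
  have g'_meas: "g' \<in> borel_measurable borel"
  proof -
    have [measurable]: "ball (0::'a) (1/2) \<in> sets borel" by simp
    have "(\<lambda>x. indicator (\<Gamma> - ball 0 (1/2)) x *\<^sub>R g x) \<in> borel_measurable borel"
      by (rule borel_measurable_continuous_on_indicator[OF _ cg]) measurable
    then show ?thesis unfolding g'_def by simp
  qed
  have "bounded (g ` (\<Gamma> - ball 0 (1/2)))"
    using comp by (intro compact_imp_bounded compact_continuous_image cg compact_diff) auto
  then obtain B0 where "\<forall>z\<in>g ` (\<Gamma> - ball 0 (1/2)). norm z \<le> B0" unfolding bounded_iff by blast
  then have B0: "\<bar>g x\<bar> \<le> B0" if "x \<in> \<Gamma> - ball 0 (1/2)" for x using that by auto
  define B where "B = max (max B0 (1 / ln 2)) 0"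
  have B: "\<bar>g' x\<bar> \<le> B" for x
  proof (cases "x \<in> \<Gamma> \<inter> ball 0 (1/2)")
    case True
    have "x \<bullet> b1 < 1/2" using Basis_le_norm[OF b1, of x] True by auto
    then have "\<bar>eta (x \<bullet> b1)\<bar> \<le> 1 / ln 2" using eta_le eta_nonneg by simp
    then show ?thesis using True by (simp add: g'_def B_def le_max_iff_disj)
  next
    case False
    then show ?thesis using B0[of x] by (auto simp: g'_def B_def le_max_iff_disj split: split_indicator)
  qed
  \<comment> \<open>A nonempty compact set in the open unit ball has a largest norm, which is below
    1.\<close>
  obtain \<rho> where \<rho>: "\<rho> < 1" "\<And>y. y \<in> \<Gamma> \<Longrightarrow> norm y \<le> \<rho>"
  proof (cases "\<Gamma> = {}")
    case False
    then obtain m where "m \<in> \<Gamma>" "\<And>y. y \<in> \<Gamma> \<Longrightarrow> norm y \<le> norm m"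
      using continuous_attains_sup[OF comp False continuous_on_norm[OF continuous_on_id]] by auto
    then show thesis using sub by (intro that[of "norm m"]) auto
  qed (auto intro: that[of 0])
  interpret surface_measure M C \<rho> B g'
  proof
    show "sets M = sets borel" by (simp add: M_def)
    show "emeasure M (ball x r) \<le> ennreal (C * r ^ ?d)" if "r > 0" for x r
    proof -
      have "emeasure M (ball x r) = emeasure ?H (\<Gamma> \<inter> ball x r)"
        unfolding M_def by (rule emeasure_density_indicator) auto
      also have "\<dots> = hausdorff_outer ?d (\<Gamma> \<inter> ball x r)" by (rule emeasure_hausdorff_measure) auto
      finally show ?thesis using C(2)[OF that] by simp
    qed
    show "AE y in M. norm y \<le> \<rho>"
      unfolding M_def by (subst AE_density) (auto intro!: AE_I2 \<rho>(2) split: split_indicator)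
  qed (use n C B \<rho> g'_meas in auto)
  have "weak_solution (ball 0 1) \<Gamma> g potential"
    unfolding weak_solution_def
  proof (intro conjI ballI)
    show "continuous_on (closure (ball 0 1)) potential" using continuous_on_potential by simp
    show "potential x = 0" if "x \<in> frontier (ball 0 1)" for x
      using that by (intro potential_boundary) (auto simp: frontier_ball)
    show "(LINT x:ball 0 1|lborel. potential x * laplacian \<phi> x) = (LINT x:\<Gamma>|?H. g x * \<phi> x)"
      if \<phi>: "\<phi> \<in> test_functions (ball 0 1)" for \<phi>
    proof -
      have "smooth_on UNIV \<phi>" using \<phi> by (simp add: test_functions_def)
      then have "continuous_on UNIV \<phi>" by (rule smooth_on_imp_continuous_on)
      then have "\<phi> \<in> borel_measurable borel" by (rule borel_measurable_continuous_onI)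
      with g'_meas have m: "(\<lambda>x. g' x * \<phi> x) \<in> borel_measurable ?H"
        by (simp add: borel_measurable_times measurable_cong_sets[OF sets_hausdorff_measure refl])
      have "(LINT x:ball 0 1|lborel. potential x * laplacian \<phi> x) = (LINT y|M. g' y * \<phi> y)"
        using set_integral_laplacian_test_function[OF \<phi>] potential_weak_solution[OF \<phi>] by simp
      also have "\<dots> = (LINT x:\<Gamma>|?H. g' x * \<phi> x)"
        unfolding M_def using m by (intro lebesgue_integral_density_indicator) auto
      also have "\<dots> = (LINT x:\<Gamma>|?H. g x * \<phi> x)"
        unfolding set_lebesgue_integral_def
        by (intro Bochner_Integration.integral_cong) (auto simp: g' split: split_indicator)
      finally show ?thesis .
    qed
  qed
  then show "\<exists>u. weak_solution (ball 0 1) \<Gamma> g u" by blast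
qed

theorem theorem3p2:
  fixes \<Gamma> :: "(real ^ 'n) set" and g :: "real ^ 'n \<Rightarrow> real"
    and i1 iN :: 'n  \<comment> \<open>the indices of the coordinates \<open>x\<^sub>1\<close> and \<open>x\<^sub>n\<close>\<close>
  assumes "CARD('n) \<ge> 2" and "i1 \<noteq> iN"
    and "smooth_closed_hypersurface \<Gamma>" and "\<Gamma> \<subseteq> ball 0 1"
    and "\<Gamma> \<inter> ball 0 (1/2) = {x. x $ iN = 0} \<inter> ball 0 (1/2)"
    and "smooth_on_subset (\<Gamma> - ball 0 (1/2)) g"
    and "\<forall>x \<in> \<Gamma> \<inter> ball 0 (1/2). g x = eta (x $ i1)"
  shows "\<exists>u. weak_solution (ball 0 1) \<Gamma> g u \<and>
             (\<forall>v. weak_solution (ball 0 1) \<Gamma> g v \<longrightarrow> (\<forall>x \<in> closure (ball 0 1). v x = u x)) \<and>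
             \<not> locally_lipschitz_on (ball 0 1) u"
proof -
  let ?b1 = "axis i1 1 :: real ^ 'n" and ?bN = "axis iN 1 :: real ^ 'n"
  have b: "?b1 \<in> Basis" "?bN \<in> Basis" "?b1 \<noteq> ?bN"
    using assms(2) by (simp_all add: axis_in_Basis_iff axis_eq_axis)
  have coord: "x \<bullet> axis i 1 = x $ i" for x :: "real ^ 'n" and i by (simp add: inner_axis)
  have geta: "g x = eta (x \<bullet> ?b1)" if "x \<in> \<Gamma> \<inter> ball 0 (1/2)" for x
    using assms(7) that by (simp add: coord)
  have dim: "DIM(real ^ 'n) \<ge> 2" using assms(1) by simp
  have flat: "\<Gamma> \<inter> ball 0 (1/2) = {x. x \<bullet> ?bN = 0} \<inter> ball 0 (1/2)"
    using assms(5) by (simp add: coord)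
  note ex = smooth_closed_hypersurface_weak_solution[OF dim b(1) assms(3,4,6) geta]
  obtain u where u: "weak_solution (ball 0 1) \<Gamma> g u" using ex(1) by blast
  have "\<Gamma> \<in> sets borel"
    using assms(3) by (simp add: smooth_closed_hypersurface_def borel_compact)
  from weak_solution_not_lipschitz[OF b this ex(2) flat geta u]
  have "\<not> locally_lipschitz_on (ball 0 1) u" .
  then show ?thesis using u weak_solution_unique[OF u] by blast
qed

end
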